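(* Let $G$ be any simple directed graph and let $m\geq 1$ be an integer. Then $\operatorname{proj\,dim} I_{G\to D_m}=\alpha(G^* )(m-1)$, where $G^*$ is the simple acyclic directed graph obtained from $G$ by shrinking directed cycles and taking transitive closure.
   Context: Directed graphs are finite with nonempty vertex sets; simple means the underlying graph has no loops and no multiple edges. $D_m$ is the directed graph on $[m]=\{1,\dots,m\}$ in which $(i,j)$ is an edge if and only if $i<j$. For directed graphs $G$ on $[n]$ and $H$ on $[m]$, a weak graph homomorphism from $G$ to $H$ is a map $\phi:V(G)\to V(H)$ such that for every $(x,y)\in E(G)$ either $\phi(x)=\phi(y)$ or $(\phi(x),\phi(y))\in E(H)$; the set of these is $\mathrm{WHom}(G,H)$. Let $K$ be a field, $S=K[x_{ij}: i\in[n], j\in[m]]$, $u_\phi=\prod_{i=1}^n x_{i\phi(i)}$ and $I_{G\to H}=(u_\phi:\phi\in\mathrm{WHom}(G,H))\subseteq S$. $\operatorname{proj\,dim}$ is projective dimension as an $S$-module. Shrinking: if $C$ is a directed cycle of a directed graph $G$, the graph obtained by shrinking $C$ has vertex set $(V(G)\setminus V(C))\cup\{0\}$ with $0$ a new vertex, and its edges are the edges of $G\setminus V(C)$, the pairs $(0,i)$ with $i\notin V(C)$ and $(j,i)\in E(G)$ for some $j\in V(C)$, and the pairs $(i,0)$ with $i\notin V(C)$ and $(i,j)\in E(G)$ for some $j\in V(C)$. The result need not be simple: both $(0,i)$ and $(i,0)$ may occur, and these then form a directed cycle of length two, which may be shrunk as well. The transitive closure of an acyclic directed graph has the same vertices,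 and edges $(i,j)$ for $i\ne j$ such that there is a directed path from $i$ to $j$. The graph $G^*$ is obtained by repeatedly shrinking directed cycles until the resulting graph is a simple acyclic directed graph, and then taking its transitive closure. $\alpha(G^* )$ is the largest size of a set of vertices of $G^*$ with no edge between any two of them. *)

theory Defs
  imports
    "HOL-Algebra.Algebra"
    "HOL-Algebra.Algebraic_Closure_Type"
    "HOL-Library.Poly_Mapping"
    "HOL-Library.Extended_Nat"
    "Graph_Theory.Pair_Digraph"
begin

section \<open>Projective dimension\<close>

definition mod_hom ::
    "('r, 'c) ring_scheme \<Rightarrow> ('r, 'a, 'd) module_scheme \<Rightarrow> ('r, 'b, 'e) module_scheme \<Rightarrow> ('a \<Rightarrow> 'b) set"
  where "mod_hom R M N =
    {h. h \<in> carrier M \<rightarrow> carrier N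
      \<and> (\<forall>x\<in>carrier M. \<forall>y\<in>carrier M. h (x \<oplus>\<^bsub>M\<^esub> y) = h x \<oplus>\<^bsub>N\<^esub> h y)
      \<and> (\<forall>r\<in>carrier R. \<forall>x\<in>carrier M. h (r \<odot>\<^bsub>M\<^esub> x) = r \<odot>\<^bsub>N\<^esub> h x)}"

text \<open>The lifting property of a projective module \<open>P\<close>. A definition in HOL cannot quantify over
  the types carrying the test modules. With targets \<open>B\<close> in the type \<open>'a\<close> of \<open>P\<close> and sources \<open>A\<close> in
  \<open>'a \<Rightarrow> 'r\<close> nothing is lost: \<open>A\<close> may be the free module on the set \<open>carrier P\<close> and \<open>B\<close> may be \<open>P\<close>
  itself, so that \<open>P\<close> is a direct summand of a free module and has the lifting property against
  all epimorphisms of modules, whatever their types.\<close>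

definition projective_module :: "('r, 'c) ring_scheme \<Rightarrow> ('r, 'a) module \<Rightarrow> bool"
  where "projective_module R P \<longleftrightarrow> Module.module R P \<and>
    (\<forall>(A :: ('r, 'a \<Rightarrow> 'r) module) (B :: ('r, 'a) module) g f.
       Module.module R A \<and> Module.module R B
       \<and> g \<in> mod_hom R A B \<and> g ` carrier A = carrier B \<and> f \<in> mod_hom R P B
       \<longrightarrow> (\<exists>h\<in>mod_hom R P A. \<forall>x\<in>carrier P. g (h x) = f x))"

text \<open>An exact sequence \<open>0 \<rightarrow> P l \<rightarrow> \<dots> \<rightarrow> P 1 \<rightarrow> P 0 \<rightarrow> M \<rightarrow> 0\<close> with all \<open>P i\<close> projective, where
  \<open>\<delta> i\<close> maps \<open>P (Suc i)\<close> to \<open>P i\<close> and \<open>\<epsilon>\<close> is the augmentation. The entries of \<open>P\<close> beyond \<open>l\<close>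
  are irrelevant.\<close>

definition projective_resolution ::
    "('r, 'c) ring_scheme \<Rightarrow> ('r, 'a, 'd) module_scheme \<Rightarrow> nat \<Rightarrow> (nat \<Rightarrow> ('r, 'b) module)
      \<Rightarrow> (nat \<Rightarrow> 'b \<Rightarrow> 'b) \<Rightarrow> ('b \<Rightarrow> 'a) \<Rightarrow> bool"
  where "projective_resolution R M l P \<delta> \<epsilon> \<longleftrightarrow>
    (let ker = (\<lambda>i. case i of 0 \<Rightarrow> a_kernel (P 0) M \<epsilon> | Suc j \<Rightarrow> a_kernel (P (Suc j)) (P j) (\<delta> j))
     in (\<forall>i\<le>l. projective_module R (P i))
      \<and> \<epsilon> \<in> mod_hom R (P 0) M \<and> \<epsilon> ` carrier (P 0) = carrier M
      \<and> (\<forall>i<l. \<delta> i \<in> mod_hom R (P (Suc i)) (P i) \<and> \<delta> i ` carrier (P (Suc i)) = ker i)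
      \<and> ker l = {\<zero>\<^bsub>P l\<^esub>})"

text \<open>The infimum is \<open>\<infinity>\<close> if there is no finite resolution. The modules of a resolution are taken in
  the type \<open>'a + nat \<Rightarrow> 'r\<close>. This is large enough: a module having a projective resolution of
  length \<open>l\<close> also has one in which all modules but the last are the free modules on
  the underlying set of the preceding kernel and the last one is a kernel, and (over a nonzero
  ring) the cardinality of these is at most that of \<open>'a + nat \<Rightarrow> 'r\<close>.\<close>

definition proj_dim :: "('r, 'c) ring_scheme \<Rightarrow> ('r, 'a, 'd) module_scheme \<Rightarrow> enat"
  where "proj_dim R M =
    Inf {enat l | l (P :: nat \<Rightarrow> ('r, 'a + nat \<Rightarrow> 'r) module) \<delta> \<epsilon>. projective_resolution R M l P \<delta> \<epsilon>}"

definition ideal_module :: "('r, 'c) ring_scheme \<Rightarrow> 'r set \<Rightarrow> ('r, 'r) module"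
  where "ideal_module R I =
    \<lparr>carrier = I, monoid.mult = monoid.mult R, monoid.one = \<one>\<^bsub>R\<^esub>, ring.zero = \<zero>\<^bsub>R\<^esub>,
      ring.add = ring.add R, module.smult = monoid.mult R\<rparr>"


section \<open>Polynomial rings\<close>

text \<open>Monomials are exponent vectors of finite support in the indeterminates \<open>'x\<close>.\<close>

type_synonym ('x, 'k) mpoly = "('x \<Rightarrow>\<^sub>0 nat) \<Rightarrow>\<^sub>0 'k"

definition indet :: "'x \<Rightarrow> ('x, 'k::field) mpoly"
  where "indet x = Poly_Mapping.single (Poly_Mapping.single x 1) 1"

definition mpoly_ring :: "'x set \<Rightarrow> ('x, 'k::field) mpoly ring"
  where "mpoly_ring V =
    ring_of_type_algebra \<lparr>carrier := {p. \<forall>t\<in>Poly_Mapping.keys p. Poly_Mapping.keys t \<subseteq> V}\<rparr>"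


section \<open>Directed graphs\<close>

definition simple_digraph :: "'v pair_pre_digraph \<Rightarrow> bool"
  where "simple_digraph G \<longleftrightarrow> pair_digraph G \<and> pverts G \<noteq> {}
    \<and> (\<forall>u v. (u, v) \<in> parcs G \<longrightarrow> (v, u) \<notin> parcs G)"

definition D :: "nat \<Rightarrow> nat pair_pre_digraph"
  where "D m = \<lparr>pverts = {1..m}, parcs = {(i, j). i \<in> {1..m} \<and> j \<in> {1..m} \<and> i < j}\<rparr>"

definition WHom :: "'v pair_pre_digraph \<Rightarrow> 'w pair_pre_digraph \<Rightarrow> ('v \<Rightarrow> 'w) set"
  where "WHom G H = {\<phi> \<in> pverts G \<rightarrow>\<^sub>E pverts H.
    \<forall>(x, y)\<in>parcs G. \<phi> x = \<phi> y \<or> (\<phi> x, \<phi> y) \<in> parcs H}"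

definition hom_ring ::
    "'v pair_pre_digraph \<Rightarrow> 'w pair_pre_digraph \<Rightarrow> ('v \<times> 'w, 'k::field) mpoly ring"
  where "hom_ring G H = mpoly_ring (pverts G \<times> pverts H)"

definition hom_monomial :: "'v pair_pre_digraph \<Rightarrow> ('v \<Rightarrow> 'w) \<Rightarrow> ('v \<times> 'w, 'k::field) mpoly"
  where "hom_monomial G \<phi> = (\<Prod>i\<in>pverts G. indet (i, \<phi> i))"

definition hom_ideal ::
    "'v pair_pre_digraph \<Rightarrow> 'w pair_pre_digraph \<Rightarrow> ('v \<times> 'w, 'k::field) mpoly set"
  where "hom_ideal G H = genideal (hom_ring G H) (hom_monomial G ` WHom G H)"

definition acyclic_digraph :: "'v pair_pre_digraph \<Rightarrow> bool"
  where "acyclic_digraph G \<longleftrightarrow> \<not> (\<exists>p. pre_digraph.cycle (with_proj G) p)"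

text \<open>Cycles are lists of arcs, so the vertices of a cycle are the tails of its arcs.\<close>

definition shrink :: "'v pair_pre_digraph \<Rightarrow> ('v \<times> 'v) awalk \<Rightarrow> 'v \<Rightarrow> 'v pair_pre_digraph"
  where "shrink G p z = (let C = fst ` set p in
    \<lparr>pverts = (pverts G - C) \<union> {z},
     parcs = {(i, j). (i, j) \<in> parcs G \<and> i \<notin> C \<and> j \<notin> C}
       \<union> {(z, i) | i. i \<in> pverts G - C \<and> (\<exists>j\<in>C. (j, i) \<in> parcs G)}
       \<union> {(i, z) | i. i \<in> pverts G - C \<and> (\<exists>j\<in>C. (i, j) \<in> parcs G)}\<rparr>)"

definition shrink_step :: "'v pair_pre_digraph \<Rightarrow> 'v pair_pre_digraph \<Rightarrow> bool"
  where "shrink_step G G' \<longleftrightarrow>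
    (\<exists>p z. pre_digraph.cycle (with_proj G) p \<and> z \<notin> pverts G \<and> G' = shrink G p z)"

definition transitive_closure :: "'v pair_pre_digraph \<Rightarrow> 'v pair_pre_digraph"
  where "transitive_closure G =
    \<lparr>pverts = pverts G, parcs = {(i, j). (i, j) \<in> (parcs G)\<^sup>+ \<and> i \<noteq> j}\<rparr>"

text \<open>\<open>G\<^sup>*\<close> depends, up to isomorphism only, on the choice of the cycles to be shrunk and of the new
  vertices. It is therefore described by the relation that \<open>H\<close> is an outcome of the construction.\<close>

definition is_star :: "'v pair_pre_digraph \<Rightarrow> 'v pair_pre_digraph \<Rightarrow> bool"
  where "is_star G H \<longleftrightarrow>
    (\<exists>G'. shrink_step\<^sup>*\<^sup>* G G' \<and> simple_digraph G' \<and> acyclic_digraph G' \<and> H = transitive_closure G')"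

definition independence_number :: "'v pair_pre_digraph \<Rightarrow> nat"
  where "independence_number H =
    Max {card A | A. A \<subseteq> pverts H \<and> (\<forall>x\<in>A. \<forall>y\<in>A. (x, y) \<notin> parcs H)}"

end

theory Submission
  imports Defs "HOL-Library.Product_Lexorder"
begin

text \<open>Monotone maps from the poset \<open>P\<close> of strongly connected components of \<open>G\<close> to a chain are the
  vertices of a polyhedral complex. Its cells are the products of simplices \<open>\<Prod>\<^sub>c F\<^sub>c\<close> with nonempty
  \<open>F\<^sub>c \<subseteq> {1..m}\<close> such that \<open>max F\<^sub>c \<le> min F\<^sub>d\<close> whenever \<open>c < d\<close>. This complex supports a free resolution
  of the ideal: in each multidegree the subcomplex collapses onto its least vertex. The cells have
  dimension at most \<open>\<alpha> (m - 1)\<close>, since for each \<open>j < m\<close> the \<open>c\<close> with \<open>j \<in> F\<^sub>c\<close> and \<open>j < max F\<^sub>c\<close> form an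
  antichain.

  Conversely let \<open>A\<close> be an antichain of size \<open>\<alpha>\<close> and let \<open>y\<^sub>c\<^sub>j\<close> be the product of the \<open>x\<^sub>v\<^sub>j\<close> over the
  vertices \<open>v\<close> of the component \<open>c\<close>. The Koszul complex of the \<open>y\<^sub>c\<^sub>j\<close>, \<open>c \<in> A\<close>, is exact on projective
  modules, so by dimension shifting a module with a resolution of length \<open>l\<close> has no Koszul homology
  above degree \<open>l\<close>. The product over \<open>c \<in> A\<close> of the boundaries of \<open>e\<^sub>c\<^sub>1 \<and> \<dots> \<and> e\<^sub>c\<^sub>m\<close> is a cycle of degree
  \<open>\<alpha> (m - 1)\<close>; up to a common factor its coefficients are minimal generators of the ideal, so it is
  no boundary.\<close>

section \<open>Module homomorphisms and free modules\<close>

text \<open>The lower bound has to hold for every resolution by projective modules, not only for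
  minimal free ones, so reading it off the cellular resolution would require a comparison of
  resolutions. Koszul homology avoids this: it is computed from the module alone, and of a
  projective module it needs only that it is a summand of a free one. The factor
  \<open>m - 1\<close> arises because the boundary of \<open>e_c1 \<and> ... \<and> e_cm\<close> has
  terms of degree \<open>m - 1\<close>. Its coefficients are the \<open>y_cj\<close>, so the product
  over the antichain has one coefficient for each map from \<open>A\<close> to
  \<open>{1..m}\<close>; a fixed extension of these maps to the remaining components is the common
  factor. In both halves exactness over the polynomial ring is reduced to linear algebra over the
  field, one multidegree at a time. This works because distinct labels \<open>y_cj\<close> are
  coprime, so that a multidegree sees exactly the sets whose elements all have labels dividing it.
  Shrinking preserves reachability up to a surjection on vertices. The algebra therefore refers only
  to reachability in \<open>G\<close> itself, and \<open>G*\<close> enters through its independence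
  number alone.\<close>

lemma mod_homD:
  assumes "h \<in> mod_hom R M N"
  shows "\<And>x. x \<in> carrier M \<Longrightarrow> h x \<in> carrier N"
    and "\<And>x y. x \<in> carrier M \<Longrightarrow> y \<in> carrier M \<Longrightarrow> h (x \<oplus>\<^bsub>M\<^esub> y) = h x \<oplus>\<^bsub>N\<^esub> h y"
    and "\<And>r x. r \<in> carrier R \<Longrightarrow> x \<in> carrier M \<Longrightarrow> h (r \<odot>\<^bsub>M\<^esub> x) = r \<odot>\<^bsub>N\<^esub> h x"
  using assms by (auto simp: mod_hom_def)

lemma mod_hom_zero:
  assumes M: "Module.module R M" and N: "Module.module R N" and h: "h \<in> mod_hom R M N"
  shows "h \<zero>\<^bsub>M\<^esub> = \<zero>\<^bsub>N\<^esub>"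
proof -
  interpret M: Module.module R M by (rule M)
  interpret N: Module.module R N by (rule N)
  have "h \<zero>\<^bsub>M\<^esub> = h (\<zero>\<^bsub>R\<^esub> \<odot>\<^bsub>M\<^esub> \<zero>\<^bsub>M\<^esub>)" by simp
  also have "\<dots> = \<zero>\<^bsub>R\<^esub> \<odot>\<^bsub>N\<^esub> h \<zero>\<^bsub>M\<^esub>"
    using mod_homD(3)[OF h] by blast
  also have "\<dots> = \<zero>\<^bsub>N\<^esub>" using mod_homD(1)[OF h] by simp
  finally show ?thesis .
qed

lemma mod_hom_finsum:
  assumes M: "Module.module R M" and N: "Module.module R N" and h: "h \<in> mod_hom R M N"
    and "finite A" and "f \<in> A \<rightarrow> carrier M"
  shows "h (finsum M f A) = finsum N (\<lambda>x. h (f x)) A"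
proof -
  interpret M: Module.module R M by (rule M)
  interpret N: Module.module R N by (rule N)
  show ?thesis using assms(4,5)
  proof (induct A)
    case empty
    then show ?case by (simp add: mod_hom_zero[OF M N h])
  next
    case (insert a A)
    then have "finsum M f A \<in> carrier M" by (intro M.finsum_closed) auto
    with insert show ?case
      by (subst M.finsum_insert, simp_all, subst N.finsum_insert,
          auto simp: Pi_def mod_homD[OF h])
  qed
qed

lemma mod_hom_image_subset:
  assumes "h \<in> mod_hom R M N"
  shows "h ` carrier M \<subseteq> carrier N"
  using mod_homD(1)[OF assms] by auto

section \<open>Free modules on a set and their direct summands\<close>

definition free_mod :: "('r, 'c) ring_scheme \<Rightarrow> 'b set \<Rightarrow> ('r, 'b \<Rightarrow> 'r) module"
  where "free_mod R B =
    \<lparr>carrier = {f. (\<forall>x. f x \<in> carrier R) \<and> (\<forall>x. x \<notin> B \<longrightarrow> f x = \<zero>\<^bsub>R\<^esub>) \<and> finite {x. f x \<noteq> \<zero>\<^bsub>R\<^esub>}},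
      monoid.mult = (\<lambda>f g. f), monoid.one = (\<lambda>_. \<zero>\<^bsub>R\<^esub>), ring.zero = (\<lambda>_. \<zero>\<^bsub>R\<^esub>),
      ring.add = (\<lambda>f g x. f x \<oplus>\<^bsub>R\<^esub> g x), module.smult = (\<lambda>r f x. r \<otimes>\<^bsub>R\<^esub> f x)\<rparr>"

definition free_unit :: "('r, 'c) ring_scheme \<Rightarrow> 'b \<Rightarrow> 'b \<Rightarrow> 'r"
  where "free_unit R b = (\<lambda>x. if x = b then \<one>\<^bsub>R\<^esub> else \<zero>\<^bsub>R\<^esub>)"

text \<open>The linear extension of a map given on the basis. Summing over the support and not over
  the basis keeps the sum finite when the basis is infinite.\<close>

definition free_ext ::
    "('r, 'c) ring_scheme \<Rightarrow> ('r, 'a, 'd) module_scheme \<Rightarrow> ('b \<Rightarrow> 'a) \<Rightarrow> ('b \<Rightarrow> 'r) \<Rightarrow> 'a"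
  where "free_ext R M a f = finsum M (\<lambda>x. f x \<odot>\<^bsub>M\<^esub> a x) {x. f x \<noteq> \<zero>\<^bsub>R\<^esub>}"

lemma free_mod_simps [simp]:
  "ring.zero (free_mod R B) = (\<lambda>_. \<zero>\<^bsub>R\<^esub>)"
  "ring.add (free_mod R B) = (\<lambda>f g x. f x \<oplus>\<^bsub>R\<^esub> g x)"
  "module.smult (free_mod R B) = (\<lambda>r f x. r \<otimes>\<^bsub>R\<^esub> f x)"
  by (simp_all add: free_mod_def)

lemma mem_free_mod:
  "f \<in> carrier (free_mod R B) \<longleftrightarrow>
    (\<forall>x. f x \<in> carrier R) \<and> (\<forall>x. x \<notin> B \<longrightarrow> f x = \<zero>\<^bsub>R\<^esub>) \<and> finite {x. f x \<noteq> \<zero>\<^bsub>R\<^esub>}"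
  by (simp add: free_mod_def)

context cring
begin

lemma free_unit_mem: "b \<in> B \<Longrightarrow> free_unit R b \<in> carrier (free_mod R B)"
  by (auto simp: mem_free_mod free_unit_def)

lemma free_mod_module: "Module.module R (free_mod R B)"
proof (rule moduleI)
  show "cring R" by (rule is_cring)
  show "abelian_group (free_mod R B)"
  proof (rule abelian_groupI)
    fix f g assume fg: "f \<in> carrier (free_mod R B)" "g \<in> carrier (free_mod R B)"
    then have "finite ({x. f x \<noteq> \<zero>} \<union> {x. g x \<noteq> \<zero>})" by (auto simp: mem_free_mod)
    moreover have "{x. f x \<oplus> g x \<noteq> \<zero>} \<subseteq> {x. f x \<noteq> \<zero>} \<union> {x. g x \<noteq> \<zero>}" by auto
    ultimately have "finite {x. f x \<oplus> g x \<noteq> \<zero>}" by (rule finite_subset[rotated])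
    with fg show "f \<oplus>\<^bsub>free_mod R B\<^esub> g \<in> carrier (free_mod R B)" by (auto simp: mem_free_mod)
  next
    fix f assume f: "f \<in> carrier (free_mod R B)"
    have "{x. \<ominus> f x \<noteq> \<zero>} \<subseteq> {x. f x \<noteq> \<zero>}" by auto
    with f have "(\<lambda>x. \<ominus> f x) \<in> carrier (free_mod R B)"
      by (auto simp: mem_free_mod intro: finite_subset)
    moreover have "(\<lambda>x. \<ominus> f x) \<oplus>\<^bsub>free_mod R B\<^esub> f = \<zero>\<^bsub>free_mod R B\<^esub>"
      using f by (auto simp: mem_free_mod l_neg)
    ultimately show "\<exists>y\<in>carrier (free_mod R B). y \<oplus>\<^bsub>free_mod R B\<^esub> f = \<zero>\<^bsub>free_mod R B\<^esub>" by blast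
  qed (auto simp: mem_free_mod a_ac)
next
  fix a f assume a: "a \<in> carrier R" and f: "f \<in> carrier (free_mod R B)"
  have "{x. a \<otimes> f x \<noteq> \<zero>} \<subseteq> {x. f x \<noteq> \<zero>}" using a by auto
  with a f show "a \<odot>\<^bsub>free_mod R B\<^esub> f \<in> carrier (free_mod R B)"
    by (auto simp: mem_free_mod intro: finite_subset)
qed (auto simp: mem_free_mod l_distr r_distr m_assoc)

lemma finsum_free_mod_apply:
  assumes "finite A" and "f \<in> A \<rightarrow> carrier (free_mod R B)"
  shows "finsum (free_mod R B) f A x = finsum R (\<lambda>a. f a x) A"
  using assms
proof (induct A)
  case empty
  interpret F: Module.module R "free_mod R B" by (rule free_mod_module)
  show ?case by simp
next
  case (insert a A)
  interpret F: Module.module R "free_mod R B" by (rule free_mod_module)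
  from insert show ?case
    by (subst F.finsum_insert, simp_all, subst finsum_insert, auto simp: mem_free_mod Pi_def)
qed

lemma free_mod_induct [consumes 1, case_names zero add]:
  assumes f: "f \<in> carrier (free_mod R B)"
    and zero: "Q (\<lambda>_. \<zero>)"
    and add: "\<And>r b g. r \<in> carrier R \<Longrightarrow> b \<in> B \<Longrightarrow> g \<in> carrier (free_mod R B) \<Longrightarrow> Q g \<Longrightarrow>
      Q (r \<odot>\<^bsub>free_mod R B\<^esub> free_unit R b \<oplus>\<^bsub>free_mod R B\<^esub> g)"
  shows "Q f"
proof -
  have "finite {x. f x \<noteq> \<zero>}" using f by (simp add: mem_free_mod)
  then obtain S where "finite S" and "{x. f x \<noteq> \<zero>} = S" by blast
  then show ?thesis using f
  proof (induct S arbitrary: f)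
    case empty
    then have "f = (\<lambda>_. \<zero>)" by auto
    then show ?case using zero by simp
  next
    case (insert b S)
    define g where "g = f(b := \<zero>)"
    have supp: "{x. g x \<noteq> \<zero>} = S" using insert(2,4) unfolding g_def by auto
    have g: "g \<in> carrier (free_mod R B)"
      using insert(1,5) supp by (auto simp: mem_free_mod g_def)
    have b: "b \<in> B" using insert(4,5) by (auto simp: mem_free_mod)
    have fb: "f b \<in> carrier R" using insert(5) by (simp add: mem_free_mod)
    have "f = f b \<odot>\<^bsub>free_mod R B\<^esub> free_unit R b \<oplus>\<^bsub>free_mod R B\<^esub> g"
      using insert(5) fb by (auto simp: fun_eq_iff g_def free_unit_def mem_free_mod)
    then show ?case using add[OF fb b g insert(3)[OF supp g]] by simp
  qed
qed

lemma free_mod_hom_eqI: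
  assumes M: "Module.module R M"
    and h: "h \<in> mod_hom R (free_mod R B) M" and k: "k \<in> mod_hom R (free_mod R B) M"
    and eq: "\<And>b. b \<in> B \<Longrightarrow> h (free_unit R b) = k (free_unit R b)"
    and f: "f \<in> carrier (free_mod R B)"
  shows "h f = k f"
  using f
proof (induct rule: free_mod_induct)
  case zero
  show ?case
    using mod_hom_zero[OF free_mod_module M h] mod_hom_zero[OF free_mod_module M k] by simp
next
  case (add r b g)
  interpret F: Module.module R "free_mod R B" by (rule free_mod_module)
  show ?case
    using add mod_homD[OF h] mod_homD[OF k] free_unit_mem[of b B] eq
    by (simp del: free_mod_simps)
qed

text \<open>The supports of \<open>f\<close>, \<open>g\<close> and their sum differ, so linearity is
  checked after moving all sums to one finite index set.\<close>

lemma free_ext_superset: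
  assumes M: "Module.module R M" and a: "\<And>b. b \<in> B \<Longrightarrow> a b \<in> carrier M"
    and f: "f \<in> carrier (free_mod R B)" and S: "{x. f x \<noteq> \<zero>} \<subseteq> S" "S \<subseteq> B" "finite S"
  shows "free_ext R M a f = finsum M (\<lambda>x. f x \<odot>\<^bsub>M\<^esub> a x) S"
proof -
  interpret M: Module.module R M by (rule M)
  show ?thesis unfolding free_ext_def
    by (rule M.add.finprod_mono_neutral_cong_left) (use assms in \<open>auto simp: mem_free_mod\<close>)
qed

lemma free_ext_hom:
  assumes M: "Module.module R M" and a: "\<And>b. b \<in> B \<Longrightarrow> a b \<in> carrier M"
  shows "free_ext R M a \<in> mod_hom R (free_mod R B) M"
proof -
  interpret M: Module.module R M by (rule M)
  have supp: "{x. f x \<noteq> \<zero>} \<subseteq> B" "finite {x. f x \<noteq> \<zero>}" if "f \<in> carrier (free_mod R B)" for f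
    using that by (auto simp: mem_free_mod)
  have cl: "f x \<in> carrier R" if "f \<in> carrier (free_mod R B)" for f x
    using that by (auto simp: mem_free_mod)
  interpret F: Module.module R "free_mod R B" by (rule free_mod_module)
  show ?thesis unfolding mod_hom_def
  proof (intro CollectI conjI ballI)
    show "free_ext R M a \<in> carrier (free_mod R B) \<rightarrow> carrier M"
      unfolding free_ext_def
      by (auto intro!: M.finsum_closed M.smult_closed cl a dest: subsetD[OF supp(1)])
  next
    fix f g assume f: "f \<in> carrier (free_mod R B)" and g: "g \<in> carrier (free_mod R B)"
    let ?S = "{x. f x \<noteq> \<zero>} \<union> {x. g x \<noteq> \<zero>}"
    have fg: "f \<oplus>\<^bsub>free_mod R B\<^esub> g \<in> carrier (free_mod R B)" using f g by blast
    have S: "?S \<subseteq> B" "finite ?S" using supp f g by auto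
    have "free_ext R M a (f \<oplus>\<^bsub>free_mod R B\<^esub> g)
        = finsum M (\<lambda>x. (f \<oplus>\<^bsub>free_mod R B\<^esub> g) x \<odot>\<^bsub>M\<^esub> a x) ?S"
      using S by (intro free_ext_superset[OF M a fg]) auto
    also have "\<dots> = finsum M (\<lambda>x. f x \<odot>\<^bsub>M\<^esub> a x \<oplus>\<^bsub>M\<^esub> g x \<odot>\<^bsub>M\<^esub> a x) ?S"
      using S a cl[OF f] cl[OF g]
      by (intro M.finsum_cong') (auto intro!: M.smult_l_distr)
    also have "\<dots> = finsum M (\<lambda>x. f x \<odot>\<^bsub>M\<^esub> a x) ?S \<oplus>\<^bsub>M\<^esub> finsum M (\<lambda>x. g x \<odot>\<^bsub>M\<^esub> a x) ?S"
      using S a cl[OF f] cl[OF g] by (intro M.finsum_addf) auto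
    also have "finsum M (\<lambda>x. f x \<odot>\<^bsub>M\<^esub> a x) ?S = free_ext R M a f"
      using S by (intro free_ext_superset[OF M a f, symmetric]) auto
    also have "finsum M (\<lambda>x. g x \<odot>\<^bsub>M\<^esub> a x) ?S = free_ext R M a g"
      using S by (intro free_ext_superset[OF M a g, symmetric]) auto
    finally show "free_ext R M a (f \<oplus>\<^bsub>free_mod R B\<^esub> g) = free_ext R M a f \<oplus>\<^bsub>M\<^esub> free_ext R M a g" .
  next
    fix r f assume r: "r \<in> carrier R" and f: "f \<in> carrier (free_mod R B)"
    let ?S = "{x. f x \<noteq> \<zero>}"
    have rf: "r \<odot>\<^bsub>free_mod R B\<^esub> f \<in> carrier (free_mod R B)" using r f by blast
    have "free_ext R M a (r \<odot>\<^bsub>free_mod R B\<^esub> f)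
        = finsum M (\<lambda>x. (r \<odot>\<^bsub>free_mod R B\<^esub> f) x \<odot>\<^bsub>M\<^esub> a x) ?S"
      using supp[OF f] r by (intro free_ext_superset[OF M a rf]) auto
    also have "\<dots> = finsum M (\<lambda>x. r \<odot>\<^bsub>M\<^esub> (f x \<odot>\<^bsub>M\<^esub> a x)) ?S"
      using supp[OF f] r cl[OF f] a
      by (intro M.finsum_cong') (auto intro!: M.smult_assoc1)
    also have "\<dots> = r \<odot>\<^bsub>M\<^esub> free_ext R M a f"
      unfolding free_ext_def using supp[OF f] r cl[OF f] a
      by (intro M.finsum_smult_ldistr[symmetric]) auto
    finally show "free_ext R M a (r \<odot>\<^bsub>free_mod R B\<^esub> f) = r \<odot>\<^bsub>M\<^esub> free_ext R M a f" .
  qed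
qed

lemma free_ext_unit:
  assumes M: "Module.module R M" and b: "a b \<in> carrier M"
  shows "free_ext R M a (free_unit R b) = a b"
proof -
  interpret M: Module.module R M by (rule M)
  have "free_ext R M a (free_unit R b) = finsum M (\<lambda>x. free_unit R b x \<odot>\<^bsub>M\<^esub> a x) {b}"
    by (rule free_ext_superset[OF M, where B = "{b}"]) (use b in \<open>auto simp: mem_free_mod free_unit_def\<close>)
  then show ?thesis using b by (simp add: free_unit_def)
qed

text \<open>A homomorphism from a free module is fixed by its values on the basis, so lifting it
  means choosing preimages of these values.\<close>

lemma free_mod_projective:
  fixes B :: "'i set"
  shows "projective_module R (free_mod R B)"
  unfolding projective_module_def
proof (intro conjI allI impI free_mod_module)
  fix A :: "('a, ('i \<Rightarrow> 'a) \<Rightarrow> 'a) module" and C :: "('a, 'i \<Rightarrow> 'a) module" and g f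
  assume "Module.module R A \<and> Module.module R C \<and> g \<in> mod_hom R A C \<and> g ` carrier A = carrier C
    \<and> f \<in> mod_hom R (free_mod R B) C"
  then have A: "Module.module R A" and C: "Module.module R C" and g: "g \<in> mod_hom R A C"
    and onto: "g ` carrier A = carrier C" and f: "f \<in> mod_hom R (free_mod R B) C" by auto
  have "\<exists>x. x \<in> carrier A \<and> g x = f (free_unit R b)" if "b \<in> B" for b
    using mod_homD(1)[OF f free_unit_mem[OF that]] onto by (metis imageE)
  then obtain a where a: "\<And>b. b \<in> B \<Longrightarrow> a b \<in> carrier A \<and> g (a b) = f (free_unit R b)" by metis
  let ?h = "free_ext R A a"
  have h: "?h \<in> mod_hom R (free_mod R B) A" using a by (intro free_ext_hom[OF A]) auto
  have gh: "(\<lambda>x. g (?h x)) \<in> mod_hom R (free_mod R B) C"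
    using mod_homD[OF h] mod_homD[OF g] by (auto simp: mod_hom_def)
  have "g (?h x) = f x" if "x \<in> carrier (free_mod R B)" for x
    by (rule free_mod_hom_eqI[OF C gh f _ that]) (use a in \<open>simp add: free_ext_unit[OF A]\<close>)
  with h show "\<exists>h\<in>mod_hom R (free_mod R B) A. \<forall>x\<in>carrier (free_mod R B). g (h x) = f x" by blast
qed

lemma projective_split:
  fixes P :: "('a, 'm) module"
  assumes P: "projective_module R P"
  obtains s where "s \<in> mod_hom R P (free_mod R (carrier P))"
    and "free_ext R P (\<lambda>x. x) \<in> mod_hom R (free_mod R (carrier P)) P"
    and "\<And>x. x \<in> carrier P \<Longrightarrow> free_ext R P (\<lambda>x. x) (s x) = x"
proof -
  have M: "Module.module R P" using P by (simp add: projective_module_def)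
  let ?g = "free_ext R P (\<lambda>x. x)"
  have g: "?g \<in> mod_hom R (free_mod R (carrier P)) P" by (rule free_ext_hom[OF M])
  have "x \<in> ?g ` carrier (free_mod R (carrier P))" if "x \<in> carrier P" for x
    using free_ext_unit[OF M, of "\<lambda>x. x" x] free_unit_mem[OF that] that
    by (metis image_eqI)
  then have onto: "?g ` carrier (free_mod R (carrier P)) = carrier P"
    using mod_hom_image_subset[OF g] by auto
  have id: "(\<lambda>x. x) \<in> mod_hom R P P" by (simp add: mod_hom_def)
  have "\<exists>h\<in>mod_hom R P (free_mod R (carrier P)). \<forall>x\<in>carrier P. ?g (h x) = x"
    using P free_mod_module M g onto id unfolding projective_module_def by blast
  then show thesis using that g by blast
qed

end

section \<open>Koszul homology of modules\<close>

text \<open>The terms \<open>H e p\<close> and \<open>H p e\<close> cancel. Exchanging the summation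
  indices would only show that twice the sum vanishes, which is not enough in characteristic two, so
  an induction cancels the pairs that contain the new element.\<close>

lemma (in abelian_group) finsum_skew_zero:
  assumes "finite A" and H: "\<And>e p. e \<in> A \<Longrightarrow> p \<in> A \<Longrightarrow> e \<noteq> p \<Longrightarrow> H e p \<in> carrier G"
    and skew: "\<And>e p. e \<in> A \<Longrightarrow> p \<in> A \<Longrightarrow> e \<noteq> p \<Longrightarrow> H e p = \<ominus> H p e"
  shows "finsum G (\<lambda>e. finsum G (H e) (A - {e})) A = \<zero>"
  using assms
proof (induct A)
  case empty
  show ?case by simp
next
  case (insert a A)
  have Ha: "H a e \<in> carrier G" "H e a \<in> carrier G" "H a e \<oplus> H e a = \<zero>" if "e \<in> A" for e
  proof -
    show *: "H a e \<in> carrier G" "H e a \<in> carrier G" using insert(2,4) that by auto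
    have "H a e = \<ominus> H e a" using insert(2) that by (intro insert(5)) auto
    then show "H a e \<oplus> H e a = \<zero>" using * by (simp add: l_neg)
  qed
  have inner: "finsum G (H e) (A - {e}) \<in> carrier G" if "e \<in> A" for e
    using insert(4) that by (intro finsum_closed) auto
  have "finsum G (H e) (insert a A - {e}) = H e a \<oplus> finsum G (H e) (A - {e})" if "e \<in> A" for e
  proof -
    have "insert a A - {e} = insert a (A - {e})" using insert(2) that by auto
    then show ?thesis using insert(1,2,4) that Ha by (subst finsum_insert[symmetric]) auto
  qed
  then have "finsum G (\<lambda>e. finsum G (H e) (insert a A - {e})) A
      = finsum G (\<lambda>e. H e a \<oplus> finsum G (H e) (A - {e})) A"
    using Ha inner by (intro finsum_cong') auto
  also have "\<dots> = finsum G (\<lambda>e. H e a) A \<oplus> finsum G (\<lambda>e. finsum G (H e) (A - {e})) A"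
    using Ha inner by (intro finsum_addf) auto
  also have "finsum G (\<lambda>e. finsum G (H e) (A - {e})) A = \<zero>"
    by (rule insert(3)) (simp_all add: insert(4), rule insert(5), simp_all)
  finally have 1: "finsum G (\<lambda>e. finsum G (H e) (insert a A - {e})) A = finsum G (\<lambda>e. H e a) A"
    using Ha by (simp add: finsum_closed Pi_def)
  have 2: "insert a A - {a} = A" using insert(2) by auto
  have "finsum G (\<lambda>e. finsum G (H e) (insert a A - {e})) (insert a A)
      = finsum G (H a) A \<oplus> finsum G (\<lambda>e. H e a) A"
  proof (subst finsum_insert)
    show "(\<lambda>e. finsum G (H e) (insert a A - {e})) \<in> A \<rightarrow> carrier G"
      using insert(4) by (auto intro!: finsum_closed)
    show "finsum G (H a) (insert a A - {a}) \<in> carrier G" unfolding 2 using Ha by (auto intro!: finsum_closed)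
    show "finsum G (H a) (insert a A - {a}) \<oplus> finsum G (\<lambda>e. finsum G (H e) (insert a A - {e})) A
      = finsum G (H a) A \<oplus> finsum G (\<lambda>e. H e a) A" unfolding 1 2 ..
  qed (use insert(1,2) in auto)
  also have "\<dots> = finsum G (\<lambda>e. H a e \<oplus> H e a) A"
    using Ha by (intro finsum_addf[symmetric]) auto
  also have "\<dots> = \<zero>" using Ha by (intro add.finprod_one_eqI) auto
  finally show ?case .
qed

text \<open>\<open>c e T\<close> is \<open>\<plusminus>y\<^sub>e\<close>. A chain with values in \<open>M\<close> is a function on the subsets of \<open>E\<close>, of degree
  \<open>i\<close> if only its values on sets of size \<open>i\<close> matter.\<close>

locale koszul = cring R for R (structure) +
  fixes E :: "'e set" and c :: "'e \<Rightarrow> 'e set \<Rightarrow> 'a"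
  assumes finE: "finite E"
    and c_closed: "\<And>e T. e \<in> E \<Longrightarrow> c e T \<in> carrier R"
    and c_skew: "\<And>e p T. e \<in> E \<Longrightarrow> p \<in> E \<Longrightarrow> T \<subseteq> E \<Longrightarrow> e \<noteq> p \<Longrightarrow> e \<notin> T \<Longrightarrow> p \<notin> T \<Longrightarrow>
      c e T \<otimes> c p (insert e T) = \<ominus> (c p T \<otimes> c e (insert p T))"
begin

text \<open>\<open>f\<close> stands for the chain \<open>\<Sum> f T e_T\<close>; the coefficient of
  \<open>e_T\<close> in its Koszul boundary collects the sets with one element more.\<close>

definition kbd :: "('a, 'm, 'd) module_scheme \<Rightarrow> ('e set \<Rightarrow> 'm) \<Rightarrow> 'e set \<Rightarrow> 'm"
  where "kbd M f T = finsum M (\<lambda>e. c e T \<odot>\<^bsub>M\<^esub> f (insert e T)) (E - T)"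

text \<open>Stating this for a subset \<open>N\<close> lets a kernel serve as coefficients without a
  module structure of its own. In degree 0 the cycle condition is vacuous, and the statement says
  that everything is a boundary.\<close>

definition koszul_exact :: "('a, 'm, 'd) module_scheme \<Rightarrow> 'm set \<Rightarrow> nat \<Rightarrow> bool"
  where "koszul_exact M N i \<longleftrightarrow>
    (\<forall>f. (\<forall>T. f T \<in> N) \<and> (\<forall>T\<subseteq>E. Suc (card T) = i \<longrightarrow> kbd M f T = \<zero>\<^bsub>M\<^esub>) \<longrightarrow>
      (\<exists>w. (\<forall>T. w T \<in> N) \<and> (\<forall>T\<subseteq>E. card T = i \<longrightarrow> kbd M w T = f T)))"

definition koszul_ring_exact :: "nat \<Rightarrow> bool"
  where "koszul_ring_exact i \<longleftrightarrow>
    (\<forall>f. (\<forall>T. f T \<in> carrier R)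
        \<and> (\<forall>T\<subseteq>E. Suc (card T) = i \<longrightarrow> finsum R (\<lambda>e. c e T \<otimes> f (insert e T)) (E - T) = \<zero>) \<longrightarrow>
      (\<exists>w. (\<forall>T. w T \<in> carrier R)
        \<and> (\<forall>T\<subseteq>E. card T = i \<longrightarrow> finsum R (\<lambda>e. c e T \<otimes> w (insert e T)) (E - T) = f T)))"

lemma kbd_closed:
  assumes "Module.module R M" and "\<And>T. f T \<in> carrier M"
  shows "kbd M f T \<in> carrier M"
proof -
  interpret M: Module.module R M by fact
  show ?thesis unfolding kbd_def using assms(2) c_closed
    by (intro M.finsum_closed) auto
qed

lemma kbd_cong:
  assumes "Module.module R M" and "\<And>T. g T \<in> carrier M"
    and "\<And>e. e \<in> E - T \<Longrightarrow> f (insert e T) = g (insert e T)"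
  shows "kbd M f T = kbd M g T"
proof -
  interpret M: Module.module R M by fact
  show ?thesis unfolding kbd_def using assms(2,3) c_closed
    by (intro M.finsum_cong') auto
qed

lemma kbd_hom:
  assumes M: "Module.module R M" and N: "Module.module R N" and h: "h \<in> mod_hom R M N"
    and f: "\<And>T. f T \<in> carrier M"
  shows "h (kbd M f T) = kbd N (\<lambda>T. h (f T)) T"
proof -
  interpret M: Module.module R M by fact
  interpret N: Module.module R N by fact
  have "h (kbd M f T) = finsum N (\<lambda>e. h (c e T \<odot>\<^bsub>M\<^esub> f (insert e T))) (E - T)"
    unfolding kbd_def using finE f c_closed by (intro mod_hom_finsum[OF M N h]) auto
  also have "\<dots> = kbd N (\<lambda>T. h (f T)) T"
    unfolding kbd_def using f c_closed mod_homD[OF h] by (intro N.finsum_cong') auto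
  finally show ?thesis .
qed

lemma kbd_diff:
  assumes M: "Module.module R M" and f: "\<And>T. f T \<in> carrier M" and g: "\<And>T. g T \<in> carrier M"
    and eq: "kbd M f T = kbd M g T"
  shows "kbd M (\<lambda>T. f T \<oplus>\<^bsub>M\<^esub> (\<ominus>\<^bsub>M\<^esub> g T)) T = \<zero>\<^bsub>M\<^esub>"
proof -
  interpret M: Module.module R M by fact
  have "kbd M (\<lambda>T. f T \<oplus>\<^bsub>M\<^esub> (\<ominus>\<^bsub>M\<^esub> g T)) T \<oplus>\<^bsub>M\<^esub> kbd M g T
      = finsum M (\<lambda>e. c e T \<odot>\<^bsub>M\<^esub> (f (insert e T) \<oplus>\<^bsub>M\<^esub> (\<ominus>\<^bsub>M\<^esub> g (insert e T)))
          \<oplus>\<^bsub>M\<^esub> c e T \<odot>\<^bsub>M\<^esub> g (insert e T)) (E - T)"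
    unfolding kbd_def using f g c_closed by (intro M.finsum_addf[symmetric]) auto
  also have "\<dots> = kbd M f T"
    unfolding kbd_def using f g c_closed
    by (intro M.finsum_cong') (auto simp: M.smult_r_distr M.smult_r_minus M.a_assoc M.l_neg)
  finally have sum: "kbd M (\<lambda>T. f T \<oplus>\<^bsub>M\<^esub> (\<ominus>\<^bsub>M\<^esub> g T)) T \<oplus>\<^bsub>M\<^esub> kbd M g T = kbd M g T"
    using eq by simp
  have cl: "kbd M (\<lambda>T. f T \<oplus>\<^bsub>M\<^esub> (\<ominus>\<^bsub>M\<^esub> g T)) T \<in> carrier M" "kbd M g T \<in> carrier M"
    using f g by (auto intro!: kbd_closed[OF M])
  show ?thesis
    using M.add.r_cancel_one[OF cl(2,1)] sum by simp
qed

text \<open>Each extension of \<open>T\<close> by two elements is reached in two orders, with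
  opposite signs by \<open>c_skew\<close>.\<close>

lemma kbd_kbd:
  assumes M: "Module.module R M" and f: "\<And>T. f T \<in> carrier M" and T: "T \<subseteq> E"
  shows "kbd M (kbd M f) T = \<zero>\<^bsub>M\<^esub>"
proof -
  interpret M: Module.module R M by fact
  define H where "H e p = (c e T \<otimes> c p (insert e T)) \<odot>\<^bsub>M\<^esub> f (insert p (insert e T))" for e p
  have H: "H e p \<in> carrier M" if "e \<in> E" "p \<in> E" for e p
    unfolding H_def using f c_closed that by auto
  have "c e T \<odot>\<^bsub>M\<^esub> kbd M f (insert e T) = finsum M (H e) (E - T - {e})" if "e \<in> E - T" for e
  proof -
    have "c e T \<odot>\<^bsub>M\<^esub> kbd M f (insert e T)
        = finsum M (\<lambda>p. c e T \<odot>\<^bsub>M\<^esub> (c p (insert e T) \<odot>\<^bsub>M\<^esub> f (insert p (insert e T)))) (E - insert e T)"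
      unfolding kbd_def using that f c_closed finE by (intro M.finsum_smult_ldistr) auto
    also have "\<dots> = finsum M (H e) (E - T - {e})"
      using H that f c_closed by (intro M.finsum_cong') (auto simp: H_def M.smult_assoc1)
    finally show ?thesis .
  qed
  then have "kbd M (kbd M f) T = finsum M (\<lambda>e. finsum M (H e) (E - T - {e})) (E - T)"
    using H unfolding kbd_def[of M "kbd M f"]
    by (intro M.finsum_cong') (auto intro!: M.finsum_closed)
  also have "\<dots> = \<zero>\<^bsub>M\<^esub>"
  proof (rule M.finsum_skew_zero)
    fix e p assume ep: "e \<in> E - T" "p \<in> E - T" "e \<noteq> p"
    have "insert p (insert e T) = insert e (insert p T)" by auto
    then show "H e p = \<ominus>\<^bsub>M\<^esub> H p e"
      unfolding H_def using c_skew[of e p T] ep f c_closed T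
      by (simp add: M.smult_l_minus)
  qed (use H finE in auto)
  finally show ?thesis .
qed

text \<open>Cycles and boundaries can be tested one coordinate at a time; the point to watch is the
  finite support of the solution.\<close>

lemma koszul_exact_free:
  assumes ex: "koszul_ring_exact i"
  shows "koszul_exact (free_mod R B) (carrier (free_mod R B)) i"
  unfolding koszul_exact_def
proof (intro allI impI, elim conjE)
  fix f assume f: "\<forall>T. f T \<in> carrier (free_mod R B)"
    and cyc: "\<forall>T\<subseteq>E. Suc (card T) = i \<longrightarrow> kbd (free_mod R B) f T = \<zero>\<^bsub>free_mod R B\<^esub>"
  interpret F: Module.module R "free_mod R B" by (rule free_mod_module)
  have kx: "kbd (free_mod R B) h T x = finsum R (\<lambda>e. c e T \<otimes> h (insert e T) x) (E - T)"
    if "\<And>T. h T \<in> carrier (free_mod R B)" for h T x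
  proof -
    have "kbd (free_mod R B) h T x = finsum R (\<lambda>e. (c e T \<odot>\<^bsub>free_mod R B\<^esub> h (insert e T)) x) (E - T)"
      unfolding kbd_def using finE c_closed that
      by (intro finsum_free_mod_apply) (auto simp del: free_mod_simps)
    then show ?thesis by simp
  qed
  have "\<exists>w. (\<forall>T. w T \<in> carrier R)
      \<and> (\<forall>T\<subseteq>E. card T = i \<longrightarrow> finsum R (\<lambda>e. c e T \<otimes> w (insert e T)) (E - T) = f T x)" for x
  proof (rule ex[unfolded koszul_ring_exact_def, rule_format, of "\<lambda>T. f T x"], intro conjI allI impI)
    show "f T x \<in> carrier R" for T using f by (simp add: mem_free_mod)
    fix T assume "T \<subseteq> E" "Suc (card T) = i"
    then have "kbd (free_mod R B) f T x = \<zero>" using cyc by simp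
    then show "finsum R (\<lambda>e. c e T \<otimes> f (insert e T) x) (E - T) = \<zero>" using kx[of f] f by simp
  qed
  then obtain v where v: "\<And>x T. v x T \<in> carrier R"
    "\<And>x T. T \<subseteq> E \<Longrightarrow> card T = i \<Longrightarrow> finsum R (\<lambda>e. c e T \<otimes> v x (insert e T)) (E - T) = f T x"
    by metis
  \<comment> \<open>\<open>E\<close> has finitely many subsets, so only finitely many coordinates
    occur in \<open>f\<close>; in all others \<open>w\<close> is 0.\<close>
  define S where "S = (\<Union>T\<in>Pow E. {x. f T x \<noteq> \<zero>})"
  define w where "w T x = (if x \<in> S then v x T else \<zero>)" for T x
  have S: "finite S" "S \<subseteq> B" unfolding S_def using finE f by (auto simp: mem_free_mod)
  have w: "w T \<in> carrier (free_mod R B)" for T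
    using v(1) S unfolding mem_free_mod w_def
    by (auto intro: finite_subset[of _ S] split: if_splits)
  have "kbd (free_mod R B) w T x = f T x" if "T \<subseteq> E" "card T = i" for T x
  proof (cases "x \<in> S")
    case True
    then show ?thesis using v(2)[OF that] by (simp add: kx w w_def)
  next
    case False
    then have "f T x = \<zero>" using that by (auto simp: S_def)
    moreover have "finsum R (\<lambda>e. c e T \<otimes> \<zero>) (E - T) = \<zero>"
      using c_closed by (intro add.finprod_one_eqI) auto
    ultimately show ?thesis using False by (simp add: kx w w_def)
  qed
  with w show "\<exists>w. (\<forall>T. w T \<in> carrier (free_mod R B))
      \<and> (\<forall>T\<subseteq>E. card T = i \<longrightarrow> kbd (free_mod R B) w T = f T)"
    by (intro exI[of _ w]) auto
qed

text \<open>A cycle is carried into the free module by the section \<open>s\<close>, bounded there,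
  and brought back by the retraction.\<close>

lemma koszul_exact_projective:
  assumes P: "projective_module R P" and ex: "koszul_ring_exact i"
  shows "koszul_exact P (carrier P) i"
  unfolding koszul_exact_def
proof (intro allI impI, elim conjE)
  fix f assume f: "\<forall>T. f T \<in> carrier P" and cyc: "\<forall>T\<subseteq>E. Suc (card T) = i \<longrightarrow> kbd P f T = \<zero>\<^bsub>P\<^esub>"
  have M: "Module.module R P" using P by (simp add: projective_module_def)
  let ?F = "free_mod R (carrier P)" and ?g = "free_ext R P (\<lambda>x. x)"
  obtain s where s: "s \<in> mod_hom R P ?F" and g: "?g \<in> mod_hom R ?F P"
    and gs: "\<And>x. x \<in> carrier P \<Longrightarrow> ?g (s x) = x" using projective_split[OF P] by blast
  have F: "Module.module R ?F" by (rule free_mod_module)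
  have "kbd ?F (\<lambda>T. s (f T)) T = \<zero>\<^bsub>?F\<^esub>" if "T \<subseteq> E" "Suc (card T) = i" for T
    using kbd_hom[OF M F s, of f T] f cyc that mod_hom_zero[OF M F s] by auto
  then obtain w where w: "\<And>T. w T \<in> carrier ?F"
    and kw: "\<And>T. T \<subseteq> E \<Longrightarrow> card T = i \<Longrightarrow> kbd ?F w T = s (f T)"
    using koszul_exact_free[OF ex, of "carrier P", unfolded koszul_exact_def, rule_format,
        of "\<lambda>T. s (f T)"] f mod_homD(1)[OF s] by auto
  have "kbd P (\<lambda>T. ?g (w T)) T = f T" if "T \<subseteq> E" "card T = i" for T
    using kbd_hom[OF F M g, of w T] w kw[OF that] gs f by simp
  then show "\<exists>w. (\<forall>T. w T \<in> carrier P) \<and> (\<forall>T\<subseteq>E. card T = i \<longrightarrow> kbd P w T = f T)"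
    using mod_homD(1)[OF g w] by (intro exI[of _ "\<lambda>T. ?g (w T)"]) auto
qed

text \<open>This is the connecting homomorphism of the sequence formed by the kernel,
  \<open>P\<close> and \<open>N\<close>, done by hand: the class of \<open>f\<close> goes to the
  boundary of a lift, and exactness for the kernel and for \<open>P\<close> lets the lift be
  corrected and bounded.\<close>

lemma koszul_exact_shift:
  assumes P: "Module.module R P" and M: "Module.module R M" and h: "h \<in> mod_hom R P M"
    and N: "h ` carrier P = N"
    and exP: "koszul_exact P (carrier P) (Suc i)" and exK: "koszul_exact P (a_kernel P M h) i"
  shows "koszul_exact M N (Suc i)"
  unfolding koszul_exact_def
proof (intro allI impI, elim conjE)
  fix f assume f: "\<forall>T. f T \<in> N"
    and cyc: "\<forall>T\<subseteq>E. Suc (card T) = Suc i \<longrightarrow> kbd M f T = \<zero>\<^bsub>M\<^esub>"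
  interpret P: Module.module R P by fact
  interpret M: Module.module R M by fact
  have h0: "h \<zero>\<^bsub>P\<^esub> = \<zero>\<^bsub>M\<^esub>" by (rule mod_hom_zero[OF P M h])
  have NM: "N \<subseteq> carrier M" using N mod_hom_image_subset[OF h] by simp
  have "\<exists>x. x \<in> carrier P \<and> h x = f T" for T using f N by (metis imageE)
  then obtain f' where f': "\<And>T. f' T \<in> carrier P" "\<And>T. h (f' T) = f T" by metis
  \<comment> \<open>The boundary of the lift \<open>f'\<close> dies in \<open>M\<close> because
    \<open>f\<close> is a cycle. Outside degree \<open>i\<close> the value 0 keeps \<open>g\<close>
    in the kernel.\<close>
  define g where "g T = (if T \<subseteq> E \<and> card T = i then kbd P f' T else \<zero>\<^bsub>P\<^esub>)" for T
  have g: "g T \<in> a_kernel P M h" for T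
    using kbd_hom[OF P M h, of f' T] f' cyc kbd_closed[OF P, of f' T] h0
    by (auto simp: g_def a_kernel_def')
  have "kbd P g T = \<zero>\<^bsub>P\<^esub>" if "T \<subseteq> E" "Suc (card T) = i" for T
  proof -
    have "finite T" using that finE finite_subset by blast
    then have "kbd P g T = kbd P (kbd P f') T"
      using that by (intro kbd_cong[OF P] kbd_closed[OF P] f') (auto simp: g_def)
    then show ?thesis using kbd_kbd[OF P, of f' T] f' that by simp
  qed
  then obtain W where W: "\<And>T. W T \<in> a_kernel P M h"
    and kW: "\<And>T. T \<subseteq> E \<Longrightarrow> card T = i \<Longrightarrow> kbd P W T = g T"
    using exK[unfolded koszul_exact_def, rule_format, of g] g by auto
  have WP: "W T \<in> carrier P" and hW: "h (W T) = \<zero>\<^bsub>M\<^esub>" for T using W by (auto simp: a_kernel_def')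
  \<comment> \<open>Subtracting \<open>W\<close> does not change the image under \<open>h\<close>,
    and it turns the lift into a cycle of \<open>P\<close>.\<close>
  let ?Z = "\<lambda>T. f' T \<oplus>\<^bsub>P\<^esub> (\<ominus>\<^bsub>P\<^esub> W T)"
  have "kbd P ?Z T = \<zero>\<^bsub>P\<^esub>" if "T \<subseteq> E" "card T = i" for T
    using kW[OF that] that f' WP by (intro kbd_diff[OF P]) (auto simp: g_def)
  then obtain V where V: "\<And>T. V T \<in> carrier P"
    and kV: "\<And>T. T \<subseteq> E \<Longrightarrow> card T = Suc i \<Longrightarrow> kbd P V T = ?Z T"
    using exP[unfolded koszul_exact_def, rule_format, of ?Z] f' WP by auto
  have hZ: "h (?Z T) = f T" for T
  proof -
    have "h (?Z T \<oplus>\<^bsub>P\<^esub> W T) = h (f' T)"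
      using f' WP by (simp add: P.a_assoc P.l_neg)
    moreover have "h (?Z T \<oplus>\<^bsub>P\<^esub> W T) = h (?Z T) \<oplus>\<^bsub>M\<^esub> h (W T)"
      using f' WP by (intro mod_homD(2)[OF h]) auto
    ultimately show ?thesis using hW f'(2) mod_homD(1)[OF h, of "?Z T"] f'(1) WP by simp
  qed
  have "kbd M (\<lambda>T. h (V T)) T = f T" if "T \<subseteq> E" "card T = Suc i" for T
    using kbd_hom[OF P M h, of V T] V kV[OF that] hZ by simp
  moreover have "h (V T) \<in> N" for T using V N by auto
  ultimately show "\<exists>w. (\<forall>T. w T \<in> N) \<and> (\<forall>T\<subseteq>E. card T = Suc i \<longrightarrow> kbd M w T = f T)"
    by (intro exI[of _ "\<lambda>T. h (V T)"]) auto
qed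

lemma koszul_exact_zero:
  assumes P: "Module.module R P"
  shows "koszul_exact P {\<zero>\<^bsub>P\<^esub>} i"
proof -
  interpret P: Module.module R P by fact
  have "kbd P (\<lambda>_. \<zero>\<^bsub>P\<^esub>) T = \<zero>\<^bsub>P\<^esub>" for T
    unfolding kbd_def using c_closed by (intro P.add.finprod_one_eqI) auto
  then show ?thesis unfolding koszul_exact_def by auto
qed

text \<open>The kernel at position \<open>l\<close> is zero, hence exact in every degree. Each step
  towards \<open>M\<close> costs one degree, and there are \<open>l + 1\<close> steps, the last
  being the augmentation.\<close>

theorem koszul_exact_of_resolution:
  assumes M: "Module.module R M" and res: "projective_resolution R M l P \<delta> \<epsilon>"
    and ex: "\<And>i. i \<ge> 1 \<Longrightarrow> koszul_ring_exact i" and "i > l"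
  shows "koszul_exact M (carrier M) i"
proof -
  define ker where "ker = (\<lambda>i. case i of 0 \<Rightarrow> a_kernel (P 0) M \<epsilon>
    | Suc j \<Rightarrow> a_kernel (P (Suc j)) (P j) (\<delta> j))"
  have proj: "\<And>i. i \<le> l \<Longrightarrow> projective_module R (P i)"
    and eps: "\<epsilon> \<in> mod_hom R (P 0) M" "\<epsilon> ` carrier (P 0) = carrier M"
    and del: "\<And>i. i < l \<Longrightarrow> \<delta> i \<in> mod_hom R (P (Suc i)) (P i)"
      "\<And>i. i < l \<Longrightarrow> \<delta> i ` carrier (P (Suc i)) = ker i"
    and last: "ker l = {\<zero>\<^bsub>P l\<^esub>}"
    using res unfolding projective_resolution_def Let_def ker_def[symmetric] by auto
  have P: "\<And>i. i \<le> l \<Longrightarrow> Module.module R (P i)" using proj by (simp add: projective_module_def)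
  have exP: "koszul_exact (P k) (carrier (P k)) i" if "k \<le> l" "i \<ge> 1" for k i
    by (rule koszul_exact_projective[OF proj[OF that(1)] ex[OF that(2)]])
  have "koszul_exact (P (l - j)) (ker (l - j)) i" if "j \<le> l" "i \<ge> j" for i j
    using that
  proof (induct j arbitrary: i)
    case 0
    then show ?case using last koszul_exact_zero[OF P[of l]] by simp
  next
    case (Suc j)
    define k where "k = l - Suc j"
    have k: "l - j = Suc k" "k < l" "Suc k \<le> l" using Suc(2) by (auto simp: k_def)
    obtain i' where i': "i = Suc i'" "i' \<ge> j" using Suc(3) by (cases i) auto
    have "koszul_exact (P (Suc k)) (a_kernel (P (Suc k)) (P k) (\<delta> k)) i'"
      using Suc(1)[of i'] Suc(2) i' k by (simp add: ker_def)
    then have "koszul_exact (P k) (ker k) (Suc i')"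
      using k by (intro koszul_exact_shift[OF P P del(1) del(2) exP]) auto
    then show ?case using i' by (simp add: k_def)
  qed
  from this[of l "i - 1"] have "koszul_exact (P 0) (a_kernel (P 0) M \<epsilon>) (i - 1)"
    using \<open>i > l\<close> by (simp add: ker_def)
  from koszul_exact_shift[OF P[of 0] M eps exP this] \<open>i > l\<close> show ?thesis by simp
qed

end

section \<open>Chain complexes on families of finite sets\<close>

lemma sum_skew_zero:
  fixes H :: "'e \<Rightarrow> 'e \<Rightarrow> 'a::ab_group_add"
  assumes "finite A" and skew: "\<And>e p. e \<in> A \<Longrightarrow> p \<in> A \<Longrightarrow> e \<noteq> p \<Longrightarrow> H e p = - H p e"
  shows "(\<Sum>e\<in>A. \<Sum>p\<in>A - {e}. H e p) = 0"
  using assms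
proof (induct A)
  case empty
  show ?case by simp
next
  case (insert a A)
  have "(\<Sum>p\<in>insert a A - {e}. H e p) = H e a + (\<Sum>p\<in>A - {e}. H e p)" if "e \<in> A" for e
  proof -
    have "insert a A - {e} = insert a (A - {e})" using insert(2) that by auto
    then show ?thesis using insert(1,2) by simp
  qed
  then have "(\<Sum>e\<in>insert a A. \<Sum>p\<in>insert a A - {e}. H e p)
      = (\<Sum>p\<in>A. H a p) + ((\<Sum>e\<in>A. H e a) + (\<Sum>e\<in>A. \<Sum>p\<in>A - {e}. H e p))"
    using insert(1,2) by (simp add: sum.distrib)
  also have "(\<Sum>e\<in>A. \<Sum>p\<in>A - {e}. H e p) = 0"
    by (rule insert(3)) (rule insert(4), simp_all)
  also have "(\<Sum>p\<in>A. H a p) + ((\<Sum>e\<in>A. H e a) + 0) = (\<Sum>p\<in>A. H a p + H p a)"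
    by (simp add: sum.distrib)
  also have "\<dots> = 0"
  proof (intro sum.neutral ballI)
    fix p assume "p \<in> A"
    then have "H a p = - H p a" using insert(2) by (intro insert(4)) auto
    then show "H a p + H p a = 0" by simp
  qed
  finally show ?case .
qed

text \<open>The counterpart of \<open>kbd\<close> over a type class. It is used with coefficients in
  the field, for a single multidegree, and in the type of all polynomials.\<close>

definition bdry :: "'e set \<Rightarrow> ('e \<Rightarrow> 'e set \<Rightarrow> 'a) \<Rightarrow> ('e set \<Rightarrow> 'a) \<Rightarrow> 'e set \<Rightarrow> 'a::comm_ring_1"
  where "bdry E c f T = (\<Sum>e\<in>E - T. c e T * f (insert e T))"

definition skew_coeffs :: "'e set \<Rightarrow> ('e \<Rightarrow> 'e set \<Rightarrow> 'a::comm_ring_1) \<Rightarrow> bool"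
  where "skew_coeffs E c \<longleftrightarrow> finite E \<and>
    (\<forall>e p T. e \<in> E \<longrightarrow> p \<in> E \<longrightarrow> T \<subseteq> E \<longrightarrow> e \<noteq> p \<longrightarrow> e \<notin> T \<longrightarrow> p \<notin> T \<longrightarrow>
      c e T * c p (insert e T) = - (c p T * c e (insert p T)))"

lemma skew_coeffsD:
  "skew_coeffs E c \<Longrightarrow> e \<in> E \<Longrightarrow> p \<in> E \<Longrightarrow> T \<subseteq> E \<Longrightarrow> e \<noteq> p \<Longrightarrow> e \<notin> T \<Longrightarrow> p \<notin> T \<Longrightarrow>
    c e T * c p (insert e T) = - (c p T * c e (insert p T))"
  unfolding skew_coeffs_def by blast

text \<open>The family need not be closed under subsets: chains are supported on it and boundaries
  are evaluated only there, which covers quotients of subcomplexes too. \<open>Q\<close> is the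
  place for the augmentation condition.\<close>

definition acyclic_family ::
    "'e set \<Rightarrow> ('e \<Rightarrow> 'e set \<Rightarrow> 'a) \<Rightarrow> 'e set set \<Rightarrow> (('e set \<Rightarrow> 'a::comm_ring_1) \<Rightarrow> bool) \<Rightarrow> bool"
  where "acyclic_family E c \<F> Q \<longleftrightarrow>
    (\<forall>z. (\<forall>T. z T \<noteq> 0 \<longrightarrow> T \<in> \<F>) \<and> (\<forall>T\<in>\<F>. bdry E c z T = 0) \<and> Q z \<longrightarrow>
      (\<exists>w. (\<forall>T. w T \<noteq> 0 \<longrightarrow> T \<in> \<F>) \<and> (\<forall>T\<in>\<F>. bdry E c w T = z T)))"

lemma bdry_cong:
  "(\<And>e. e \<in> E - T \<Longrightarrow> f (insert e T) = g (insert e T)) \<Longrightarrow> bdry E c f T = bdry E c g T"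
  by (simp add: bdry_def)

lemma bdry_add: "bdry E c (\<lambda>T. f T + g T) T = bdry E c f T + bdry E c g T"
  by (simp add: bdry_def distrib_left sum.distrib)

lemma bdry_diff: "bdry E c (\<lambda>T. f T - g T) T = bdry E c f T - bdry E c g T"
  by (simp add: bdry_def right_diff_distrib sum_subtractf)

lemma bdry_bdry:
  assumes c: "skew_coeffs E c" and "T \<subseteq> E"
  shows "bdry E c (bdry E c f) T = 0"
proof -
  define H where "H e p = c e T * c p (insert e T) * f (insert p (insert e T))" for e p
  have "bdry E c (bdry E c f) T = (\<Sum>e\<in>E - T. \<Sum>p\<in>E - T - {e}. H e p)"
    unfolding bdry_def sum_distrib_left
    by (intro sum.cong) (auto simp: H_def mult.assoc)
  also have "\<dots> = 0"
  proof (rule sum_skew_zero)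
    fix e p assume ep: "e \<in> E - T" "p \<in> E - T" "e \<noteq> p"
    have 1: "insert p (insert e T) = insert e (insert p T)" by auto
    have 2: "c e T * c p (insert e T) = - (c p T * c e (insert p T))"
      using ep \<open>T \<subseteq> E\<close> by (intro skew_coeffsD[OF c]) auto
    show "H e p = - H p e" unfolding H_def 1 2 by simp
  qed (use c in \<open>simp add: skew_coeffs_def\<close>)
  finally show ?thesis .
qed

text \<open>The members of \<F> pair off by adding or removing the apex \<open>p\<close>, and
  \<open>z \<mapsto> p \<and> z\<close> is a contracting homotopy.\<close>

lemma acyclic_cone:
  assumes c: "skew_coeffs E c" and unit: "\<And>e T. c e T * c e T = 1" and p: "p \<in> E"
    and sub: "\<And>T. T \<in> \<F> \<Longrightarrow> T \<subseteq> E"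
    and ins: "\<And>T. T \<in> \<F> \<Longrightarrow> insert p T \<in> \<F>" and del: "\<And>T. T \<in> \<F> \<Longrightarrow> T - {p} \<in> \<F>"
  shows "acyclic_family E c \<F> (\<lambda>_. True)"
  unfolding acyclic_family_def
proof (intro allI impI, elim conjE)
  fix z assume supp: "\<forall>T. z T \<noteq> 0 \<longrightarrow> T \<in> \<F>" and cyc: "\<forall>T\<in>\<F>. bdry E c z T = 0"
  have fin: "finite E" using c by (simp add: skew_coeffs_def)
  \<comment> \<open>The product of \<open>p\<close> with \<open>z\<close>; the coefficient
    \<open>c p (T - {p})\<close> is its own inverse by \<open>unit\<close>.\<close>
  define w where "w T = (if p \<in> T then c p (T - {p}) * z (T - {p}) else 0)" for T
  have "T \<in> \<F>" if "w T \<noteq> 0" for T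
  proof -
    have "p \<in> T" "z (T - {p}) \<noteq> 0" using that by (auto simp: w_def split: if_splits)
    then have "insert p (T - {p}) \<in> \<F>" using supp ins by blast
    with \<open>p \<in> T\<close> show ?thesis by (simp add: insert_absorb)
  qed
  moreover have "bdry E c w T = z T" if T: "T \<in> \<F>" for T
  proof (cases "p \<in> T")
    case False
    have "bdry E c w T = (\<Sum>e\<in>E - T. if e = p then z T else 0)"
      unfolding bdry_def
    proof (intro sum.cong refl)
      fix e assume "e \<in> E - T"
      show "c e T * w (insert e T) = (if e = p then z T else 0)"
        using False unit[of p T] by (auto simp: w_def mult.assoc[symmetric])
    qed
    also have "\<dots> = z T" using p False fin by simp
    finally show ?thesis .
  next
    case True
    define U where "U = T - {p}"
    have U: "T = insert p U" "p \<notin> U" "U \<in> \<F>" "U \<subseteq> E" using True del[OF T] sub by (auto simp: U_def)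
    \<comment> \<open>Skewness moves \<open>p\<close> past \<open>e\<close>. Summed over
      \<open>e\<close> this gives the boundary of \<open>z\<close> at \<open>U\<close> without its
      \<open>p\<close>-term, and the cycle condition at \<open>U\<close> supplies that term.\<close>
    have key: "c e T * w (insert e T) = - (c p U) * (c e U * z (insert e U))" if e: "e \<in> E - T" for e
    proof -
      have ep: "e \<noteq> p" "e \<notin> U" using e U by auto
      have "c p (insert e U) = c e U * (c e U * c p (insert e U))"
        by (simp add: mult.assoc[symmetric] unit)
      also have "\<dots> = c e U * - (c p U * c e T)"
        unfolding U(1) by (subst skew_coeffsD[OF c, of e p U]) (use e p ep U in auto)
      finally have "c e T * c p (insert e U) = - (c e T * c e T) * (c p U * c e U)"
        by (simp add: mult_ac)
      then have "c e T * c p (insert e U) = - (c p U * c e U)" by (simp add: unit)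
      moreover have "w (insert e T) = c p (insert e U) * z (insert e U)"
      proof -
        have "insert e T - {p} = insert e U" using U ep by auto
        then show ?thesis using True by (simp add: w_def)
      qed
      ultimately show ?thesis by (simp add: mult.assoc[symmetric])
    qed
    have "E - U = insert p (E - T)" using U p by auto
    then have "bdry E c z U = c p U * z T + (\<Sum>e\<in>E - T. c e U * z (insert e U))"
      using True fin by (simp add: bdry_def U(1)[symmetric])
    then have s: "(\<Sum>e\<in>E - T. c e U * z (insert e U)) = - (c p U * z T)"
      using cyc U(3) by (simp add: eq_neg_iff_add_eq_0 add.commute)
    have "bdry E c w T = - (c p U) * (\<Sum>e\<in>E - T. c e U * z (insert e U))"
      unfolding bdry_def sum_distrib_left by (intro sum.cong refl key)
    then show ?thesis using unit[of p U] by (simp add: s mult.assoc[symmetric])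
  qed
  ultimately show "\<exists>w. (\<forall>T. w T \<noteq> 0 \<longrightarrow> T \<in> \<F>) \<and> (\<forall>T\<in>\<F>. bdry E c w T = z T)" by blast
qed

text \<open>The chains on \<open>\<G>\<close> form a subcomplex of those on \<open>\<F>\<close>, with quotient the chains on \<open>\<F> - \<G>\<close>.\<close>

lemma acyclic_glue:
  assumes c: "skew_coeffs E c" and sub: "\<And>T. T \<in> \<F> \<Longrightarrow> T \<subseteq> E"
    and convex: "\<And>S T U. S \<in> \<F> \<Longrightarrow> U \<in> \<F> \<Longrightarrow> S \<subseteq> T \<Longrightarrow> T \<subseteq> U \<Longrightarrow> T \<in> \<F>"
    and GF: "\<G> \<subseteq> \<F>" and down: "\<And>S T. T \<in> \<G> \<Longrightarrow> S \<in> \<F> \<Longrightarrow> S \<subseteq> T \<Longrightarrow> S \<in> \<G>"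
    and Q: "\<And>z w. Q z \<Longrightarrow> (\<And>T. z T \<noteq> 0 \<Longrightarrow> T \<in> \<F>) \<Longrightarrow> (\<And>T. w T \<noteq> 0 \<Longrightarrow> T \<in> \<F>) \<Longrightarrow>
      Q (\<lambda>T. if T \<in> \<F> then z T - bdry E c w T else 0)"
    and ex1: "acyclic_family E c \<G> Q" and ex2: "acyclic_family E c (\<F> - \<G>) (\<lambda>_. True)"
  shows "acyclic_family E c \<F> Q"
  unfolding acyclic_family_def
proof (intro allI impI, elim conjE)
  fix z assume supp: "\<forall>T. z T \<noteq> 0 \<longrightarrow> T \<in> \<F>" and cyc: "\<forall>T\<in>\<F>. bdry E c z T = 0" and Qz: "Q z"
  \<comment> \<open>The image of \<open>z\<close> in the quotient. It is a cycle there because no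
    member of \<open>\<F> - \<G>\<close> lies below a member of \<G>.\<close>
  define z2 where "z2 T = (if T \<in> \<G> then 0 else z T)" for T
  have "bdry E c z2 T = 0" if T: "T \<in> \<F> - \<G>" for T
  proof -
    have "bdry E c z2 T = bdry E c z T"
      using down T by (intro bdry_cong) (auto simp: z2_def)
    with cyc T show ?thesis by simp
  qed
  moreover have "z2 T \<noteq> 0 \<Longrightarrow> T \<in> \<F> - \<G>" for T using supp by (auto simp: z2_def split: if_splits)
  ultimately obtain w2 where w2: "\<And>T. w2 T \<noteq> 0 \<Longrightarrow> T \<in> \<F> - \<G>"
    and bw2: "\<And>T. T \<in> \<F> - \<G> \<Longrightarrow> bdry E c w2 T = z2 T"
    using ex2[unfolded acyclic_family_def, rule_format, of z2] by blast
  \<comment> \<open>Subtracting the boundary of the lifted solution leaves a chain that lives on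
    \<G>.\<close>
  define z1 where "z1 T = (if T \<in> \<F> then z T - bdry E c w2 T else 0)" for T
  have z1: "T \<in> \<G>" if "z1 T \<noteq> 0" for T
    using that bw2[of T] by (auto simp: z1_def z2_def split: if_splits)
  have "bdry E c z1 T = 0" if T: "T \<in> \<G>" for T
  proof -
    have TF: "T \<in> \<F>" using T GF by auto
    \<comment> \<open>By convexity a set outside \<F> that contains \<open>T\<close> has no superset
      in \<F>, so cutting the boundary off at \<F> loses nothing.\<close>
    have z': "bdry E c w2 (insert e T) = 0" if "e \<in> E - T" "insert e T \<notin> \<F>" for e
      unfolding bdry_def
    proof (intro sum.neutral ballI)
      fix p assume "p \<in> E - insert e T"
      have "insert p (insert e T) \<notin> \<F>" using that convex[OF TF, of "insert p (insert e T)" "insert e T"] by auto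
      then show "c p (insert e T) * w2 (insert p (insert e T)) = 0" using w2 by force
    qed
    have "bdry E c z1 T = bdry E c (\<lambda>T. z T - bdry E c w2 T) T"
      using z' supp by (intro bdry_cong) (force simp: z1_def)
    also have "\<dots> = 0"
      using bdry_bdry[OF c sub[OF TF]] cyc TF by (simp add: bdry_diff)
    finally show ?thesis .
  qed
  moreover have "Q z1" unfolding z1_def[abs_def] using w2 supp by (intro Q Qz) blast+
  ultimately obtain w1 where w1: "\<And>T. w1 T \<noteq> 0 \<Longrightarrow> T \<in> \<G>"
    and bw1: "\<And>T. T \<in> \<G> \<Longrightarrow> bdry E c w1 T = z1 T"
    using ex1[unfolded acyclic_family_def, rule_format, of z1] z1 by blast
  have "bdry E c (\<lambda>T. w1 T + w2 T) T = z T" if T: "T \<in> \<F>" for T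
  proof (cases "T \<in> \<G>")
    case True
    then show ?thesis using bw1[OF True] T by (simp add: bdry_add z1_def)
  next
    case False
    then have "insert e T \<notin> \<G>" for e using down[of "insert e T" T] T by auto
    then have "w1 (insert e T) = 0" for e using w1 by blast
    then have "bdry E c w1 T = 0" unfolding bdry_def by simp
    then show ?thesis using bw2[of T] False T by (simp add: bdry_add z2_def)
  qed
  moreover have "T \<in> \<F>" if "w1 T + w2 T \<noteq> 0" for T using that w1 w2 GF by force
  ultimately show "\<exists>w. (\<forall>T. w T \<noteq> 0 \<longrightarrow> T \<in> \<F>) \<and> (\<forall>T\<in>\<F>. bdry E c w T = z T)"
    by (intro exI[of _ "\<lambda>T. w1 T + w2 T"]) blast
qed

section \<open>Incidence signs\<close>

definition sgn_at :: "'e::linorder \<Rightarrow> 'e set \<Rightarrow> 'a::comm_ring_1"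
  where "sgn_at e T = (- 1) ^ card {t \<in> T. t < e}"

lemma sgn_at_square: "sgn_at e T * sgn_at e T = 1"
  by (simp add: sgn_at_def power_mult_distrib[symmetric])

lemma sgn_at_insert:
  assumes "finite T" "e \<notin> T"
  shows "sgn_at p (insert e T) = (if e < p then - sgn_at p T else sgn_at p T)"
proof -
  have "{t \<in> insert e T. t < p} = (if e < p then insert e {t \<in> T. t < p} else {t \<in> T. t < p})" by auto
  then show ?thesis using assms by (simp add: sgn_at_def)
qed

lemma sgn_at_self: "sgn_at e (insert e T) = sgn_at e T"
proof -
  have "{t \<in> insert e T. t < e} = {t \<in> T. t < e}" by auto
  then show ?thesis by (simp add: sgn_at_def)
qed

lemma sgn_at_skew:
  assumes "finite E" 
  shows "skew_coeffs E (\<lambda>e T. sgn_at e T * y e)"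
  unfolding skew_coeffs_def
proof (intro conjI allI impI assms)
  fix e p T assume "e \<in> E" "p \<in> E" "T \<subseteq> E" "e \<noteq> p" "e \<notin> T" "p \<notin> T"
  moreover have "finite T" using \<open>T \<subseteq> E\<close> assms finite_subset by blast
  ultimately show "sgn_at e T * y e * (sgn_at p (insert e T) * y p)
      = - (sgn_at p T * y p * (sgn_at e (insert p T) * y e))"
    by (cases "e < p") (auto simp: sgn_at_insert mult_ac)
qed

text \<open>Signs may equally be counted in the complement. The Koszul complex of the lower bound
  uses this version because its cycle is described by the sets \<open>E - T\<close>.\<close>

lemma cosgn_skew:
  assumes "finite E"
  shows "skew_coeffs E (\<lambda>e T. sgn_at e (E - T) * y e)"
  unfolding skew_coeffs_def
proof (intro conjI allI impI assms)
  fix e p T assume *: "e \<in> E" "p \<in> E" "T \<subseteq> E" "e \<noteq> p" "e \<notin> T" "p \<notin> T"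
  define U where "U = E - T - {e, p}"
  have "E - T = insert e (insert p U)" "E - insert e T = insert p U" "E - insert p T = insert e U"
    using * by (auto simp: U_def)
  moreover have "finite U" "e \<notin> U" "p \<notin> U" using assms by (auto simp: U_def)
  ultimately show "sgn_at e (E - T) * y e * (sgn_at p (E - insert e T) * y p)
      = - (sgn_at p (E - T) * y p * (sgn_at e (E - insert p T) * y e))"
    using *(4) by (cases "e < p") (auto simp: sgn_at_insert sgn_at_self mult_ac)
qed

lemma image_remove_eq:
  assumes "e' \<in> F" "e' \<noteq> e" "f e' = f e"
  shows "f ` (F - {e}) = f ` F"
proof -
  have "f e \<in> f ` (F - {e})" using assms by (metis Diff_iff image_eqI singletonD)
  then show ?thesis by auto
qed

text \<open>In the lexicographic order, nothing in \<open>F\<close> lies between the two elements of the only fibre of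
  size two, so that removing one or the other comes with opposite signs.\<close>

lemma two_element_fibre:
  fixes F :: "('v::linorder \<times> nat) set"
  assumes fin: "finite F" and im: "fst ` F = P" and card: "card F = Suc (card P)"
  obtains c i j where "i < j" "(c, i) \<in> F" "(c, j) \<in> F"
    and "{e \<in> F. fst ` (F - {e}) = P} = {(c, i), (c, j)}"
    and "(sgn_at (c, i) (F - {(c, i)}) :: 'a::comm_ring_1) = - sgn_at (c, j) (F - {(c, j)})"
proof -
  have "\<not> inj_on fst F"
    using card_image[of fst F] im card by auto
  then obtain c i' j' where "(c, i') \<in> F" "(c, j') \<in> F" "i' \<noteq> j'"
    unfolding inj_on_def by (metis prod.collapse)
  then obtain i j where ij: "i < j" "(c, i) \<in> F" "(c, j) \<in> F"
    by (metis linorder_neqE_nat)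
  have im': "fst ` (F - {(c, j)}) = P"
    using image_remove_eq[of "(c, i)" F "(c, j)" fst] ij im by simp
  \<comment> \<open>Without \<open>(c, j)\<close> the projection is already a bijection, so all
    other fibres are singletons and the one over \<open>c\<close> is \<open>{i, j}\<close>.\<close>
  have inj: "inj_on fst (F - {(c, j)})"
    using fin card ij(3) im' by (intro eq_card_imp_inj_on) (auto simp: card_Diff_singleton)
  have inj': "k = k'" if "(d, k) \<in> F" "(d, k') \<in> F" "(d, k) \<noteq> (c, j)" "(d, k') \<noteq> (c, j)" for d k k'
    using inj_onD[OF inj, of "(d, k)" "(d, k')"] that by simp
  have only: "k \<in> {i, j}" if "(c, k) \<in> F" for k
    using inj'[of c k i] that ij by (cases "k = j") auto
  have "fst ` (F - {e}) = P \<longleftrightarrow> e \<in> {(c, i), (c, j)}" if e: "e \<in> F" for e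
  proof
    assume "fst ` (F - {e}) = P"
    moreover have "fst e \<in> P" using e im by auto
    ultimately obtain k where k: "(fst e, k) \<in> F" "(fst e, k) \<noteq> e" by force
    show "e \<in> {(c, i), (c, j)}"
    proof (cases "fst e = c")
      case True
      then show ?thesis using only[of "snd e"] e by (cases e) auto
    next
      case False
      then show ?thesis using inj'[of "fst e" k "snd e"] k e by (cases e) auto
    qed
  next
    assume "e \<in> {(c, i), (c, j)}"
    then show "fst ` (F - {e}) = P"
      using image_remove_eq[of "(c, i)" F "(c, j)" fst] image_remove_eq[of "(c, j)" F "(c, i)" fst] ij im
      by auto
  qed
  then have "{e \<in> F. fst ` (F - {e}) = P} = {e \<in> F. e \<in> {(c, i), (c, j)}}"
    by (intro Collect_cong conj_cong refl)
  also have "\<dots> = {(c, i), (c, j)}" using ij by auto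
  finally have eq: "{e \<in> F. fst ` (F - {e}) = P} = {(c, i), (c, j)}" .
  have "{t \<in> F - {(c, j)}. t < (c, j)} = insert (c, i) {t \<in> F - {(c, i)}. t < (c, i)}"
  proof (intro equalityI subsetI)
    fix t assume t: "t \<in> {t \<in> F - {(c, j)}. t < (c, j)}"
    show "t \<in> insert (c, i) {t \<in> F - {(c, i)}. t < (c, i)}"
    proof (cases t)
      case (Pair d k)
      with t only[of k] show ?thesis by (auto simp: less_prod_simp)
    qed
  qed (use ij in \<open>auto simp: less_prod_simp\<close>)
  then have "card {t \<in> F - {(c, j)}. t < (c, j)} = Suc (card {t \<in> F - {(c, i)}. t < (c, i)})"
    using fin by simp
  then have "(sgn_at (c, i) (F - {(c, i)}) :: 'a) = - sgn_at (c, j) (F - {(c, j)})"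
    by (simp add: sgn_at_def)
  with ij eq that show thesis by blast
qed

section \<open>The complex of multihomomorphisms from a poset to a chain\<close>

locale multihom =
  fixes P :: "'v::linorder set" and le :: "'v \<Rightarrow> 'v \<Rightarrow> bool" and m :: nat
  assumes finP: "finite P"
    and le_trans: "\<And>a b c. a \<in> P \<Longrightarrow> b \<in> P \<Longrightarrow> c \<in> P \<Longrightarrow> le a b \<Longrightarrow> le b c \<Longrightarrow> le a c"
    and le_antisym: "\<And>a b. a \<in> P \<Longrightarrow> b \<in> P \<Longrightarrow> le a b \<Longrightarrow> le b a \<Longrightarrow> a = b"
begin

definition cells :: "('v \<times> nat) set"
  where "cells = P \<times> {1..m}"

text \<open>\<open>F\<close> encodes the product of the simplices on the vertex sets \<open>F\<^sub>c = {j. (c, j) \<in> F}\<close>.\<close>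

definition adm :: "('v \<times> nat) set \<Rightarrow> bool"
  where "adm F \<longleftrightarrow> F \<subseteq> cells \<and> fst ` F = P
    \<and> (\<forall>(c, i)\<in>F. \<forall>(d, j)\<in>F. le c d \<longrightarrow> c \<noteq> d \<longrightarrow> i \<le> j)"

text \<open>Admissible sets with \<open>card P\<close> elements have one element in each fibre: they
  are the vertices of the complex.\<close>

definition aug :: "(('v \<times> nat) set \<Rightarrow> 'a::comm_ring_1) \<Rightarrow> 'a"
  where "aug z = (\<Sum>T | adm T \<and> card T = card P. z T)"

lemma fin_cells: "finite cells"
  using finP by (simp add: cells_def)

lemma adm_sub: "adm F \<Longrightarrow> F \<subseteq> cells"
  by (simp add: adm_def)

lemma adm_finite: "adm F \<Longrightarrow> finite F"
  using adm_sub fin_cells finite_subset by blast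

lemma finite_adm: "finite {T. adm T \<and> R T}"
  by (rule finite_subset[of _ "Pow cells"]) (use fin_cells adm_sub in auto)

lemma adm_fst: "adm F \<Longrightarrow> (c, j) \<in> F \<Longrightarrow> c \<in> P"
  using adm_sub by (auto simp: cells_def)

lemma adm_fibre:
  assumes "adm F" "c \<in> P"
  shows "\<exists>j. (c, j) \<in> F"
proof -
  have "c \<in> fst ` F" using assms by (simp add: adm_def)
  then show ?thesis by force
qed

lemma adm_subset: "adm F \<Longrightarrow> T \<subseteq> F \<Longrightarrow> fst ` T = P \<Longrightarrow> adm T"
  unfolding adm_def by blast

lemma adm_convex:
  assumes "adm S" "adm U" "S \<subseteq> T" "T \<subseteq> U"
  shows "adm T"
proof -
  have "fst ` S = P" "fst ` U = P" using assms(1,2) by (simp_all add: adm_def)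
  then have "fst ` T = P" using image_mono[OF assms(3), of fst] image_mono[OF assms(4), of fst] by simp
  then show ?thesis by (rule adm_subset[OF assms(2,4)])
qed

lemma adm_card: "adm F \<Longrightarrow> card P \<le> card F"
  using card_image_le[OF adm_finite, of F fst] by (simp add: adm_def)

text \<open>An edge has exactly two end points, which enter with opposite signs by
  \<open>two_element_fibre\<close>. The double sum over vertices is regrouped by edges to make this
  visible.\<close>

lemma aug_bdry:
  fixes w :: "('v \<times> nat) set \<Rightarrow> 'a::comm_ring_1"
  assumes supp: "\<And>T. w T \<noteq> 0 \<Longrightarrow> adm T"
  shows "aug (bdry cells sgn_at w) = 0"
proof -
  define A where "A = {T. adm T \<and> card T = card P}"
  define B where "B = {T. adm T \<and> card T = Suc (card P)}"
  define Y where "Y = {(T, e). T \<in> A \<and> e \<in> cells - T \<and> adm (insert e T)}"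
  have fin: "finite A" "finite B" unfolding A_def B_def by (rule finite_adm)+
  have "aug (bdry cells sgn_at w) = (\<Sum>T\<in>A. \<Sum>e\<in>cells - T. sgn_at e T * w (insert e T))"
    by (simp add: aug_def bdry_def A_def)
  also have "\<dots> = (\<Sum>(T, e)\<in>(SIGMA T:A. cells - T). sgn_at e T * w (insert e T))"
    using fin fin_cells by (intro sum.Sigma) auto
  also have "\<dots> = (\<Sum>(T, e)\<in>Y. sgn_at e T * w (insert e T))"
  proof (intro sum.mono_neutral_right ballI)
    fix x assume x: "x \<in> (SIGMA T:A. cells - T) - Y"
    obtain T e where "x = (T, e)" by (cases x)
    then have "\<not> adm (insert e T)" using x by (auto simp: Y_def)
    then have "w (insert e T) = 0" using supp by blast
    then show "(case x of (T, e) \<Rightarrow> sgn_at e T * w (insert e T)) = 0" using \<open>x = (T, e)\<close> by simp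
  qed (use fin fin_cells in \<open>auto simp: Y_def\<close>)
  also have "\<dots> = (\<Sum>(F, e)\<in>(SIGMA F:B. {e \<in> F. fst ` (F - {e}) = P}). sgn_at e (F - {e}) * w F)"
  proof (rule sum.reindex_bij_witness[where i = "\<lambda>(F, e). (F - {e}, e)" and j = "\<lambda>(T, e). (insert e T, e)"])
    fix x assume "x \<in> Y"
    moreover obtain T e where x: "x = (T, e)" by (cases x)
    ultimately have T: "adm T" "card T = card P" and e: "e \<in> cells" "e \<notin> T" "adm (insert e T)"
      unfolding Y_def A_def by simp_all
    have del: "insert e T - {e} = T" using e(2) by simp
    have "fst ` T = P" using T(1) by (simp add: adm_def)
    then show "(case x of (T, e) \<Rightarrow> (insert e T, e)) \<in> (SIGMA F:B. {e \<in> F. fst ` (F - {e}) = P})"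
      using T e adm_finite by (simp add: x B_def)
    show "(case case x of (T, e) \<Rightarrow> (insert e T, e) of (F, e) \<Rightarrow> (F - {e}, e)) = x"
      "(case case x of (T, e) \<Rightarrow> (insert e T, e) of (F, e) \<Rightarrow> sgn_at e (F - {e}) * w F)
        = (case x of (T, e) \<Rightarrow> sgn_at e T * w (insert e T))"
      by (simp_all add: x del)
  next
    fix x assume "x \<in> (SIGMA F:B. {e \<in> F. fst ` (F - {e}) = P})"
    moreover obtain F e where x: "x = (F, e)" by (cases x)
    ultimately have F: "adm F" "card F = Suc (card P)" "e \<in> F" "fst ` (F - {e}) = P"
      unfolding B_def by simp_all
    have "adm (F - {e})" by (rule adm_subset[OF F(1) _ F(4)]) blast
    then show "(case x of (F, e) \<Rightarrow> (F - {e}, e)) \<in> Y"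
      using F(1-3) subsetD[OF adm_sub[OF F(1)] F(3)] adm_finite[OF F(1)]
      by (simp add: x Y_def A_def insert_absorb)
    show "(case case x of (F, e) \<Rightarrow> (F - {e}, e) of (T, e) \<Rightarrow> (insert e T, e)) = x"
      using F(3) by (simp add: x insert_absorb)
  qed
  also have "\<dots> = (\<Sum>F\<in>B. \<Sum>e | e \<in> F \<and> fst ` (F - {e}) = P. sgn_at e (F - {e}) * w F)"
    using fin by (intro sum.Sigma[symmetric]) (auto simp: B_def adm_finite)
  also have "\<dots> = 0"
  proof (rule sum.neutral, rule ballI)
    fix F assume "F \<in> B"
    then have "finite F" "fst ` F = P" "card F = Suc (card P)"
      using adm_finite by (simp_all add: B_def adm_def)
    then obtain c i j where "i < j" and eq: "{e \<in> F. fst ` (F - {e}) = P} = {(c, i), (c, j)}"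
      and s: "(sgn_at (c, i) (F - {(c, i)}) :: 'a) = - sgn_at (c, j) (F - {(c, j)})"
      by (rule two_element_fibre)
    then show "(\<Sum>e | e \<in> F \<and> fst ` (F - {e}) = P. sgn_at e (F - {e}) * w F) = 0"
      unfolding eq by simp
  qed
  finally show ?thesis .
qed

lemma skew_sgn: "skew_coeffs cells (sgn_at :: 'v \<times> nat \<Rightarrow> _ \<Rightarrow> 'a::comm_ring_1)"
  using sgn_at_skew[OF fin_cells, of "\<lambda>_. 1"] by simp

lemma ex_minimal:
  assumes "Q \<subset> P"
  obtains c where "c \<in> P - Q" and "\<And>d. d \<in> P \<Longrightarrow> le d c \<Longrightarrow> d \<noteq> c \<Longrightarrow> d \<in> Q"
proof -
  define r where "r = {(a, b). a \<in> P \<and> b \<in> P \<and> le a b \<and> a \<noteq> b}"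
  have "trans r" unfolding trans_def r_def using le_trans le_antisym by blast
  then have "acyclic r" by (simp add: acyclic_irrefl irrefl_def r_def)
  moreover have "finite r" by (rule finite_subset[of _ "P \<times> P"]) (use finP in \<open>auto simp: r_def\<close>)
  ultimately have "wf r" by (rule finite_acyclic_wf[rotated])
  then obtain c where "c \<in> P - Q" "\<And>d. (d, c) \<in> r \<Longrightarrow> d \<notin> P - Q"
    using assms unfolding wf_eq_minimal by (metis DiffI psubset_imp_ex_mem)
  then show thesis by (intro that[of c]) (auto simp: r_def)
qed

text \<open>Let \<open>\<psi>\<close> be the pointwise minimum of the multihomomorphisms with graph in \<open>E'\<close>. Those agreeing
  with \<open>\<psi>\<close> on a down-set \<open>Q\<close> form a subcomplex; enlarging \<open>Q\<close> by a minimal element \<open>c\<close> of the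
  complement removes a cone with apex \<open>(c, \<psi> c)\<close>.\<close>

theorem acyclic_multihom:
  "acyclic_family cells (sgn_at :: _ \<Rightarrow> _ \<Rightarrow> 'a::comm_ring_1) {T. adm T \<and> T \<subseteq> E'} (\<lambda>z. aug z = 0)"
proof -
  let ?\<F> = "{T. adm T \<and> T \<subseteq> E'}"
  define \<psi> where "\<psi> c = (LEAST j. \<exists>F\<in>?\<F>. (c, j) \<in> F)" for c
  define fam where "fam Q = {T \<in> ?\<F>. \<forall>(c, j)\<in>T. c \<in> Q \<longrightarrow> j = \<psi> c}" for Q
  have psi_le: "\<psi> c \<le> j" if "F \<in> ?\<F>" "(c, j) \<in> F" for F c j
    unfolding \<psi>_def by (rule Least_le) (use that in blast)
  have psi_ex: "\<exists>F\<in>?\<F>. (c, \<psi> c) \<in> F" if "F \<in> ?\<F>" "c \<in> P" for F c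
  proof -
    have "\<exists>j. \<exists>F\<in>?\<F>. (c, j) \<in> F" using adm_fibre[of F c] that by blast
    then show ?thesis unfolding \<psi>_def by (rule LeastI_ex)
  qed
  \<comment> \<open>Some member of the family attains the minimum over \<open>d\<close>, and its
    values over \<open>c\<close> are bounded by that minimum.\<close>
  have psi_mono: "\<psi> c \<le> \<psi> d" if F: "F \<in> ?\<F>" "c \<in> P" "d \<in> P" "le c d" "c \<noteq> d" for F c d
  proof -
    obtain F' where F': "F' \<in> ?\<F>" "(d, \<psi> d) \<in> F'" using psi_ex[OF F(1,3)] by blast
    then obtain i where i: "(c, i) \<in> F'" using adm_fibre[of F' c] F(2) by blast
    have "i \<le> \<psi> d" using F' i F(4,5) unfolding adm_def by blast
    with psi_le[OF F'(1) i] show ?thesis by simp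
  qed
  have down_fam: "S \<in> fam Q" if "T \<in> fam Q" "adm S" "S \<subseteq> T" for S T Q
    using that unfolding fam_def by blast
  \<comment> \<open>Induction from \<open>Q = P\<close>, where at most the graph of \<psi> is left,
    down to \<open>Q = {}\<close>, which gives the whole family.\<close>
  have "acyclic_family cells (sgn_at :: _ \<Rightarrow> _ \<Rightarrow> 'a) (fam Q) (\<lambda>z. aug z = 0)"
    if "Q \<subseteq> P" "\<And>c d. c \<in> P \<Longrightarrow> d \<in> Q \<Longrightarrow> le c d \<Longrightarrow> c \<in> Q" for Q
    using that
  proof (induct "card (P - Q)" arbitrary: Q rule: less_induct)
    case less
    show ?case
    proof (cases "Q = P")
      case True
      have only: "T = (\<lambda>c. (c, \<psi> c)) ` P" if "T \<in> fam Q" for T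
      proof -
        have admT: "adm T" using that by (simp add: fam_def)
        have T1: "j = \<psi> c" if "(c, j) \<in> T" for c j
          using \<open>T \<in> fam Q\<close> adm_fst[OF admT that] that True unfolding fam_def by blast
        have T2: "\<exists>j. (c, j) \<in> T" if "c \<in> P" for c using adm_fibre[OF admT that] .
        show ?thesis
        proof (intro equalityI subsetI)
          fix e assume e: "e \<in> T"
          then have "e = (fst e, \<psi> (fst e))" using T1[of "fst e" "snd e"] by (simp add: prod_eq_iff)
          moreover have "fst e \<in> P" using adm_fst[OF admT, of "fst e" "snd e"] e by simp
          ultimately show "e \<in> (\<lambda>c. (c, \<psi> c)) ` P" by blast
        next
          fix e assume "e \<in> (\<lambda>c. (c, \<psi> c)) ` P"
          then obtain c where c: "c \<in> P" "e = (c, \<psi> c)" by auto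
          then obtain j where "(c, j) \<in> T" using T2 by blast
          then show "e \<in> T" using T1 c by auto
        qed
      qed
      \<comment> \<open>Only one vertex is left, so the augmentation of \<open>z\<close> is its
        single coefficient.\<close>
      have z0: "z T = 0" if supp: "\<forall>T. z T \<noteq> 0 \<longrightarrow> T \<in> fam Q" and aug: "aug z = 0" and T: "T \<in> fam Q"
        for z :: "('v \<times> nat) set \<Rightarrow> 'a" and T
      proof -
        have "inj_on (\<lambda>c. (c, \<psi> c)) P" by (auto simp: inj_on_def)
        then have "card T = card P" using only[OF T] by (simp add: card_image)
        moreover have "adm T" using T by (simp add: fam_def)
        ultimately have "aug z = (\<Sum>T\<in>{T}. z T)" unfolding aug_def
          using only[OF T] only supp finite_adm
          by (intro sum.mono_neutral_right) auto
        then show ?thesis using aug by simp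
      qed
      show ?thesis unfolding acyclic_family_def
      proof (intro allI impI, elim conjE)
        fix z :: "('v \<times> nat) set \<Rightarrow> 'a"
        assume supp: "\<forall>T. z T \<noteq> 0 \<longrightarrow> T \<in> fam Q" and aug: "aug z = 0"
        have "\<forall>T\<in>fam Q. z T = 0" using z0[OF supp aug] by blast
        then show "\<exists>w. (\<forall>T. w T \<noteq> 0 \<longrightarrow> T \<in> fam Q) \<and> (\<forall>T\<in>fam Q. bdry cells sgn_at w T = z T)"
          by (intro exI[of _ "\<lambda>_. 0"]) (simp add: bdry_def)
      qed
    next
      case False
      then have "Q \<subset> P" using less(2) by auto
      then obtain c where c: "c \<in> P - Q"
        and min: "\<And>d. d \<in> P \<Longrightarrow> le d c \<Longrightarrow> d \<noteq> c \<Longrightarrow> d \<in> Q" by (erule ex_minimal)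
      let ?Q = "insert c Q"
      have Q': "?Q \<subseteq> P" using c less(2) by blast
      have Q'': "b \<in> ?Q" if "b \<in> P" "d \<in> ?Q" "le b d" for b d
        using that min[of b] less(3)[of b d] by blast
      have "P - ?Q \<subset> P - Q" using c by auto
      then have lt: "card (P - ?Q) < card (P - Q)" using finP by (intro psubset_card_mono) auto
      have ex1: "acyclic_family cells (sgn_at :: _ \<Rightarrow> _ \<Rightarrow> 'a) (fam ?Q) (\<lambda>z. aug z = 0)"
        by (rule less(1)[OF lt Q' Q''])
      have mem2: "T \<in> fam Q - fam ?Q \<longleftrightarrow> T \<in> fam Q \<and> (\<exists>j. (c, j) \<in> T \<and> j \<noteq> \<psi> c)" for T
        unfolding fam_def by auto
      have ex2: "acyclic_family cells (sgn_at :: _ \<Rightarrow> _ \<Rightarrow> 'a) (fam Q - fam ?Q) (\<lambda>_. True)"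
      \<comment> \<open>\<psi> is a genuine minimum only if the family is nonempty, so an empty
        difference is treated apart.\<close>
      proof (cases "fam Q - fam ?Q = {}")
        case True
        then show ?thesis unfolding acyclic_family_def by (auto intro!: exI[of _ "\<lambda>_. 0"])
      next
        case False
        then obtain F0 where F0: "F0 \<in> ?\<F>" by (auto simp: fam_def)
        obtain F1 where F1: "F1 \<in> ?\<F>" "(c, \<psi> c) \<in> F1" using psi_ex[OF F0] c by auto
        then have p: "(c, \<psi> c) \<in> cells" "(c, \<psi> c) \<in> E'" using adm_sub by auto
        show ?thesis
        proof (rule acyclic_cone[where p = "(c, \<psi> c)"])
          fix T assume T: "T \<in> fam Q - fam ?Q"
          then have TF: "T \<in> ?\<F>" and TQ: "T \<in> fam Q" by (auto simp: fam_def)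
          obtain j where j: "(c, j) \<in> T" "j \<noteq> \<psi> c" using T mem2 by blast
          show "T \<subseteq> cells" using TF adm_sub by auto
          have "fst ` insert (c, \<psi> c) T = P" using TF c by (simp add: adm_def insert_absorb)
          \<comment> \<open>Below \<open>c\<close> the values are those of \<psi>, by minimality of
            \<open>c\<close> and membership in \<open>fam Q\<close>; above \<open>c\<close> they are
            at least \<open>j\<close>, hence at least \<open>\<psi> c\<close>.\<close>
          moreover have "i \<le> k" if ik: "(a, i) \<in> insert (c, \<psi> c) T" "(b, k) \<in> insert (c, \<psi> c) T"
            "le a b" "a \<noteq> b" for a b i k
          proof -
            have ab: "a \<in> P" "b \<in> P" using ik(1,2) TF c adm_sub by (auto simp: cells_def)
            consider "(a, i) \<in> T" "(b, k) \<in> T" | "(a, i) \<in> T" "b = c" "k = \<psi> c" | "a = c" "i = \<psi> c" "(b, k) \<in> T"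
              using ik by auto
            then show ?thesis
            proof cases
              case 1
              then show ?thesis using TF ik unfolding adm_def by blast
            next
              case 2
              then have "i = \<psi> a" using TQ min[of a] ab ik unfolding fam_def by blast
              then show ?thesis using 2 psi_mono[OF F0, of a c] ab c ik by auto
            next
              case 3
              then have "j \<le> k" using TF j ik unfolding adm_def by blast
              then show ?thesis using psi_le[OF TF j(1)] 3 by simp
            qed
          qed
          ultimately have "adm (insert (c, \<psi> c) T)" unfolding adm_def using p TF adm_sub by auto
          then show "insert (c, \<psi> c) T \<in> fam Q - fam ?Q"
            using TQ p j c unfolding mem2 by (auto simp: fam_def)
          \<comment> \<open>The element \<open>(c, j)\<close> stays, so the fibre over
            \<open>c\<close> does not become empty.\<close>
          have fib: "fst ` (T - {(c, \<psi> c)}) = P"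
            using image_remove_eq[of "(c, j)" T "(c, \<psi> c)" fst] j TF by (simp add: adm_def)
          have "adm T" using TF by simp
          then have "adm (T - {(c, \<psi> c)})" by (rule adm_subset[OF _ _ fib]) blast
          then have "T - {(c, \<psi> c)} \<in> fam Q" by (rule down_fam[OF TQ]) blast
          moreover have "(c, j) \<in> T - {(c, \<psi> c)}" using j by simp
          ultimately show "T - {(c, \<psi> c)} \<in> fam Q - fam ?Q" unfolding mem2 using j(2) by blast
        qed (use skew_sgn p in \<open>auto simp: sgn_at_square\<close>)
      qed
      show ?thesis
      proof (rule acyclic_glue[OF skew_sgn _ _ _ _ _ ex1 ex2])
        show "T \<subseteq> cells" if "T \<in> fam Q" for T using that adm_sub by (auto simp: fam_def)
        show "T \<in> fam Q" if "S \<in> fam Q" "U \<in> fam Q" "S \<subseteq> T" "T \<subseteq> U" for S T U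
          using that adm_convex[of S U T] by (intro down_fam[of U Q T]) (auto simp: fam_def)
        show "fam ?Q \<subseteq> fam Q" by (auto simp: fam_def)
        show "S \<in> fam ?Q" if "T \<in> fam ?Q" "S \<in> fam Q" "S \<subseteq> T" for S T
          using that by (intro down_fam[of T ?Q S]) (auto simp: fam_def)
        fix z w :: "('v \<times> nat) set \<Rightarrow> 'a"
        assume aug: "aug z = 0" and z: "\<And>T. z T \<noteq> 0 \<Longrightarrow> T \<in> fam Q" and w: "\<And>T. w T \<noteq> 0 \<Longrightarrow> T \<in> fam Q"
        \<comment> \<open>At admissible cells outside \<open>fam Q\<close> both terms vanish,
          because \<open>fam Q\<close> is closed under admissible subsets. Hence \<open>aug\<close>
          does not notice the truncation.\<close>
        have "(if T \<in> fam Q then z T - bdry cells sgn_at w T else 0) = z T - bdry cells sgn_at w T"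
          if "adm T" for T
        proof (cases "T \<in> fam Q")
          case False
          then have "w (insert e T) = 0" for e
            using w down_fam[of "insert e T" Q T] that by blast
          then show ?thesis using False z by (auto simp: bdry_def)
        qed simp
        then have "aug (\<lambda>T. if T \<in> fam Q then z T - bdry cells sgn_at w T else 0)
            = aug z - aug (bdry cells sgn_at w)"
          unfolding aug_def by (simp add: sum_subtractf)
        also have "\<dots> = 0" using aug aug_bdry[of w] w by (auto simp: fam_def)
        finally show "aug (\<lambda>T. if T \<in> fam Q then z T - bdry cells sgn_at w T else 0) = 0" .
      qed
    qed
  qed
  from this[of "{}"] have "acyclic_family cells (sgn_at :: _ \<Rightarrow> _ \<Rightarrow> 'a) (fam {}) (\<lambda>z. aug z = 0)" by simp
  moreover have "fam {} = ?\<F>" by (auto simp: fam_def)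
  ultimately show ?thesis by simp
qed

end

section \<open>Polynomial rings and multidegrees\<close>

lemma mpoly_ring_simps [simp]:
  "monoid.mult (mpoly_ring V) = (*)" "monoid.one (mpoly_ring V) = 1"
  "ring.zero (mpoly_ring V) = 0" "ring.add (mpoly_ring V) = (+)"
  by (auto simp: mpoly_ring_def ring_of_type_algebra_def fun_eq_iff)

lemma mem_mpoly_ring: "p \<in> carrier (mpoly_ring V) \<longleftrightarrow> (\<forall>t\<in>Poly_Mapping.keys p. Poly_Mapping.keys t \<subseteq> V)"
  by (simp add: mpoly_ring_def)

lemma mpoly_ring_zero: "0 \<in> carrier (mpoly_ring V)"
  and mpoly_ring_one: "1 \<in> carrier (mpoly_ring V)"
  and mpoly_ring_uminus: "p \<in> carrier (mpoly_ring V) \<Longrightarrow> - p \<in> carrier (mpoly_ring V)"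
  by (simp_all add: mem_mpoly_ring in_keys_iff)

lemma mpoly_ring_add:
  "p \<in> carrier (mpoly_ring V) \<Longrightarrow> q \<in> carrier (mpoly_ring V) \<Longrightarrow> p + q \<in> carrier (mpoly_ring V)"
  using Poly_Mapping.keys_add[of p q] unfolding mem_mpoly_ring by blast

lemma mpoly_ring_mult:
  assumes "p \<in> carrier (mpoly_ring V)" "q \<in> carrier (mpoly_ring V)"
  shows "p * q \<in> carrier (mpoly_ring V)"
  unfolding mem_mpoly_ring
proof
  fix t assume "t \<in> Poly_Mapping.keys (p * q)"
  then obtain a b where "t = a + b" "a \<in> Poly_Mapping.keys p" "b \<in> Poly_Mapping.keys q"
    using keys_mult[of p q] by blast
  then show "Poly_Mapping.keys t \<subseteq> V"
    using assms Poly_Mapping.keys_add[of a b] unfolding mem_mpoly_ring by blast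
qed

lemmas mpoly_ring_closed =
  mpoly_ring_zero mpoly_ring_one mpoly_ring_add mpoly_ring_mult mpoly_ring_uminus

lemma mpoly_ring_cring: "cring (mpoly_ring V)"
proof (rule cringI)
  show "abelian_group (mpoly_ring V)"
  proof (rule abelian_groupI)
    fix p assume "p \<in> carrier (mpoly_ring V)"
    then show "\<exists>q\<in>carrier (mpoly_ring V). q \<oplus>\<^bsub>mpoly_ring V\<^esub> p = \<zero>\<^bsub>mpoly_ring V\<^esub>"
      by (intro bexI[of _ "- p"] mpoly_ring_closed) simp_all
  qed (simp_all add: mpoly_ring_closed add_ac)
  show "comm_monoid (mpoly_ring V)"
    by (rule comm_monoidI) (simp_all add: mpoly_ring_closed mult_ac)
qed (simp add: distrib_right)

lemma finsum_mpoly_ring: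
  assumes "finite A" "f \<in> A \<rightarrow> carrier (mpoly_ring V)"
  shows "finsum (mpoly_ring V) f A = sum f A"
  using assms
proof (induct A)
  case empty
  interpret cring "mpoly_ring V" by (rule mpoly_ring_cring)
  show ?case by simp
next
  case (insert a A)
  interpret cring "mpoly_ring V" by (rule mpoly_ring_cring)
  show ?case using insert by (subst finsum_insert) (simp_all add: Pi_def)
qed

lemma sum_mpoly_ring_closed:
  "(\<And>a. a \<in> A \<Longrightarrow> f a \<in> carrier (mpoly_ring V)) \<Longrightarrow> sum f A \<in> carrier (mpoly_ring V)"
  by (induct A rule: infinite_finite_induct) (simp_all add: mpoly_ring_closed)

lemma minus_one_power_closed: "(- 1) ^ k \<in> carrier (mpoly_ring V)"
  by (induct k) (simp_all add: mpoly_ring_closed)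

abbreviation mon :: "('x \<Rightarrow>\<^sub>0 nat) \<Rightarrow> ('x, 'k::field) mpoly"
  where "mon t \<equiv> Poly_Mapping.single t 1"

lemma mon_closed: "Poly_Mapping.keys t \<subseteq> V \<Longrightarrow> mon t \<in> carrier (mpoly_ring V)"
  by (simp add: mem_mpoly_ring)

lemma mon_add: "mon (s + t) = mon s * mon t"
  by (simp add: mult_single)

section \<open>Divisibility of monomials and multigraded strands\<close>

definition mdvd :: "('x \<Rightarrow>\<^sub>0 nat) \<Rightarrow> ('x \<Rightarrow>\<^sub>0 nat) \<Rightarrow> bool"
  where "mdvd a b \<longleftrightarrow> (\<exists>t. b = a + t)"

lemma mdvd_iff: "mdvd a b \<longleftrightarrow> (\<forall>x. Poly_Mapping.lookup a x \<le> Poly_Mapping.lookup b x)"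
proof
  assume *: "\<forall>x. Poly_Mapping.lookup a x \<le> Poly_Mapping.lookup b x"
  have "b = a + (b - a)"
    by (rule poly_mapping_eqI) (simp add: lookup_add lookup_minus *)
  then show "mdvd a b" unfolding mdvd_def by blast
qed (auto simp: mdvd_def lookup_add)

lemma lookup_mon_mult: "Poly_Mapping.lookup (mon a * h) (a + t) = Poly_Mapping.lookup h t"
  by (simp add: lookup_mult lookup_single when_mult mult_when)

lemma lookup_mon_mult_zero: "\<not> mdvd a b \<Longrightarrow> Poly_Mapping.lookup (mon a * h) b = 0"
  by (simp add: lookup_mult lookup_single when_mult mult_when mdvd_def)

lemma lookup_sign_mult:
  "Poly_Mapping.lookup ((- 1) ^ k * (p :: ('x, 'k::field) mpoly)) b = (- 1) ^ k * Poly_Mapping.lookup p b"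
  by (cases "even k") simp_all

text \<open>The sign exponent \<open>s\<close> is a parameter because there are two instances: the
  cellular complex counts the elements below \<open>e\<close> in \<open>T\<close>, the Koszul
  complex those in the complement of \<open>T\<close>.\<close>

locale labels =
  fixes E :: "'e set" and \<beta> :: "'e \<Rightarrow> ('x \<Rightarrow>\<^sub>0 nat)" and V :: "'x set" and s :: "'e \<Rightarrow> 'e set \<Rightarrow> nat"
  assumes fin: "finite E" and keys_label: "\<And>e. e \<in> E \<Longrightarrow> Poly_Mapping.keys (\<beta> e) \<subseteq> V"
    and coprime_labels: "\<And>e e'. e \<in> E \<Longrightarrow> e' \<in> E \<Longrightarrow> e \<noteq> e' \<Longrightarrow>
      Poly_Mapping.keys (\<beta> e) \<inter> Poly_Mapping.keys (\<beta> e') = {}"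
begin

definition lab :: "'e set \<Rightarrow> ('x \<Rightarrow>\<^sub>0 nat)"
  where "lab T = (\<Sum>e\<in>T. \<beta> e)"

definition cmon :: "'e \<Rightarrow> 'e set \<Rightarrow> ('x, 'k::field) mpoly"
  where "cmon e T = (- 1) ^ s e T * mon (\<beta> e)"

text \<open>The basis element \<open>T\<close> has multidegree \<open>lab T\<close>, which makes the boundary map homogeneous.\<close>

definition comp :: "('x \<Rightarrow>\<^sub>0 nat) \<Rightarrow> ('e set \<Rightarrow> ('x, 'k::field) mpoly) \<Rightarrow> 'e set \<Rightarrow> 'k"
  where "comp b f T = Poly_Mapping.lookup (mon (lab T) * f T) b"

lemma lab_insert: "T \<subseteq> E \<Longrightarrow> e \<notin> T \<Longrightarrow> lab (insert e T) = lab T + \<beta> e"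
  using fin finite_subset by (fastforce simp: lab_def add.commute)

lemma keys_lab: "T \<subseteq> E \<Longrightarrow> Poly_Mapping.keys (lab T) \<subseteq> V"
proof -
  assume T: "T \<subseteq> E"
  then have "finite T" using fin finite_subset by blast
  then show ?thesis using T
  proof (induct T)
    case (insert e T)
    then have "lab (insert e T) = lab T + \<beta> e" by (intro lab_insert) auto
    then show ?case
      using insert keys_label[of e] Poly_Mapping.keys_add[of "lab T" "\<beta> e"] by auto
  qed (simp add: lab_def)
qed

lemma cmon_closed: "e \<in> E \<Longrightarrow> cmon e T \<in> carrier (mpoly_ring V)"
  unfolding cmon_def
  by (intro mpoly_ring_closed mon_closed keys_label minus_one_power_closed)

text \<open>For pairwise coprime labels the product \<open>lab T\<close> is also the least common
  multiple. The sets that matter in multidegree \<open>b\<close> are therefore all subsets of one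
  fixed set.\<close>

lemma mdvd_lab_iff:
  assumes T: "T \<subseteq> E"
  shows "mdvd (lab T) b \<longleftrightarrow> (\<forall>e\<in>T. mdvd (\<beta> e) b)"
proof -
  have finT: "finite T" using T fin finite_subset by blast
  have l: "Poly_Mapping.lookup (lab T) x = (\<Sum>e\<in>T. Poly_Mapping.lookup (\<beta> e) x)" for x
    by (simp add: lab_def lookup_sum)
  show ?thesis
  proof
    assume "mdvd (lab T) b"
    then show "\<forall>e\<in>T. mdvd (\<beta> e) b"
      unfolding mdvd_iff l using member_le_sum[OF _ _ finT, of _ "\<lambda>e. Poly_Mapping.lookup (\<beta> e) _"]
      by (meson le_trans zero_le)
  next
    assume *: "\<forall>e\<in>T. mdvd (\<beta> e) b"
    show "mdvd (lab T) b" unfolding mdvd_iff l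
    proof
      fix x
      show "(\<Sum>e\<in>T. Poly_Mapping.lookup (\<beta> e) x) \<le> Poly_Mapping.lookup b x"
      proof (cases "\<exists>e\<in>T. x \<in> Poly_Mapping.keys (\<beta> e)")
        case True
        then obtain e where e: "e \<in> T" "x \<in> Poly_Mapping.keys (\<beta> e)" by blast
        have "Poly_Mapping.lookup (\<beta> e') x = 0" if "e' \<in> T - {e}" for e'
        proof -
          have "Poly_Mapping.keys (\<beta> e) \<inter> Poly_Mapping.keys (\<beta> e') = {}"
            using e(1) that T by (intro coprime_labels) auto
          then show ?thesis using e(2) by (auto simp: in_keys_iff)
        qed
        then have "(\<Sum>e\<in>T. Poly_Mapping.lookup (\<beta> e) x) = Poly_Mapping.lookup (\<beta> e) x"
          using finT e by (simp add: sum.remove)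
        then show ?thesis using * e by (simp add: mdvd_iff)
      next
        case False
        then have "(\<Sum>e\<in>T. Poly_Mapping.lookup (\<beta> e) x) = 0" by (intro sum.neutral) (auto simp: in_keys_iff)
        then show ?thesis by simp
      qed
    qed
  qed
qed

text \<open>The factor \<open>mon (lab T)\<close> homogenizes: the monomial of \<open>cmon\<close>
  is absorbed into \<open>lab (insert e T)\<close>, and only its sign survives.\<close>

lemma mon_lab_bdry:
  assumes "T \<subseteq> E"
  shows "mon (lab T) * bdry E cmon f T
    = bdry E (\<lambda>e T. (- 1) ^ s e T) (\<lambda>T. mon (lab T) * (f T :: ('x, 'k::field) mpoly)) T"
  unfolding bdry_def sum_distrib_left
proof (intro sum.cong refl)
  fix e assume "e \<in> E - T"
  then have "(mon (lab (insert e T)) :: ('x, 'k) mpoly) = mon (lab T) * mon (\<beta> e)"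
    using assms by (simp add: lab_insert mon_add)
  then show "mon (lab T) * (cmon e T * f (insert e T)) = (- 1) ^ s e T * (mon (lab (insert e T)) * f (insert e T))"
    by (simp only: cmon_def mult_ac)
qed

lemma comp_bdry:
  assumes "T \<subseteq> E"
  shows "comp b (bdry E cmon f) T = bdry E (\<lambda>e T. (- 1) ^ s e T) (comp b f) T"
  unfolding comp_def mon_lab_bdry[OF assms]
  by (simp add: bdry_def lookup_sum lookup_sign_mult)

lemma comp_support: "comp b f T \<noteq> 0 \<Longrightarrow> f T \<noteq> 0 \<and> mdvd (lab T) b"
  using lookup_mon_mult_zero unfolding comp_def by fastforce

text \<open>The equation for \<open>w\<close> splits into independent equations over the field, one
  for each multidegree. Only finitely many of them have a nonzero right-hand side, so their
  solutions assemble to polynomials.\<close>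

lemma lift_boundary:
  fixes z :: "'e set \<Rightarrow> ('x, 'k::field) mpoly"
  assumes sub: "\<And>T. T \<in> \<F> \<Longrightarrow> T \<subseteq> E" and z: "\<And>T. z T \<in> carrier (mpoly_ring V)"
    and ex: "\<And>b. \<exists>w. (\<forall>T. w T \<noteq> 0 \<longrightarrow> T \<in> \<F> \<and> mdvd (lab T) b)
      \<and> (\<forall>T\<in>\<F>. mdvd (lab T) b \<longrightarrow> bdry E (\<lambda>e T. (- 1) ^ s e T) w T = comp b z T)"
  shows "\<exists>w. (\<forall>T. w T \<in> carrier (mpoly_ring V)) \<and> (\<forall>T. w T \<noteq> 0 \<longrightarrow> T \<in> \<F>)
    \<and> (\<forall>T\<in>\<F>. bdry E cmon w T = z T)"
proof -
  \<comment> \<open>The multidegrees in which \<open>z\<close> lives. In all others the zero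
    solution is taken, which makes the coefficients of \<open>w\<close> finitely supported.\<close>
  define Bs where "Bs = (\<Union>T\<in>\<F>. (\<lambda>t. lab T + t) ` Poly_Mapping.keys (z T))"
  have "finite \<F>" by (rule finite_subset[of _ "Pow E"]) (use sub fin in auto)
  then have finB: "finite Bs" unfolding Bs_def by auto
  obtain W where W: "\<And>b T. W b T \<noteq> 0 \<Longrightarrow> T \<in> \<F> \<and> mdvd (lab T) b"
    and bW: "\<And>b T. T \<in> \<F> \<Longrightarrow> mdvd (lab T) b \<Longrightarrow>
      bdry E (\<lambda>e T. (- 1) ^ s e T) (W b) T = comp b z T"
    using ex by metis
  define W' where "W' b T = (if b \<in> Bs then W b T else 0)" for b T
  \<comment> \<open>The coefficient of \<open>t\<close> in \<open>w T\<close> belongs to multidegree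
    \<open>lab T + t\<close>.\<close>
  define w where "w T = Abs_poly_mapping (\<lambda>t. W' (lab T + t) T)" for T
  have lw: "Poly_Mapping.lookup (w T) t = W' (lab T + t) T" for T t
  proof -
    have "{t. W' (lab T + t) T \<noteq> 0} \<subseteq> (\<lambda>t. lab T + t) -` Bs" by (auto simp: W'_def)
    moreover have "finite ((\<lambda>t. lab T + t) -` Bs)"
      by (rule finite_vimageI[OF finB]) (simp add: inj_on_def)
    ultimately have "finite {t. W' (lab T + t) T \<noteq> 0}" by (rule finite_subset)
    then show ?thesis unfolding w_def by simp
  qed
  have keysB: "Poly_Mapping.keys b \<subseteq> V" if bB: "b \<in> Bs" for b
  proof -
    obtain T t where T: "T \<in> \<F>" "t \<in> Poly_Mapping.keys (z T)" "b = lab T + t"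
      using bB unfolding Bs_def by blast
    then have "Poly_Mapping.keys t \<subseteq> V" using z[of T] by (simp add: mem_mpoly_ring)
    then show ?thesis
      using keys_lab[OF sub[OF T(1)]] Poly_Mapping.keys_add[of "lab T" t] T(3) by blast
  qed
  have "w T \<in> carrier (mpoly_ring V)" for T
    unfolding mem_mpoly_ring
  proof
    fix t assume "t \<in> Poly_Mapping.keys (w T)"
    then have "lab T + t \<in> Bs" by (auto simp: in_keys_iff lw W'_def split: if_splits)
    then have "Poly_Mapping.keys (lab T + t) \<subseteq> V" by (rule keysB)
    then show "Poly_Mapping.keys t \<subseteq> V" by (auto simp: in_keys_iff lookup_add)
  qed
  moreover have "T \<in> \<F>" if "w T \<noteq> 0" for T
  proof (rule ccontr)
    assume "T \<notin> \<F>"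
    then have "W' b T = 0" for b using W by (auto simp: W'_def)
    then have "w T = 0" by (intro poly_mapping_eqI) (simp add: lw)
    with that show False by simp
  qed
  moreover have "bdry E cmon w T = z T" if T: "T \<in> \<F>" for T
  proof (rule poly_mapping_eqI)
    fix t
    let ?b = "lab T + t"
    have b: "mdvd (lab T) ?b" by (auto simp: mdvd_def)
    have cw: "comp ?b w = W' ?b"
    proof
      fix U
      show "comp ?b w U = W' ?b U"
      proof (cases "mdvd (lab U) ?b")
        case True
        then obtain u where "?b = lab U + u" by (auto simp: mdvd_def)
        then show ?thesis by (simp add: comp_def lookup_mon_mult lw)
      next
        case False
        then have "W ?b U = 0" using W by blast
        then show ?thesis using False by (simp add: comp_def lookup_mon_mult_zero W'_def)
      qed
    qed
    have "Poly_Mapping.lookup (bdry E cmon w T) t = comp ?b (bdry E cmon w) T"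
      by (simp add: comp_def lookup_mon_mult)
    also have "\<dots> = bdry E (\<lambda>e T. (- 1) ^ s e T) (W' ?b) T"
      unfolding comp_bdry[OF sub[OF T]] cw ..
    also have "\<dots> = comp ?b z T"
    proof (cases "?b \<in> Bs")
      case True
      then have "W' ?b = W ?b" by (auto simp: W'_def)
      then show ?thesis using bW[OF T b] by simp
    next
      case False
      then have "t \<notin> Poly_Mapping.keys (z T)" using T unfolding Bs_def by blast
      then have "comp ?b z T = 0" by (simp add: comp_def lookup_mon_mult in_keys_iff)
      moreover have "W' ?b = (\<lambda>_. 0)" using False by (auto simp: W'_def)
      ultimately show ?thesis by (simp add: bdry_def)
    qed
    also have "\<dots> = Poly_Mapping.lookup (z T) t" by (simp add: comp_def lookup_mon_mult)
    finally show "Poly_Mapping.lookup (bdry E cmon w T) t = Poly_Mapping.lookup (z T) t" .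
  qed
  ultimately show ?thesis by (intro exI[of _ w]) blast
qed

text \<open>In multidegree \<open>b\<close> the Koszul complex of the coprime monomials \<open>mon (\<beta> e)\<close> is the augmented
  chain complex of the full simplex on the labels dividing \<open>b\<close>.\<close>

lemma koszul_monomials_exact:
  fixes f :: "'e set \<Rightarrow> ('x, 'k::field) mpoly"
  assumes skew: "skew_coeffs E (\<lambda>e T. (- 1) ^ s e T :: 'k)" and i: "i \<ge> 1"
    and f: "\<And>T. f T \<in> carrier (mpoly_ring V)"
    and cyc: "\<And>T. T \<subseteq> E \<Longrightarrow> Suc (card T) = i \<Longrightarrow> bdry E cmon f T = 0"
  shows "\<exists>w. (\<forall>T. w T \<in> carrier (mpoly_ring V)) \<and> (\<forall>T\<subseteq>E. card T = i \<longrightarrow> bdry E cmon w T = f T)"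
proof -
  \<comment> \<open>Cut down to degree \<open>i\<close>, the chain is a cycle at every
    \<open>T \<subseteq> E\<close>, as needed for the full simplex.\<close>
  define z where "z T = (if card T = i then f T else 0)" for T
  have bz: "bdry E cmon z T = 0" if "T \<subseteq> E" for T
  proof (cases "Suc (card T) = i")
    case True
    have "finite T" using that fin finite_subset by blast
    then have "bdry E cmon z T = bdry E cmon f T"
      using True by (intro bdry_cong) (auto simp: z_def)
    then show ?thesis using cyc[OF that True] by simp
  next
    case False
    have "finite T" using that fin finite_subset by blast
    then show ?thesis using False unfolding bdry_def by (intro sum.neutral) (auto simp: z_def)
  qed
  have "\<exists>w. (\<forall>T. w T \<noteq> 0 \<longrightarrow> T \<in> Pow E \<and> mdvd (lab T) b)
      \<and> (\<forall>T\<in>Pow E. mdvd (lab T) b \<longrightarrow> bdry E (\<lambda>e T. (- 1) ^ s e T) w T = comp b z' T)"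
    if z': "z' = (\<lambda>T. if T \<subseteq> E then z T else 0)" for b and z' :: "'e set \<Rightarrow> ('x, 'k) mpoly"
  proof -
    define Eb where "Eb = {e \<in> E. mdvd (\<beta> e) b}"
    have Eb: "T \<in> Pow Eb \<longleftrightarrow> T \<in> Pow E \<and> mdvd (lab T) b" for T
      using mdvd_lab_iff[of T b] unfolding Eb_def by blast
    have supp: "T \<in> Pow Eb \<and> card T = i" if "comp b z' T \<noteq> 0" for T
      unfolding Eb using comp_support[OF that] by (auto simp: z' z_def split: if_splits)
    have cyc': "bdry E (\<lambda>e T. (- 1) ^ s e T) (comp b z') T = 0" if "T \<in> Pow Eb" for T
    proof -
      have T: "T \<subseteq> E" using that Eb by blast
      have "bdry E cmon z' T = bdry E cmon z T"
        using T by (intro bdry_cong) (auto simp: z')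
      then have "bdry E cmon z' T = 0" using bz[OF T] by simp
      then have "comp b (bdry E cmon z') T = 0" by (simp add: comp_def)
      then show ?thesis by (simp add: comp_bdry[OF T])
    qed
    show ?thesis
    proof (cases "Eb = {}")
      case True
      \<comment> \<open>Only the empty set is left, and its size 0 is less than
        \<open>i\<close>.\<close>
      have "comp b z' T = 0" for T using supp[of T] True i by fastforce
      then show ?thesis by (intro exI[of _ "\<lambda>_. 0"]) (simp add: bdry_def)
    next
      case False
      then obtain p where p: "p \<in> Eb" by blast
      have "acyclic_family E (\<lambda>e T. (- 1) ^ s e T :: 'k) (Pow Eb) (\<lambda>_. True)"
      proof (rule acyclic_cone[OF skew])
        show "((- 1) ^ s e T :: 'k) * (- 1) ^ s e T = 1" for e T
          by (simp add: power_mult_distrib[symmetric])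
      qed (use p Eb_def in auto)
      from this[unfolded acyclic_family_def, rule_format, of "comp b z'"] supp cyc'
      obtain w where "\<forall>T. w T \<noteq> 0 \<longrightarrow> T \<in> Pow Eb"
        "\<forall>T\<in>Pow Eb. bdry E (\<lambda>e T. (- 1) ^ s e T) w T = comp b z' T" by blast
      then show ?thesis using Eb by (intro exI[of _ w]) blast
    qed
  qed
  note ex = this[OF refl]
  have "\<exists>w. (\<forall>T. w T \<in> carrier (mpoly_ring V)) \<and> (\<forall>T. w T \<noteq> 0 \<longrightarrow> T \<in> Pow E)
    \<and> (\<forall>T\<in>Pow E. bdry E cmon w T = (if T \<subseteq> E then z T else 0))"
    by (rule lift_boundary[OF _ _ ex]) (simp_all add: z_def f mpoly_ring_closed)
  then obtain w where w: "\<forall>T. w T \<in> carrier (mpoly_ring V)"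
    "\<forall>T\<in>Pow E. bdry E cmon w T = (if T \<subseteq> E then z T else 0)" by (elim exE conjE)
  then have "\<forall>T\<subseteq>E. card T = i \<longrightarrow> bdry E cmon w T = f T" by (simp add: z_def)
  with w(1) show ?thesis by (intro exI[of _ w] conjI)
qed

end

section \<open>The cellular resolution\<close>

lemma ideal_module_simps [simp]:
  "carrier (ideal_module R I) = I" "ring.zero (ideal_module R I) = \<zero>\<^bsub>R\<^esub>"
  "ring.add (ideal_module R I) = ring.add R" "module.smult (ideal_module R I) = monoid.mult R"
  by (simp_all add: ideal_module_def)

lemma (in cring) ideal_module_module:
  assumes I: "ideal I R"
  shows "Module.module R (ideal_module R I)"
proof (rule moduleI)
  have sub: "I \<subseteq> carrier R" by (rule additive_subgroup.a_subset[OF ideal.axioms(1)[OF I]])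
  interpret I: ideal I R by (rule I)
  show "cring R" by (rule is_cring)
  show "abelian_group (ideal_module R I)"
  proof (rule abelian_groupI)
    fix x assume "x \<in> carrier (ideal_module R I)"
    then show "\<exists>y\<in>carrier (ideal_module R I). y \<oplus>\<^bsub>ideal_module R I\<^esub> x = \<zero>\<^bsub>ideal_module R I\<^esub>"
      using sub by (intro bexI[of _ "\<ominus> x"]) (auto simp: l_neg)
  qed (use sub in \<open>auto simp: subset_iff a_ac\<close>)
qed (use ideal.I_l_closed[OF I] additive_subgroup.a_subset[OF ideal.axioms(1)[OF I]] in
  \<open>auto simp: subset_iff l_distr r_distr m_assoc\<close>)

lemma a_inv_mpoly_ring: "p \<in> carrier (mpoly_ring V) \<Longrightarrow> \<ominus>\<^bsub>mpoly_ring V\<^esub> p = - p"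
proof -
  assume p: "p \<in> carrier (mpoly_ring V)"
  interpret cring "mpoly_ring V" by (rule mpoly_ring_cring)
  show ?thesis using p by (intro minus_equality) (simp_all add: mpoly_ring_closed)
qed

text \<open>The linear order provides the signs, through the lexicographic order on pairs;
  countability allows the cells to be coded by natural numbers.\<close>

locale cell_res =
  multihom P le m + labels "multihom.cells P m" \<beta> V "\<lambda>e T. card {t \<in> T. t < e}"
  for P :: "'v::{linorder, countable} set" and le m and \<beta> :: "'v \<times> nat \<Rightarrow> ('x \<Rightarrow>\<^sub>0 nat)" and V
begin

lemma cmon_eq: "cmon e T = sgn_at e T * mon (\<beta> e)"
  by (simp add: cmon_def sgn_at_def)

text \<open>A product of simplices on vertex sets \<open>F_c\<close> has dimension
  \<open>\<Sum> (|F_c| - 1)\<close>, hence the shift by \<open>card P\<close>.\<close>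

definition deg :: "nat \<Rightarrow> ('v \<times> nat) set set"
  where "deg i = {T. adm T \<and> card T = card P + i}"

definition gens :: "('x, 'k::field) mpoly set"
  where "gens = (\<lambda>T. mon (lab T)) ` deg 0"

definition eps :: "(('v \<times> nat) set \<Rightarrow> ('x, 'k::field) mpoly) \<Rightarrow> ('x, 'k) mpoly"
  where "eps f = (\<Sum>T\<in>deg 0. mon (lab T) * f T)"

lemma fin_deg: "finite (deg i)"
  unfolding deg_def by (rule finite_adm)

lemma deg_sub: "T \<in> deg i \<Longrightarrow> T \<subseteq> cells"
  unfolding deg_def using adm_sub by simp

lemma mon_lab_closed: "T \<subseteq> cells \<Longrightarrow> mon (lab T) \<in> carrier (mpoly_ring V)"
  by (intro mon_closed keys_lab)

lemma eps_closed: "(\<And>T. f T \<in> carrier (mpoly_ring V)) \<Longrightarrow> eps f \<in> carrier (mpoly_ring V)"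
  unfolding eps_def by (intro sum_mpoly_ring_closed mpoly_ring_mult mon_lab_closed) (simp_all add: deg_sub)

lemma eps_add: "eps (\<lambda>T. f T + g T) = eps f + eps g"
  by (simp add: eps_def distrib_left sum.distrib)

lemma eps_mult: "eps (\<lambda>T. r * f T) = r * eps f"
  by (simp add: eps_def sum_distrib_left mult.left_commute)

lemma eps_aug: "eps f = aug (\<lambda>T. mon (lab T) * f T)"
  by (simp add: eps_def aug_def deg_def)

text \<open>The explicit form of the ideal generated by \<open>gens\<close>, in which surjectivity
  of the augmentation is immediate.\<close>

definition gen_ideal :: "('x, 'k::field) mpoly set"
  where "gen_ideal = {eps f | f. \<forall>T. f T \<in> carrier (mpoly_ring V)}"

lemma gen_ideal_ideal: "ideal gen_ideal (mpoly_ring V :: ('x, 'k::field) mpoly ring)"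
proof -
  let ?S = "mpoly_ring V :: ('x, 'k) mpoly ring"
  interpret cring ?S by (rule mpoly_ring_cring)
  have mult: "r * eps f \<in> gen_ideal" if "r \<in> carrier ?S" "\<forall>T. f T \<in> carrier ?S" for r f
    unfolding gen_ideal_def using that
    by (auto simp: mpoly_ring_mult eps_mult[symmetric] intro!: exI[of _ "\<lambda>T. r * f T"])
  show ?thesis
  proof (rule idealI)
    show "ring ?S" by (rule ring_axioms)
    show "subgroup gen_ideal (add_monoid ?S)"
    proof (rule add.subgroupI)
      show "gen_ideal \<subseteq> carrier ?S" by (auto simp: gen_ideal_def eps_closed)
      show "gen_ideal \<noteq> {}" using mpoly_ring_zero[of V] by (auto simp: gen_ideal_def)
      fix a :: "('x, 'k) mpoly" assume a: "a \<in> gen_ideal"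
      then obtain f where f: "a = eps f" "\<forall>T. f T \<in> carrier ?S" by (auto simp: gen_ideal_def)
      have "- 1 * a \<in> gen_ideal" unfolding f(1)
        by (rule mult[OF _ f(2)]) (simp add: mpoly_ring_closed)
      then show "\<ominus>\<^bsub>?S\<^esub> a \<in> gen_ideal" using f by (simp add: a_inv_mpoly_ring eps_closed)
      fix b :: "('x, 'k) mpoly" assume "b \<in> gen_ideal"
      then obtain g where g: "b = eps g" "\<forall>T. g T \<in> carrier ?S" by (auto simp: gen_ideal_def)
      show "a \<oplus>\<^bsub>?S\<^esub> b \<in> gen_ideal" unfolding gen_ideal_def f(1) g(1)
        using f(2) g(2) by (auto simp: eps_add[symmetric] mpoly_ring_add intro!: exI[of _ "\<lambda>T. f T + g T"])
    qed
  next
    fix a x :: "('x, 'k) mpoly" assume "a \<in> gen_ideal" and x: "x \<in> carrier ?S"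
    then obtain f where f: "a = eps f" "\<forall>T. f T \<in> carrier ?S" by (auto simp: gen_ideal_def)
    show "x \<otimes>\<^bsub>?S\<^esub> a \<in> gen_ideal" "a \<otimes>\<^bsub>?S\<^esub> x \<in> gen_ideal"
      using mult[OF x f(2)] by (simp_all add: f(1) mult.commute)
  qed
qed

lemma genideal_gens: "genideal (mpoly_ring V) gens = (gen_ideal :: ('x, 'k::field) mpoly set)"
proof
  let ?S = "mpoly_ring V :: ('x, 'k) mpoly ring"
  interpret cring ?S by (rule mpoly_ring_cring)
  have gens_sub: "gens \<subseteq> carrier ?S" using mon_lab_closed deg_sub by (auto simp: gens_def)
  show "genideal ?S gens \<subseteq> gen_ideal"
  proof (rule genideal_minimal[OF gen_ideal_ideal])
    show "gens \<subseteq> (gen_ideal :: ('x, 'k) mpoly set)"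
    proof
      fix u :: "('x, 'k) mpoly" assume "u \<in> gens"
      then obtain T0 where T0: "T0 \<in> deg 0" "u = mon (lab T0)" by (auto simp: gens_def)
      have "eps (\<lambda>T. if T = T0 then 1 else 0) = (\<Sum>T\<in>deg 0. if T = T0 then u else 0)"
        unfolding eps_def by (intro sum.cong) (auto simp: T0)
      also have "\<dots> = u" using T0 fin_deg by simp
      finally show "u \<in> gen_ideal" unfolding gen_ideal_def
        by (intro CollectI exI[of _ "\<lambda>T. if T = T0 then 1 else 0"]) (simp add: mpoly_ring_closed)
    qed
  qed
  interpret I: ideal "genideal ?S gens" ?S by (rule genideal_ideal[OF gens_sub])
  show "gen_ideal \<subseteq> genideal ?S gens"
  proof
    fix u :: "('x, 'k) mpoly" assume "u \<in> gen_ideal"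
    then obtain f where u: "u = eps f" and f: "\<And>T. f T \<in> carrier ?S" by (auto simp: gen_ideal_def)
    have "(\<Sum>T\<in>A. mon (lab T) * f T) \<in> genideal ?S gens" if "A \<subseteq> deg 0" for A
      using finite_subset[OF that fin_deg] that
    proof (induct A)
      case empty
      then show ?case using I.zero_closed by simp
    next
      case (insert T A)
      have "mon (lab T) \<in> genideal ?S gens"
        using insert(4) genideal_self[OF gens_sub] by (auto simp: gens_def)
      then have "mon (lab T) * f T \<in> genideal ?S gens" using I.I_r_closed[OF _ f[of T]] by simp
      then show ?case using insert I.a_closed by simp
    qed
    then show "u \<in> genideal ?S gens" unfolding u eps_def by simp
  qed
qed

lemma eps_bdry:
  fixes f :: "('v \<times> nat) set \<Rightarrow> ('x, 'k::field) mpoly"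
  assumes "\<And>T. f T \<noteq> 0 \<Longrightarrow> adm T"
  shows "eps (bdry cells cmon f) = 0"
proof -
  have "eps (bdry cells cmon f) = aug (bdry cells sgn_at (\<lambda>T. mon (lab T) * f T))"
    unfolding eps_aug aug_def
    by (intro sum.cong) (auto simp: mon_lab_bdry adm_sub sgn_at_def[abs_def])
  also have "\<dots> = 0" by (rule aug_bdry) (use assms in force)
  finally show ?thesis .
qed

text \<open>Multidegree \<open>b\<close> consists of the admissible cells inside the set
  \<open>Eb\<close> of elements with labels dividing \<open>b\<close>. So
  \<open>acyclic_multihom\<close> settles each multidegree, and \<open>lift_boundary\<close>
  combines them.\<close>

lemma cell_complex_exact:
  fixes z :: "('v \<times> nat) set \<Rightarrow> ('x, 'k::field) mpoly"
  assumes z: "\<And>T. z T \<in> carrier (mpoly_ring V)" and supp: "\<And>T. z T \<noteq> 0 \<Longrightarrow> adm T"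
    and cyc: "\<And>T. adm T \<Longrightarrow> bdry cells cmon z T = 0" and eps: "eps z = 0"
  shows "\<exists>w. (\<forall>T. w T \<in> carrier (mpoly_ring V)) \<and> (\<forall>T. w T \<noteq> 0 \<longrightarrow> T \<in> {T. adm T})
    \<and> (\<forall>T\<in>{T. adm T}. bdry cells cmon w T = z T)"
proof (rule lift_boundary)
  show "T \<subseteq> cells" if "T \<in> {T. adm T}" for T using that adm_sub by simp
  fix b
  define Eb where "Eb = {e \<in> cells. mdvd (\<beta> e) b}"
  have Eb: "T \<subseteq> Eb \<longleftrightarrow> mdvd (lab T) b" if "adm T" for T
    using mdvd_lab_iff[OF adm_sub[OF that], of b] adm_sub[OF that] unfolding Eb_def by blast
  have s: "comp b z T \<noteq> 0 \<Longrightarrow> T \<in> {T. adm T \<and> T \<subseteq> Eb}" for T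
    using comp_support[of b z T] supp[of T] Eb[of T] by simp
  have c: "bdry cells sgn_at (comp b z) T = 0" if "T \<in> {T. adm T \<and> T \<subseteq> Eb}" for T
  proof -
    have "adm T" using that by simp
    then have "comp b (bdry cells cmon z) T = 0" using cyc by (simp add: comp_def)
    then show ?thesis using comp_bdry[OF adm_sub[OF \<open>adm T\<close>], of b z] by (simp add: sgn_at_def[abs_def])
  qed
  have "aug (comp b z) = Poly_Mapping.lookup (eps z) b"
    by (simp add: eps_aug aug_def comp_def[abs_def] lookup_sum)
  then have a: "aug (comp b z) = 0" using eps by simp
  obtain w where w: "\<forall>T. w T \<noteq> 0 \<longrightarrow> T \<in> {T. adm T \<and> T \<subseteq> Eb}"
    "\<forall>T\<in>{T. adm T \<and> T \<subseteq> Eb}. bdry cells sgn_at w T = comp b z T"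
    using acyclic_multihom[of Eb, where 'a = 'k, unfolded acyclic_family_def, rule_format, of "comp b z"] s c a
    by blast
  have "\<forall>T. w T \<noteq> 0 \<longrightarrow> T \<in> {T. adm T} \<and> mdvd (lab T) b" using w(1) Eb by blast
  moreover have "\<forall>T\<in>{T. adm T}. mdvd (lab T) b \<longrightarrow> bdry cells (\<lambda>e T. (- 1) ^ card {t \<in> T. t < e}) w T = comp b z T"
    using w(2) Eb by (simp add: sgn_at_def[abs_def])
  ultimately show "\<exists>w. (\<forall>T. w T \<noteq> 0 \<longrightarrow> T \<in> {T. adm T} \<and> mdvd (lab T) b)
      \<and> (\<forall>T\<in>{T. adm T}. mdvd (lab T) b \<longrightarrow> bdry cells (\<lambda>e T. (- 1) ^ card {t \<in> T. t < e}) w T = comp b z T)"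
    by (intro exI[of _ w] conjI)
qed (rule z)

section \<open>Chains of fixed dimension as free modules\<close>

definition chains :: "nat \<Rightarrow> (('v \<times> nat) set \<Rightarrow> ('x, 'k::field) mpoly) set"
  where "chains i = {g. (\<forall>T. g T \<in> carrier (mpoly_ring V)) \<and> (\<forall>T. g T \<noteq> 0 \<longrightarrow> T \<in> deg i)}"

text \<open>Faces in which a fibre has become empty are not cells of the complex. The boundary over
  all subsets may be nonzero there and has to be cut off.\<close>

definition bd :: "nat \<Rightarrow> (('v \<times> nat) set \<Rightarrow> ('x, 'k::field) mpoly) \<Rightarrow> ('v \<times> nat) set \<Rightarrow> ('x, 'k) mpoly"
  where "bd i g T = (if T \<in> deg i then bdry cells cmon g T else 0)"

lemma bd_chains: "g \<in> chains (Suc i) \<Longrightarrow> bd i g \<in> chains i"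
  unfolding chains_def bd_def bdry_def
  by (auto intro!: sum_mpoly_ring_closed mpoly_ring_closed cmon_closed)

lemma bd_adm:
  assumes g: "g \<in> chains (Suc i)" and T: "adm T"
  shows "bd i g T = bdry cells cmon g T"
proof (cases "T \<in> deg i")
  case False
  then have "g (insert e T) = 0" if "e \<notin> T" for e
    using g that adm_finite[OF T] T unfolding chains_def deg_def by force
  then have "bdry cells cmon g T = 0" by (simp add: bdry_def)
  then show ?thesis using False by (simp add: bd_def)
qed (simp add: bd_def)

text \<open>The cut-off in \<open>bd\<close> is harmless: by \<open>adm_convex\<close> every set
  between the admissible \<open>T\<close> and a cell is admissible, so \<open>bd i g\<close> agrees
  with the full boundary wherever it is evaluated.\<close>

lemma bdry_bd:
  assumes g: "g \<in> chains (Suc i)" and T: "adm T"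
  shows "bdry cells cmon (bd i g) T = 0"
proof -
  have z: "bd i g (insert e T) = bdry cells cmon g (insert e T)" if e: "e \<in> cells - T" for e
  proof (cases "adm (insert e T)")
    case True
    then show ?thesis by (rule bd_adm[OF g])
  next
    case False
    have "g (insert p (insert e T)) = 0" for p
    proof (rule ccontr)
      assume "g (insert p (insert e T)) \<noteq> 0"
      then have "adm (insert p (insert e T))" using g by (simp add: chains_def deg_def)
      then have "adm (insert e T)" by (rule adm_convex[OF T]) auto
      with False show False by simp
    qed
    then show ?thesis using False by (simp add: bd_def bdry_def deg_def)
  qed
  have "skew_coeffs cells cmon"
    using sgn_at_skew[OF fin_cells, of "\<lambda>e. mon (\<beta> e)"] by (simp add: cmon_eq[abs_def])
  then have "bdry cells cmon (bdry cells cmon g) T = 0" by (rule bdry_bdry) (rule adm_sub[OF T])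
  then show ?thesis using bdry_cong[of cells T "bd i g" "bdry cells cmon g" cmon] z by simp
qed

lemma bd_exact:
  assumes z: "z \<in> chains i" and cyc: "\<And>T. adm T \<Longrightarrow> bdry cells cmon z T = 0" and eps: "eps z = 0"
  obtains g where "g \<in> chains (Suc i)" "bd i g = z"
proof -
  obtain w where w: "\<forall>T. w T \<in> carrier (mpoly_ring V)" "\<forall>T. w T \<noteq> 0 \<longrightarrow> T \<in> {T. adm T}"
    "\<forall>T\<in>{T. adm T}. bdry cells cmon w T = z T"
    using cell_complex_exact[OF _ _ cyc eps] z by (auto simp: chains_def deg_def)
  \<comment> \<open>The bounding chain may mix dimensions; only its part of dimension
    \<open>i + 1\<close> contributes to a boundary in dimension \<open>i\<close>.\<close>
  define g where "g T = (if T \<in> deg (Suc i) then w T else 0)" for T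
  have g: "g \<in> chains (Suc i)" using w(1) by (simp add: chains_def g_def mpoly_ring_closed)
  have "bd i g T = z T" for T
  proof (cases "T \<in> deg i")
    case True
    then have T: "adm T" "finite T" using adm_finite by (auto simp: deg_def)
    have "bdry cells cmon g T = bdry cells cmon w T"
    proof (rule bdry_cong)
      fix e assume "e \<in> cells - T"
      then show "g (insert e T) = w (insert e T)"
        using True T(2) w(2) by (auto simp: g_def deg_def)
    qed
    then show ?thesis using True T w(3) by (simp add: bd_def)
  next
    case False
    then show ?thesis using z by (auto simp: bd_def chains_def)
  qed
  then have "bd i g = z" by (rule ext)
  with g show thesis by (rule that)
qed

text \<open>Since \<open>proj_dim\<close> takes its modules from one fixed type, cells are coded by natural numbers.\<close>

definition enc :: "('v \<times> nat) set \<Rightarrow> ('x, 'k::field) mpoly + nat"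
  where "enc T = Inr (set_encode (to_nat ` T))"

definition Fmod :: "nat \<Rightarrow> (('x, 'k::field) mpoly, ('x, 'k) mpoly + nat \<Rightarrow> ('x, 'k) mpoly) module"
  where "Fmod i = free_mod (mpoly_ring V) (enc ` deg i)"

definition to_fun :: "nat \<Rightarrow> (('v \<times> nat) set \<Rightarrow> ('x, 'k::field) mpoly) \<Rightarrow> ('x, 'k) mpoly + nat \<Rightarrow> ('x, 'k) mpoly"
  where "to_fun i g x = (if x \<in> enc ` deg i then g (the_inv_into (deg i) (enc :: _ \<Rightarrow> ('x, 'k) mpoly + nat) x) else 0)"

definition of_fun :: "nat \<Rightarrow> (('x, 'k::field) mpoly + nat \<Rightarrow> ('x, 'k) mpoly) \<Rightarrow> ('v \<times> nat) set \<Rightarrow> ('x, 'k) mpoly"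
  where "of_fun i f T = (if T \<in> deg i then f (enc T) else 0)"

lemma inj_enc: "inj_on (enc :: _ \<Rightarrow> ('x, 'k::field) mpoly + nat) (deg i)"
proof (rule inj_onI)
  fix S T :: "('v \<times> nat) set"
  assume "S \<in> deg i" "T \<in> deg i" and eq: "(enc S :: ('x, 'k) mpoly + nat) = enc T"
  then have "finite (to_nat ` S)" "finite (to_nat ` T)" using adm_finite by (auto simp: deg_def)
  then have "to_nat ` S = to_nat ` T" using eq by (simp add: enc_def set_encode_eq)
  then show "S = T" by (simp add: inj_image_eq_iff)
qed

lemma to_fun_enc: "T \<in> deg i \<Longrightarrow> to_fun i g (enc T) = g T"
  by (simp add: to_fun_def the_inv_into_f_f[OF inj_enc])

lemma of_to_fun: "g \<in> chains i \<Longrightarrow> of_fun i (to_fun i g) = g"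
  by (auto simp: of_fun_def to_fun_enc chains_def fun_eq_iff)

lemma mem_Fmod:
  "f \<in> carrier (Fmod i) \<longleftrightarrow> (\<forall>x. f x \<in> carrier (mpoly_ring V)) \<and> (\<forall>x. x \<notin> enc ` deg i \<longrightarrow> f x = 0)"
proof -
  have "finite {x. f x \<noteq> 0}" if "\<forall>x. x \<notin> enc ` deg i \<longrightarrow> f x = 0"
    by (rule finite_subset[of _ "enc ` deg i"]) (use that fin_deg in auto)
  then show ?thesis by (auto simp: Fmod_def mem_free_mod)
qed

lemma to_of_fun: "f \<in> carrier (Fmod i) \<Longrightarrow> to_fun i (of_fun i f) = f"
proof
  fix x assume f: "f \<in> carrier (Fmod i)"
  show "to_fun i (of_fun i f) x = f x"
  proof (cases "x \<in> enc ` deg i")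
    case True
    then obtain T where "T \<in> deg i" "x = enc T" by blast
    then show ?thesis by (simp add: to_fun_enc of_fun_def)
  next
    case False
    then show ?thesis using f by (simp add: mem_Fmod to_fun_def)
  qed
qed

lemma of_fun_chains: "f \<in> carrier (Fmod i) \<Longrightarrow> of_fun i f \<in> chains i"
  by (auto simp: mem_Fmod chains_def of_fun_def mpoly_ring_closed)

lemma to_fun_carrier: "g \<in> chains i \<Longrightarrow> to_fun i g \<in> carrier (Fmod i)"
  by (auto simp: mem_Fmod chains_def to_fun_def mpoly_ring_closed)

lemma of_fun_add: "of_fun i (f \<oplus>\<^bsub>Fmod i\<^esub> g) = (\<lambda>T. of_fun i f T + of_fun i g T)"
  by (auto simp: of_fun_def Fmod_def)

lemma of_fun_smult: "of_fun i (r \<odot>\<^bsub>Fmod i\<^esub> f) = (\<lambda>T. r * of_fun i f T)"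
  by (auto simp: of_fun_def Fmod_def)

lemma to_fun_add: "to_fun i (\<lambda>T. f T + g T) = to_fun i f \<oplus>\<^bsub>Fmod i\<^esub> to_fun i g"
  by (auto simp: to_fun_def Fmod_def)

lemma to_fun_smult: "to_fun i (\<lambda>T. r * f T) = r \<odot>\<^bsub>Fmod i\<^esub> to_fun i f"
  by (auto simp: to_fun_def Fmod_def)

lemma bd_add: "bd i (\<lambda>T. f T + g T) = (\<lambda>T. bd i f T + bd i g T)"
  by (auto simp: bd_def bdry_add)

lemma bd_smult: "bd i (\<lambda>T. r * f T) = (\<lambda>T. r * bd i f T)"
  by (auto simp: bd_def bdry_def sum_distrib_left mult.left_commute)

lemma Fmod_zero: "\<zero>\<^bsub>Fmod i\<^esub> = (\<lambda>_. 0)"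
  by (simp add: Fmod_def)

definition delta :: "nat \<Rightarrow> (('x, 'k::field) mpoly + nat \<Rightarrow> ('x, 'k) mpoly) \<Rightarrow> ('x, 'k) mpoly + nat \<Rightarrow> ('x, 'k) mpoly"
  where "delta i f = to_fun i (bd i (of_fun (Suc i) f))"

lemma delta_hom: "delta i \<in> mod_hom (mpoly_ring V) (Fmod (Suc i)) (Fmod i)"
  unfolding mod_hom_def
proof (intro CollectI conjI ballI)
  show "delta i \<in> carrier (Fmod (Suc i)) \<rightarrow> carrier (Fmod i)"
    by (auto simp: delta_def intro!: to_fun_carrier bd_chains of_fun_chains)
qed (simp_all add: delta_def of_fun_add of_fun_smult bd_add bd_smult to_fun_add to_fun_smult)

lemma delta_delta:
  assumes "f \<in> carrier (Fmod (Suc (Suc i)))"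
  shows "delta i (delta (Suc i) f) = (\<lambda>_. 0)"
proof -
  let ?g = "of_fun (Suc (Suc i)) f"
  have g: "?g \<in> chains (Suc (Suc i))" by (rule of_fun_chains[OF assms])
  have "bd i (bd (Suc i) ?g) = (\<lambda>_. 0)"
    using bdry_bd[OF g] by (auto simp: bd_def[of i] deg_def)
  then show ?thesis
    by (simp add: delta_def of_to_fun[OF bd_chains[OF g]]) (auto simp: to_fun_def)
qed

lemma chain_eps_zero:
  assumes "z \<in> chains (Suc i)"
  shows "eps z = 0"
proof -
  have "z T = 0" if "T \<in> deg 0" for T
    using assms that unfolding chains_def deg_def by fastforce
  then show ?thesis by (simp add: eps_def)
qed

theorem cellular_resolution:
  assumes bound: "\<And>T. adm T \<Longrightarrow> card T \<le> card P + l"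
  shows "projective_resolution (mpoly_ring V :: ('x, 'k::field) mpoly ring)
    (ideal_module (mpoly_ring V) gen_ideal) l Fmod delta (\<lambda>f. eps (of_fun 0 f))"
proof -
  let ?S = "mpoly_ring V :: ('x, 'k) mpoly ring"
  let ?e = "\<lambda>f :: ('x, 'k) mpoly + nat \<Rightarrow> ('x, 'k) mpoly. eps (of_fun 0 f)"
  let ?M = "ideal_module ?S gen_ideal"
  interpret S: cring ?S by (rule mpoly_ring_cring)
  define ker where "ker = (\<lambda>i. case i of 0 \<Rightarrow> a_kernel (Fmod 0) ?M ?e
    | Suc j \<Rightarrow> a_kernel (Fmod (Suc j)) (Fmod j) (delta j))"
  have proj: "projective_module ?S (Fmod i)" for i unfolding Fmod_def by (rule S.free_mod_projective)
  have ehom: "?e \<in> mod_hom ?S (Fmod 0) ?M" unfolding mod_hom_def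
  proof (intro CollectI conjI ballI)
    show "?e \<in> carrier (Fmod 0) \<rightarrow> carrier ?M"
    proof
      fix f :: "('x, 'k) mpoly + nat \<Rightarrow> ('x, 'k) mpoly" assume "f \<in> carrier (Fmod 0)"
      from of_fun_chains[OF this] show "?e f \<in> carrier ?M" by (auto simp: chains_def gen_ideal_def)
    qed
  qed (simp_all add: of_fun_add of_fun_smult eps_add eps_mult)
  have onto: "?e ` carrier (Fmod 0) = carrier ?M"
  proof
    show "?e ` carrier (Fmod 0) \<subseteq> carrier ?M" by (rule mod_hom_image_subset[OF ehom])
    show "carrier ?M \<subseteq> ?e ` carrier (Fmod 0)"
    proof
      fix u assume "u \<in> carrier ?M"
      then obtain f where f: "u = eps f" "\<forall>T. f T \<in> carrier ?S" by (auto simp: gen_ideal_def)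
      define g where "g T = (if T \<in> deg 0 then f T else 0)" for T
      have g: "g \<in> chains 0" using f(2) by (simp add: chains_def g_def mpoly_ring_closed)
      have "eps g = u" unfolding f(1) eps_def by (simp add: g_def)
      then have "u = ?e (to_fun 0 g)" by (simp add: of_to_fun[OF g])
      then show "u \<in> ?e ` carrier (Fmod 0)" using to_fun_carrier[OF g] by blast
    qed
  qed
  \<comment> \<open>At position 0 the cycle condition is automatic, since no admissible set is
    smaller than a vertex; at later positions the augmentation vanishes automatically. So elements
    of every kernel satisfy both hypotheses of \<open>bd_exact\<close>.\<close>
  have ker_cycle: "of_fun i f \<in> chains i \<and> (\<forall>T. adm T \<longrightarrow> bdry cells cmon (of_fun i f) T = 0)
      \<and> eps (of_fun i f) = 0 \<and> f \<in> carrier (Fmod i)"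
    if f: "f \<in> ker i" for f :: "('x, 'k) mpoly + nat \<Rightarrow> ('x, 'k) mpoly" and i
  proof (cases i)
    case 0
    then have *: "f \<in> carrier (Fmod 0)" "eps (of_fun 0 f) = 0"
      using f by (auto simp: ker_def a_kernel_def')
    have c: "of_fun 0 f \<in> chains 0" by (rule of_fun_chains[OF *(1)])
    have "bdry cells cmon (of_fun 0 f) T = 0" if T: "adm T" for T
    proof -
      have "of_fun 0 f (insert e T) = 0" if "e \<notin> T" for e
        using adm_card[OF T] adm_finite[OF T] that by (simp add: of_fun_def deg_def)
      then show ?thesis by (simp add: bdry_def)
    qed
    then show ?thesis using * c 0 by simp
  next
    case (Suc j)
    then have *: "f \<in> carrier (Fmod (Suc j))" "delta j f = (\<lambda>_. 0)"
      using f by (auto simp: ker_def a_kernel_def' Fmod_zero)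
    have c: "of_fun (Suc j) f \<in> chains (Suc j)" by (rule of_fun_chains[OF *(1)])
    have "bd j (of_fun (Suc j) f) = of_fun j (delta j f)"
      by (simp add: delta_def of_to_fun[OF bd_chains[OF c]])
    then have "bd j (of_fun (Suc j) f) = (\<lambda>_. 0)" by (simp add: *(2)) (simp add: of_fun_def fun_eq_iff)
    then have "bdry cells cmon (of_fun (Suc j) f) T = 0" if "adm T" for T
      using bd_adm[OF c that] by simp
    then show ?thesis using * c Suc chain_eps_zero[OF c] by simp
  qed
  have ex: "\<exists>g\<in>carrier (Fmod (Suc i)). delta i g = f" if f: "f \<in> ker i" for f :: "('x, 'k) mpoly + nat \<Rightarrow> ('x, 'k) mpoly" and i
  proof -
    from ker_cycle[OF f] obtain g where g: "g \<in> chains (Suc i)" "bd i g = of_fun i f"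
      using bd_exact[of "of_fun i f" i] by blast
    then have "delta i (to_fun (Suc i) g) = f"
      using ker_cycle[OF f] by (simp add: delta_def of_to_fun to_of_fun)
    then show ?thesis using to_fun_carrier[OF g(1)] by blast
  qed
  have image: "delta i ` carrier (Fmod (Suc i)) = ker i" for i
  proof
    show "ker i \<subseteq> delta i ` carrier (Fmod (Suc i))" using ex by blast
    show "delta i ` carrier (Fmod (Suc i)) \<subseteq> ker i"
    proof
      fix h :: "('x, 'k) mpoly + nat \<Rightarrow> ('x, 'k) mpoly" assume "h \<in> delta i ` carrier (Fmod (Suc i))"
      then obtain f where f: "f \<in> carrier (Fmod (Suc i))" "h = delta i f" by blast
      have h: "h \<in> carrier (Fmod i)" using f mod_homD(1)[OF delta_hom] by blast
      show "h \<in> ker i"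
      proof (cases i)
        case 0
        let ?g = "of_fun (Suc 0) f"
        have g: "?g \<in> chains (Suc 0)" using of_fun_chains[of f "Suc 0"] f 0 by simp
        have "?e h = eps (bd 0 ?g)" using f(2) 0 of_to_fun[OF bd_chains[OF g]] by (simp add: delta_def)
        also have "\<dots> = eps (bdry cells cmon ?g)" unfolding eps_def by (simp add: bd_def)
        also have "\<dots> = 0" by (rule eps_bdry) (use g in \<open>auto simp: chains_def deg_def\<close>)
        finally show ?thesis using h 0 by (simp add: ker_def a_kernel_def')
      next
        case (Suc j)
        then show ?thesis using h f delta_delta[of f j] by (simp add: ker_def a_kernel_def' Fmod_zero)
      qed
    qed
  qed
  \<comment> \<open>No cell has dimension \<open>l + 1\<close>, so the module mapping onto the
    kernel at \<open>l\<close> is zero.\<close>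
  have "deg (Suc l) = {}" using bound by (fastforce simp: deg_def)
  then have "carrier (Fmod (Suc l)) = {\<lambda>_. (0 :: ('x, 'k) mpoly)}"
    by (auto simp: mem_Fmod mpoly_ring_closed fun_eq_iff)
  moreover have "delta l (\<lambda>_. 0 :: ('x, 'k) mpoly) = (\<lambda>_. 0)"
  proof -
    have "of_fun (Suc l) (\<lambda>_. 0 :: ('x, 'k) mpoly) = (\<lambda>_. 0)" by (simp add: of_fun_def fun_eq_iff)
    moreover have "bd l (\<lambda>_. 0 :: ('x, 'k) mpoly) = (\<lambda>_. 0)" by (simp add: bd_def bdry_def fun_eq_iff)
    moreover have "to_fun l (\<lambda>_. 0 :: ('x, 'k) mpoly) = (\<lambda>_. 0)" by (simp add: to_fun_def fun_eq_iff)
    ultimately show ?thesis by (simp add: delta_def)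
  qed
  ultimately have last: "ker l = {\<zero>\<^bsub>Fmod l\<^esub>}"
    using image[of l] by (simp add: Fmod_zero)
  show ?thesis
    unfolding projective_resolution_def Let_def ker_def[symmetric]
    using proj ehom onto delta_hom image last by blast
qed

corollary proj_dim_le:
  assumes "\<And>T. adm T \<Longrightarrow> card T \<le> card P + l"
  shows "proj_dim (mpoly_ring V :: ('x, 'k::field) mpoly ring)
    (ideal_module (mpoly_ring V) (genideal (mpoly_ring V) gens)) \<le> enat l"
  unfolding proj_dim_def genideal_gens using cellular_resolution[OF assms] by (intro Inf_lower) blast

end

section \<open>The length of the resolution\<close>

lemma finsum_ideal_module:
  assumes I: "ideal I (mpoly_ring V)" and "finite A" "f \<in> A \<rightarrow> I"
  shows "finsum (ideal_module (mpoly_ring V) I) f A = sum f A"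
proof -
  interpret cring "mpoly_ring V" by (rule mpoly_ring_cring)
  interpret M: Module.module "mpoly_ring V" "ideal_module (mpoly_ring V) I" by (rule ideal_module_module[OF I])
  show ?thesis using assms(2,3)
    by (induct A) (simp_all add: M.finsum_insert Pi_def)
qed

context multihom
begin

definition antichain :: "'v set \<Rightarrow> bool"
  where "antichain A \<longleftrightarrow> A \<subseteq> P \<and> (\<forall>x\<in>A. \<forall>y\<in>A. x \<noteq> y \<longrightarrow> \<not> le x y)"

text \<open>The largest elements of the fibres account for \<open>card P\<close>. The others have
  second component less than \<open>m\<close>, so they are spread over \<open>m - 1\<close>
  antichains.\<close>

lemma adm_card_le:
  assumes F: "adm F" and a: "\<And>A. antichain A \<Longrightarrow> card A \<le> a"
  shows "card F \<le> card P + a * (m - 1)"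
proof -
  define top where "top = {(c, j) \<in> F. \<forall>k. (c, k) \<in> F \<longrightarrow> k \<le> j}"
  define A where "A j = {c. (c, j) \<in> F \<and> (\<exists>k>j. (c, k) \<in> F)}" for j
  have finF: "finite F" by (rule adm_finite[OF F])
  have "antichain (A j)" for j
    unfolding antichain_def
  proof (intro conjI ballI impI notI)
    show "A j \<subseteq> P" using adm_fst[OF F] by (auto simp: A_def)
    fix x y assume "x \<in> A j" "y \<in> A j" "x \<noteq> y" "le x y"
    then obtain k where "k > j" "(x, k) \<in> F" "(y, j) \<in> F" by (auto simp: A_def)
    moreover have "k \<le> j" using F \<open>(x, k) \<in> F\<close> \<open>(y, j) \<in> F\<close> \<open>le x y\<close> \<open>x \<noteq> y\<close>
      unfolding adm_def by blast
    ultimately show False by simp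
  qed
  then have cA: "card (A j) \<le> a" for j using a by blast
  have finA: "finite (A j)" for j
    by (rule finite_subset[OF _ finP]) (use adm_fst[OF F] in \<open>auto simp: A_def\<close>)
  have "F \<subseteq> top \<union> (\<Union>j\<in>{1..<m}. (\<lambda>c. (c, j)) ` A j)"
  proof
    fix e assume e: "e \<in> F"
    obtain c j where cj: "e = (c, j)" by (cases e)
    show "e \<in> top \<union> (\<Union>j\<in>{1..<m}. (\<lambda>c. (c, j)) ` A j)"
    proof (cases "\<exists>k>j. (c, k) \<in> F")
      case True
      then obtain k where "k > j" "(c, k) \<in> F" by blast
      then have "j \<in> {1..<m}" using e adm_sub[OF F] by (auto simp: cells_def cj)
      moreover have "c \<in> A j" using True e by (simp add: A_def cj)
      ultimately show ?thesis unfolding cj by blast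
    next
      case False
      then show ?thesis using e by (auto simp: top_def cj not_less)
    qed
  qed
  moreover have fint: "finite top" by (rule finite_subset[OF _ finF]) (auto simp: top_def)
  ultimately have "card F \<le> card (top \<union> (\<Union>j\<in>{1..<m}. (\<lambda>c. (c, j)) ` A j))"
    using finA by (intro card_mono) auto
  also have "\<dots> \<le> card top + card (\<Union>j\<in>{1..<m}. (\<lambda>c. (c, j)) ` A j)" by (rule card_Un_le)
  also have "card top \<le> card P"
  proof (rule card_inj_on_le)
    show "inj_on fst top" unfolding inj_on_def top_def by (auto intro: antisym)
    show "fst ` top \<subseteq> P" using adm_fst[OF F] by (auto simp: top_def)
  qed (rule finP)
  also have "card (\<Union>j\<in>{1..<m}. (\<lambda>c. (c, j)) ` A j) \<le> (\<Sum>j\<in>{1..<m}. card ((\<lambda>c. (c, j)) ` A j))"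
    by (rule card_UN_le) simp
  also have "\<dots> \<le> (\<Sum>j\<in>{1..<m}. a)"
    by (intro sum_mono order_trans[OF card_image_le[OF finA] cA])
  finally show ?thesis by (simp add: mult.commute)
qed

end

section \<open>A non-bounding cycle\<close>

text \<open>An indeterminate of \<open>\<beta> e\<close> occurs in no other label, so it can enter
  \<open>lab T\<close> only through \<open>e\<close> itself.\<close>

lemma (in labels) mdvd_label_mem:
  assumes T: "T \<subseteq> E" and e: "e \<in> E" "\<beta> e \<noteq> 0" and dvd: "mdvd (\<beta> e) (lab T)"
  shows "e \<in> T"
proof -
  obtain x where x: "x \<in> Poly_Mapping.keys (\<beta> e)" using e(2) by fastforce
  then have "Poly_Mapping.lookup (lab T) x \<noteq> 0"
    using dvd unfolding mdvd_iff in_keys_iff by (metis le_zero_eq)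
  then obtain e' where e': "e' \<in> T" "x \<in> Poly_Mapping.keys (\<beta> e')"
    unfolding lab_def lookup_sum in_keys_iff by (meson sum.neutral)
  then have "e' = e" using coprime_labels[of e e'] e(1) T x by blast
  with e'(1) show ?thesis by simp
qed

lemma (in labels) lab_union:
  "finite S \<Longrightarrow> finite T \<Longrightarrow> S \<inter> T = {} \<Longrightarrow> lab (S \<union> T) = lab S + lab T"
  by (simp add: lab_def sum.union_disjoint)

locale cell_res_nontrivial = cell_res P le m \<beta> V
  for P :: "'v::{linorder, countable} set" and le m and \<beta> :: "'v \<times> nat \<Rightarrow> ('x \<Rightarrow>\<^sub>0 nat)" and V +
  assumes label_nonzero: "\<And>e. e \<in> cells \<Longrightarrow> \<beta> e \<noteq> 0" and m_pos: "m \<ge> 1"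
begin

text \<open>All generators come from sets of the same size, so none properly divides another. After
  multiplication by a nonconstant label, the generator of \<open>T\<close> can no longer
  occur.\<close>

lemma minimal_generator:
  assumes T: "T \<in> deg 0" and e: "e \<in> cells" and u: "u \<in> gen_ideal"
  shows "Poly_Mapping.lookup (mon (\<beta> e) * (u :: ('x, 'k::field) mpoly)) (lab T) = 0"
proof -
  obtain g where g: "u = eps g" using u by (auto simp: gen_ideal_def)
  have "\<not> mdvd (\<beta> e + lab U) (lab T)" if U: "U \<in> deg 0" for U
  proof
    assume "mdvd (\<beta> e + lab U) (lab T)"
    then obtain t where t: "lab T = \<beta> e + lab U + t" by (auto simp: mdvd_def)
    have "mdvd (lab U) (lab T)" unfolding t mdvd_def by (metis add.commute add.left_commute)
    then have "\<forall>e'\<in>U. mdvd (\<beta> e') (lab T)" using mdvd_lab_iff[OF deg_sub[OF U]] by blast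
    then have "U \<subseteq> T" using mdvd_label_mem[OF deg_sub[OF T]] deg_sub[OF U] label_nonzero by blast
    moreover have "card U = card T" "finite T" using T U adm_finite by (auto simp: deg_def)
    ultimately have "U = T" by (simp add: card_subset_eq)
    then have "lab T + (\<beta> e + t) = lab T + 0" using t by (simp add: add_ac)
    then have "\<beta> e + t = 0" by (rule add_left_imp_eq)
    then have "Poly_Mapping.lookup (\<beta> e) x + Poly_Mapping.lookup t x = 0" for x
      by (metis lookup_add lookup_zero)
    then have "\<beta> e = 0" by (intro poly_mapping_eqI) auto
    with label_nonzero[OF e] show False by simp
  qed
  then have "Poly_Mapping.lookup (mon (\<beta> e + lab U) * g U) (lab T) = 0" if "U \<in> deg 0" for U
    using that by (intro lookup_mon_mult_zero) auto
  moreover have "mon (\<beta> e) * u = (\<Sum>U\<in>deg 0. mon (\<beta> e + lab U) * g U)"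
    unfolding g eps_def sum_distrib_left by (simp add: mon_add mult.assoc)
  ultimately show ?thesis by (simp add: lookup_sum)
qed

text \<open>Each monotone map on an antichain \<open>A\<close> extends by \<open>m\<close> above \<open>A\<close> and by \<open>1\<close> elsewhere.\<close>

definition rest :: "'v set \<Rightarrow> ('v \<times> nat) set"
  where "rest A = (\<lambda>c. (c, if \<exists>a\<in>A. le a c then m else 1)) ` (P - A)"

lemma extend_graph:
  assumes A: "antichain A" and F: "F \<subseteq> A \<times> {1..m}" "fst ` F = A" "card F = card A"
  shows "F \<union> rest A \<in> deg 0"
proof -
  have AP: "A \<subseteq> P" using A by (simp add: antichain_def)
  have fin: "finite F" "finite (rest A)" "finite A"
    using F(1) AP finP finite_subset[of A P] finite_subset[of F "A \<times> {1..m}"] by (auto simp: rest_def)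
  have disj: "F \<inter> rest A = {}" using F(1) by (auto simp: rest_def)
  have "card (rest A) = card (P - A)" unfolding rest_def by (rule card_image) (auto simp: inj_on_def)
  then have card: "card (F \<union> rest A) = card P"
    using card_Un_disjoint[OF fin(1,2) disj] F(3) card_Diff_subset[OF fin(3) AP] card_mono[OF finP AP]
    by simp
  have fst: "fst ` (F \<union> rest A) = P"
    using F(2) AP unfolding image_Un rest_def image_image by auto
  have sub: "F \<union> rest A \<subseteq> cells"
    using F(1) AP m_pos unfolding rest_def cells_def by auto
  have "i \<le> j" if cd: "(c, i) \<in> F \<union> rest A" "(d, j) \<in> F \<union> rest A" "le c d" "c \<noteq> d" for c d i j
  proof -
    have P: "c \<in> P" "d \<in> P" "i \<le> m" "j \<ge> 1" using cd(1,2) sub by (auto simp: cells_def)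
    have i: "c \<in> A \<or> (\<exists>a\<in>A. le a c) \<or> i = 1"
      using cd(1) F(1) by (auto simp: rest_def split: if_splits)
    have j: "d \<in> A \<or> \<not> (\<exists>a\<in>A. le a d) \<or> j = m"
      using cd(2) F(1) by (auto simp: rest_def split: if_splits)
    \<comment> \<open>If \<open>c\<close> lies in or above \<open>A\<close>, then \<open>d\<close>
      lies above \<open>A\<close> and outside it, so its value is \<open>m\<close>; otherwise the
      value of \<open>c\<close> is 1.\<close>
    show ?thesis
    proof (cases "\<exists>a\<in>A. le a c \<or> a = c")
      case True
      then obtain a where a: "a \<in> A" "le a c \<or> a = c" by blast
      have aP: "a \<in> P" using a AP by blast
      have ad: "le a d" using a cd(3) le_trans[OF aP P(1,2)] by blast
      have "d \<notin> A"
      proof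
        assume "d \<in> A"
        then have "a = d" using A a ad unfolding antichain_def by blast
        then have "c = d" using a(2) le_antisym[OF P(1,2)] cd(3) by blast
        with cd(4) show False by simp
      qed
      then have "j = m" using j a ad by blast
      then show ?thesis using P by simp
    next
      case False
      then have "i = 1" using i by blast
      then show ?thesis using P by simp
    qed
  qed
  then have "adm (F \<union> rest A)" unfolding adm_def using fst sub by blast
  then show ?thesis using card by (simp add: deg_def)
qed

theorem resolution_length:
  assumes A: "antichain A"
    and res: "projective_resolution (mpoly_ring V :: ('x, 'k::field) mpoly ring)
      (ideal_module (mpoly_ring V) gen_ideal) l Q \<delta> \<epsilon>"
  shows "card A * (m - 1) \<le> l"
proof (rule ccontr)
  let ?S = "mpoly_ring V :: ('x, 'k) mpoly ring"
  let ?I = "gen_ideal :: ('x, 'k) mpoly set"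
  define E where "E = A \<times> {1..m}"
  define i where "i = card A * (m - 1)"
  assume "\<not> card A * (m - 1) \<le> l"
  then have il: "i > l" by (simp add: i_def)
  have AP: "A \<subseteq> P" using A by (simp add: antichain_def)
  have finA: "finite A" using AP finP finite_subset by blast
  have finE: "finite E" using finA by (simp add: E_def)
  have Ecells: "E \<subseteq> cells" using AP by (auto simp: E_def cells_def)
  have cardE: "card E = card A + i" using m_pos
    by (cases m) (simp_all add: E_def i_def card_cartesian_product)
  define s where "s e T = card {t \<in> E - T. t < e}" for e T
  interpret L: labels E \<beta> V s
    using finE keys_label coprime_labels Ecells by unfold_locales blast+
  have cmonL: "L.cmon e T = sgn_at e (E - T) * mon (\<beta> e)" for e T
    by (simp add: L.cmon_def sgn_at_def s_def)
  interpret S: cring ?S by (rule mpoly_ring_cring)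
  have skew: "skew_coeffs E (L.cmon :: _ \<Rightarrow> _ \<Rightarrow> ('x, 'k) mpoly)"
    using cosgn_skew[OF finE, of "\<lambda>e. mon (\<beta> e)"] by (simp add: cmonL[abs_def])
  interpret K: koszul ?S E L.cmon
  proof
    fix e p T assume *: "e \<in> E" "p \<in> E" "T \<subseteq> E" "e \<noteq> p" "e \<notin> T" "p \<notin> T"
    have "L.cmon e T * L.cmon p (insert e T) = - (L.cmon p T * (L.cmon e (insert p T) :: ('x, 'k) mpoly))"
      by (rule skew_coeffsD[OF skew *])
    moreover have "L.cmon p T * L.cmon e (insert p T) \<in> carrier ?S"
      using * by (intro mpoly_ring_mult L.cmon_closed)
    ultimately show "L.cmon e T \<otimes>\<^bsub>?S\<^esub> L.cmon p (insert e T)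
        = \<ominus>\<^bsub>?S\<^esub> (L.cmon p T \<otimes>\<^bsub>?S\<^esub> L.cmon e (insert p T))"
      by (simp add: a_inv_mpoly_ring)
  qed (use finE L.cmon_closed in auto)
  let ?M = "ideal_module ?S ?I"
  have M: "Module.module ?S ?M" by (rule S.ideal_module_module[OF gen_ideal_ideal])
  have fs: "finsum ?S (\<lambda>e. L.cmon e T \<otimes>\<^bsub>?S\<^esub> f (insert e T)) (E - T) = bdry E L.cmon f T"
    if "\<And>T. f T \<in> carrier ?S" for f T
    unfolding bdry_def using finE L.cmon_closed that
    by (subst finsum_mpoly_ring) (auto intro!: mpoly_ring_mult)
  have "K.koszul_ring_exact k" if k: "k \<ge> 1" for k
    unfolding K.koszul_ring_exact_def
  proof (intro allI impI, elim conjE)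
    fix f :: "('v \<times> nat) set \<Rightarrow> ('x, 'k) mpoly"
    assume f: "\<forall>T. f T \<in> carrier ?S"
      and cyc: "\<forall>T\<subseteq>E. Suc (card T) = k \<longrightarrow>
        finsum ?S (\<lambda>e. L.cmon e T \<otimes>\<^bsub>?S\<^esub> f (insert e T)) (E - T) = \<zero>\<^bsub>?S\<^esub>"
    have "skew_coeffs E (\<lambda>e T. (- 1) ^ s e T :: 'k)"
      using cosgn_skew[OF finE, of "\<lambda>_. 1"] by (simp add: sgn_at_def s_def)
    then obtain w where w: "\<forall>T. w T \<in> carrier ?S" "\<forall>T\<subseteq>E. card T = k \<longrightarrow> bdry E L.cmon w T = f T"
      using L.koszul_monomials_exact[OF _ k, of f] f cyc fs[of f] by auto
    then show "\<exists>w. (\<forall>T. w T \<in> carrier ?S) \<and> (\<forall>T\<subseteq>E. card T = k \<longrightarrow>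
        finsum ?S (\<lambda>e. L.cmon e T \<otimes>\<^bsub>?S\<^esub> w (insert e T)) (E - T) = f T)"
      using fs[of w] by (intro exI[of _ w]) simp
  qed
  from K.koszul_exact_of_resolution[OF M res this il]
  have exact: "K.koszul_exact ?M ?I i" by simp
  have kb: "K.kbd ?M f T = bdry E L.cmon f T" if "\<And>T. f T \<in> ?I" for f T
  proof -
    have "L.cmon e T * f (insert e T) \<in> ?I" if "e \<in> E" for e
      using ideal.I_l_closed[OF gen_ideal_ideal \<open>\<And>T. f T \<in> ?I\<close> L.cmon_closed[OF that]] by simp
    then show ?thesis unfolding K.kbd_def bdry_def using finE
      by (subst finsum_ideal_module[OF gen_ideal_ideal]) auto
  qed
  define R where "R = rest A"
  have finR: "finite R" unfolding R_def rest_def using finP by simp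
  have ER: "F \<inter> R = {}" if "F \<subseteq> E" for F using that by (auto simp: R_def rest_def E_def)
  \<comment> \<open>The product of the simplex boundaries, times \<open>mon (lab R)\<close>: a set
    \<open>T\<close> occurs when \<open>E - T\<close> is the graph of a map on \<open>A\<close>, and
    the monomial of that map is its coefficient. With signs counted in complements no further signs
    appear.\<close>
  define f :: "('v \<times> nat) set \<Rightarrow> ('x, 'k) mpoly"
    where "f T = (if fst ` (E - T) = A \<and> card (E - T) = card A then mon (lab (E - T) + lab R) else 0)" for T
  have fI: "f T \<in> ?I" for T
  proof (cases "fst ` (E - T) = A \<and> card (E - T) = card A")
    case True
    then have "(E - T) \<union> R \<in> deg 0" unfolding R_def by (intro extend_graph[OF A]) (auto simp: E_def)
    moreover have "lab ((E - T) \<union> R) = lab (E - T) + lab R"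
      using finE finR ER[of "E - T"] by (intro lab_union) auto
    ultimately have "f T \<in> gens" using True by (force simp: f_def gens_def)
    moreover have "gens \<subseteq> carrier ?S" using mon_lab_closed deg_sub by (auto simp: gens_def)
    ultimately show ?thesis using S.genideal_self[of gens] unfolding genideal_gens by blast
  next
    case False
    then show ?thesis using additive_subgroup.zero_closed[OF ideal.axioms(1)[OF gen_ideal_ideal]]
      by (auto simp: f_def)
  qed
  \<comment> \<open>\<open>E - T\<close> has one element more than \<open>A\<close>. If it covers
    \<open>A\<close>, exactly one fibre has two elements, and the two resulting terms are the same
    monomial with opposite signs; if not, all terms vanish.\<close>
  have cyc: "bdry E L.cmon f T = 0" if T: "T \<subseteq> E" "Suc (card T) = i" for T
  proof -
    define F where "F = E - T"
    have F: "finite F" "card F = Suc (card A)"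
      using finE T cardE card_Diff_subset[OF finite_subset[OF T(1) finE] T(1)] by (auto simp: F_def)
    have ins: "E - insert e T = F - {e}" for e by (auto simp: F_def)
    have fins: "f (insert e T) = (if fst ` (F - {e}) = A then mon (lab (F - {e}) + lab R) else 0)" if "e \<in> F" for e
      using F that by (simp add: f_def ins)
    have "fst ` (F - {e}) \<subseteq> fst ` F" "fst ` F \<subseteq> A" for e using T by (auto simp: F_def E_def)
    then consider "\<forall>e\<in>F. fst ` (F - {e}) \<noteq> A" | "fst ` F = A" by blast
    then show ?thesis
    proof cases
      case 1
      then show ?thesis using fins by (simp add: bdry_def F_def)
    next
      case 2
      obtain c j k where jk: "j < k" "(c, j) \<in> F" "(c, k) \<in> F"
        and two: "{e \<in> F. fst ` (F - {e}) = A} = {(c, j), (c, k)}"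
        and sg: "(sgn_at (c, j) (F - {(c, j)}) :: ('x, 'k) mpoly) = - sgn_at (c, k) (F - {(c, k)})"
        by (rule two_element_fibre[OF F(1) 2 F(2)])
      have summand: "L.cmon e T * f (insert e T)
          = (if e \<in> {(c, j), (c, k)} then sgn_at e (F - {e}) * mon (lab F + lab R) else 0)" if e: "e \<in> F" for e
      proof -
        have "sgn_at e F = (sgn_at e (F - {e}) :: ('x, 'k) mpoly)"
          using sgn_at_self[of e "F - {e}"] e by (simp add: insert_absorb)
        moreover have "lab F = \<beta> e + lab (F - {e})"
          using e F(1) by (simp add: lab_def sum.remove)
        moreover have "fst ` (F - {e}) = A \<longleftrightarrow> e \<in> {(c, j), (c, k)}"
          unfolding two[symmetric] using e by simp
        ultimately show ?thesis
          using fins[OF e] by (simp add: cmonL F_def[symmetric] mon_add mult.assoc)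
      qed
      have "bdry E L.cmon f T = (\<Sum>e\<in>F. if e \<in> {(c, j), (c, k)} then sgn_at e (F - {e}) * mon (lab F + lab R) else 0)"
        unfolding bdry_def F_def[symmetric] by (intro sum.cong refl summand)
      also have "\<dots> = (\<Sum>e\<in>{(c, j), (c, k)}. sgn_at e (F - {e}) * mon (lab F + lab R))"
        using F(1) jk by (intro sum.mono_neutral_cong_right) auto
      also have "\<dots> = 0" using jk(1) sg by simp
      finally show ?thesis .
    qed
  qed
  have "\<forall>T\<subseteq>E. Suc (card T) = i \<longrightarrow> K.kbd ?M f T = \<zero>\<^bsub>?M\<^esub>"
    using cyc kb[of f] fI by simp
  then obtain w where wI: "\<And>T. w T \<in> ?I" and w: "\<And>T. T \<subseteq> E \<Longrightarrow> card T = i \<Longrightarrow> K.kbd ?M w T = f T"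
    using exact[unfolded K.koszul_exact_def, rule_format, of f] fI by auto
  \<comment> \<open>The graph of the constant map 1 on \<open>A\<close>; it lies in \<open>E\<close>
    because \<open>m \<ge> 1\<close>.\<close>
  define F0 where "F0 = A \<times> {1::nat}"
  define T0 where "T0 = E - F0"
  have F0: "F0 \<subseteq> E" "fst ` F0 = A" "card F0 = card A" using m_pos
    by (auto simp: F0_def E_def card_cartesian_product)
  have ET0: "E - T0 = F0" using F0(1) by (auto simp: T0_def)
  have "card T0 = i" unfolding T0_def
    using card_Diff_subset[OF finite_subset[OF F0(1) finE] F0(1)] cardE F0(3) by simp
  then have bw: "bdry E L.cmon w T0 = f T0" using w[of T0] kb[of w] wI by (auto simp: T0_def)
  have T: "F0 \<union> R \<in> deg 0" unfolding R_def by (rule extend_graph[OF A _ F0(2,3)]) (use F0(1) E_def in auto)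
  have labT: "lab (F0 \<union> R) = lab F0 + lab R"
    using finE finR ER[OF F0(1)] F0(1) finite_subset by (intro lab_union) auto
  \<comment> \<open>Every term of the boundary is, up to sign, a label times an element of the
    ideal, so this minimal generator does not occur in it; in \<open>f T0\<close> it has coefficient
    1.\<close>
  have "Poly_Mapping.lookup (bdry E L.cmon w T0) (lab (F0 \<union> R)) = 0"
    unfolding bdry_def lookup_sum
  proof (intro sum.neutral ballI)
    fix e assume "e \<in> E - T0"
    then have "e \<in> cells" using Ecells by blast
    from minimal_generator[OF T this wI]
    show "Poly_Mapping.lookup (L.cmon e T0 * w (insert e T0)) (lab (F0 \<union> R)) = 0"
      by (simp add: L.cmon_def mult.assoc lookup_sign_mult)
  qed
  moreover have "Poly_Mapping.lookup (f T0) (lab (F0 \<union> R)) = 1"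
    by (simp add: f_def ET0 F0 labT)
  ultimately show False using bw by simp
qed

theorem proj_dim_gens:
  assumes "antichain A" and "\<And>B. antichain B \<Longrightarrow> card B \<le> card A"
  shows "proj_dim (mpoly_ring V :: ('x, 'k::field) mpoly ring)
    (ideal_module (mpoly_ring V) (genideal (mpoly_ring V) gens)) = enat (card A * (m - 1))"
proof (rule antisym)
  show "proj_dim (mpoly_ring V :: ('x, 'k) mpoly ring)
    (ideal_module (mpoly_ring V) (genideal (mpoly_ring V) gens)) \<le> enat (card A * (m - 1))"
    by (rule proj_dim_le) (rule adm_card_le[OF _ assms(2)])
  show "enat (card A * (m - 1)) \<le> proj_dim (mpoly_ring V :: ('x, 'k) mpoly ring)
    (ideal_module (mpoly_ring V) (genideal (mpoly_ring V) gens))"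
    unfolding proj_dim_def genideal_gens
    using resolution_length[OF assms(1)] by (intro Inf_greatest) auto
qed

end

section \<open>Shrinking cycles\<close>

definition reach_antichain :: "'v pair_pre_digraph \<Rightarrow> 'v set \<Rightarrow> bool"
  where "reach_antichain G A \<longleftrightarrow> A \<subseteq> pverts G \<and> (\<forall>x\<in>A. \<forall>y\<in>A. x \<noteq> y \<longrightarrow> (x, y) \<notin> (parcs G)\<^sup>*)"

text \<open>Such a surjection identifies the posets of strongly connected components; this is what
  survives of a graph under shrinking.\<close>

definition reach_quotient :: "'v pair_pre_digraph \<Rightarrow> 'v pair_pre_digraph \<Rightarrow> bool"
  where "reach_quotient G G' \<longleftrightarrow> (\<exists>\<pi>. \<pi> ` pverts G = pverts G' \<and>
    (\<forall>u\<in>pverts G. \<forall>v\<in>pverts G. (u, v) \<in> (parcs G)\<^sup>* \<longleftrightarrow> (\<pi> u, \<pi> v) \<in> (parcs G')\<^sup>*))"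

lemma reach_quotient_refl: "reach_quotient G G"
  unfolding reach_quotient_def by (rule exI[of _ "\<lambda>x. x"]) simp

lemma reach_quotient_trans:
  assumes "reach_quotient G G'" "reach_quotient G' G''"
  shows "reach_quotient G G''"
proof -
  obtain f where f: "f ` pverts G = pverts G'"
    "\<And>u v. u \<in> pverts G \<Longrightarrow> v \<in> pverts G \<Longrightarrow> (u, v) \<in> (parcs G)\<^sup>* \<longleftrightarrow> (f u, f v) \<in> (parcs G')\<^sup>*"
    using assms(1) unfolding reach_quotient_def by blast
  obtain g where g: "g ` pverts G' = pverts G''"
    "\<And>u v. u \<in> pverts G' \<Longrightarrow> v \<in> pverts G' \<Longrightarrow> (u, v) \<in> (parcs G')\<^sup>* \<longleftrightarrow> (g u, g v) \<in> (parcs G'')\<^sup>*"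
    using assms(2) unfolding reach_quotient_def by blast
  have "(g \<circ> f) ` pverts G = pverts G''" using f(1) g(1) by (metis image_comp)
  moreover have "(u, v) \<in> (parcs G)\<^sup>* \<longleftrightarrow> ((g \<circ> f) u, (g \<circ> f) v) \<in> (parcs G'')\<^sup>*"
    if "u \<in> pverts G" "v \<in> pverts G" for u v
    using f(2)[OF that] g(2)[of "f u" "f v"] f(1) that by auto
  ultimately show ?thesis unfolding reach_quotient_def by blast
qed

text \<open>Vertices with the same image reach each other, so the map is injective on antichains;
  conversely, any choice of preimages lifts an antichain.\<close>

lemma reach_quotient_antichain:
  assumes "reach_quotient G G'"
  shows "{card A | A. reach_antichain G A} = {card A | A. reach_antichain G' A}"
proof -
  obtain f where onto: "f ` pverts G = pverts G'"
    and f: "\<And>u v. u \<in> pverts G \<Longrightarrow> v \<in> pverts G \<Longrightarrow> (u, v) \<in> (parcs G)\<^sup>* \<longleftrightarrow> (f u, f v) \<in> (parcs G')\<^sup>*"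
    using assms unfolding reach_quotient_def by blast
  have "\<exists>B. reach_antichain G' B \<and> card B = card A" if A: "reach_antichain G A" for A
  proof (intro exI conjI)
    have AV: "A \<subseteq> pverts G" using A by (simp add: reach_antichain_def)
    have inj: "inj_on f A"
    proof (rule inj_onI)
      fix x y assume xy: "x \<in> A" "y \<in> A" "f x = f y"
      then have "(x, y) \<in> (parcs G)\<^sup>*" using f[of x y] AV by auto
      then show "x = y" using A xy unfolding reach_antichain_def by blast
    qed
    show "card (f ` A) = card A" by (rule card_image[OF inj])
    show "reach_antichain G' (f ` A)" unfolding reach_antichain_def
    proof (intro conjI ballI impI)
      show "f ` A \<subseteq> pverts G'" using AV onto by blast
      fix x' y' assume "x' \<in> f ` A" "y' \<in> f ` A" "x' \<noteq> y'"
      then obtain x y where "x \<in> A" "y \<in> A" "x' = f x" "y' = f y" "x \<noteq> y" by blast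
      then show "(x', y') \<notin> (parcs G')\<^sup>*" using A f[of x y] AV unfolding reach_antichain_def by blast
    qed
  qed
  moreover have "\<exists>A. reach_antichain G A \<and> card A = card B" if B: "reach_antichain G' B" for B
  proof -
    have BV: "B \<subseteq> pverts G'" using B by (simp add: reach_antichain_def)
    define g where "g = inv_into (pverts G) f"
    have g: "g b \<in> pverts G" "f (g b) = b" if "b \<in> B" for b
      using that BV onto unfolding g_def by (metis inv_into_into subsetD, metis f_inv_into_f subsetD)
    have "inj_on g B" by (rule inj_onI) (metis g(2))
    moreover have "reach_antichain G (g ` B)" unfolding reach_antichain_def
    proof (intro conjI ballI impI)
      show "g ` B \<subseteq> pverts G" using g by blast
      fix x y assume "x \<in> g ` B" "y \<in> g ` B" "x \<noteq> y"
      then obtain b c where "b \<in> B" "c \<in> B" "x = g b" "y = g c" "b \<noteq> c" by blast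
      then show "(x, y) \<notin> (parcs G)\<^sup>*" using B f[of x y] g unfolding reach_antichain_def by simp
    qed
    ultimately show ?thesis using card_image by blast
  qed
  ultimately show ?thesis by (auto; metis)
qed

text \<open>Intermediate graphs may contain cycles of length two and so fail to be simple. This
  weaker property is the one that shrinking preserves.\<close>

definition loopfree_fin :: "'v pair_pre_digraph \<Rightarrow> bool"
  where "loopfree_fin G \<longleftrightarrow> finite (pverts G) \<and> pverts G \<noteq> {} \<and> parcs G \<subseteq> pverts G \<times> pverts G
    \<and> (\<forall>v. (v, v) \<notin> parcs G)"

lemma loopfree_fin_pair_digraph: "loopfree_fin G \<Longrightarrow> pair_digraph G"
  unfolding loopfree_fin_def by unfold_locales (auto intro: finite_subset)

lemma simple_digraph_loopfree_fin: "simple_digraph G \<Longrightarrow> loopfree_fin G"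
proof -
  assume G: "simple_digraph G"
  then interpret pair_digraph G by (simp add: simple_digraph_def)
  show ?thesis using G pair_finite_verts in_arcsD1 in_arcsD2
    unfolding simple_digraph_def loopfree_fin_def by auto
qed

lemma closed_walk_reach:
  assumes "pcas u p v" "set p \<subseteq> r" "x \<in> fst ` set p"
  shows "(u, x) \<in> r\<^sup>* \<and> (x, v) \<in> r\<^sup>*"
  using assms
proof (induct p arbitrary: u)
  case Nil
  then show ?case by simp
next
  case (Cons e p)
  have e: "fst e = u" "(u, snd e) \<in> r" "pcas (snd e) p v" "set p \<subseteq> r" using Cons(2,3) by (auto simp: prod_eq_iff)
  have all: "(u', v) \<in> r\<^sup>*" if "pcas u' q v" "set q \<subseteq> r" for u' q
    using that
  proof (induct q arbitrary: u')
    case (Cons d q)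
    then have "fst d = u'" "(u', snd d) \<in> r" "(snd d, v) \<in> r\<^sup>*" by (auto simp: prod_eq_iff)
    then show ?case by (meson converse_rtrancl_into_rtrancl)
  qed simp
  show ?case
  proof (cases "x = u")
    case True
    then show ?thesis using all[OF Cons(2,3)] by simp
  next
    case False
    then have "x \<in> fst ` set p" using Cons(4) e(1) by auto
    with Cons(1)[OF e(3,4)] e(2) show ?thesis by (meson converse_rtrancl_into_rtrancl)
  qed
qed

text \<open>The bound \<open>2 \<le> card C\<close> comes from the absence of loops; it makes
  shrinking decrease the number of vertices.\<close>

lemma cycle_vertices:
  assumes G: "loopfree_fin G" and cyc: "pre_digraph.cycle (with_proj G) p"
  defines "C \<equiv> fst ` set p"
  shows "C \<subseteq> pverts G" and "2 \<le> card C" and "\<And>x y. x \<in> C \<Longrightarrow> y \<in> C \<Longrightarrow> (x, y) \<in> (parcs G)\<^sup>*"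
proof -
  interpret pair_digraph G by (rule loopfree_fin_pair_digraph[OF G])
  obtain u where u: "pcas u p u" "set p \<subseteq> parcs G" "p \<noteq> []"
    using cyc unfolding cycle_def awalk_def by auto
  show CV: "C \<subseteq> pverts G" unfolding C_def by (intro image_subsetI arc_fst_in_verts subsetD[OF u(2)])
  show "(x, y) \<in> (parcs G)\<^sup>*" if "x \<in> C" "y \<in> C" for x y
    using closed_walk_reach[OF u(1,2), of x] closed_walk_reach[OF u(1,2), of y] that
    unfolding C_def by (meson rtrancl_trans)
  obtain e q where p: "p = e # q" using u(3) by (cases p) auto
  have e: "fst e = u" "pcas (snd e) q u" using u(1) p by auto
  have ne: "fst e \<noteq> snd e" using G u(2) p unfolding loopfree_fin_def by (cases e) auto
  then obtain d q' where "q = d # q'" using e by (cases q) auto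
  then have "snd e \<in> C" using e p by (auto simp: C_def)
  moreover have "fst e \<in> C" using p by (simp add: C_def)
  ultimately have "card {fst e, snd e} \<le> card C"
    using finite_subset[OF CV pair_finite_verts] by (intro card_mono) auto
  then show "2 \<le> card C" using ne by simp
qed

lemma shrink_step_props:
  assumes G: "loopfree_fin G" and step: "shrink_step G G'"
  shows "loopfree_fin G'" and "card (pverts G') < card (pverts G)" and "reach_quotient G G'"
proof -
  obtain p z where cyc: "pre_digraph.cycle (with_proj G) p" and z: "z \<notin> pverts G" and G': "G' = shrink G p z"
    using step unfolding shrink_step_def by blast
  define C where "C = fst ` set p"
  note C = cycle_vertices[OF G cyc, folded C_def]
  have finV: "finite (pverts G)" and wf: "parcs G \<subseteq> pverts G \<times> pverts G" and loop: "\<And>v. (v, v) \<notin> parcs G"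
    using G by (auto simp: loopfree_fin_def)
  have V': "pverts G' = (pverts G - C) \<union> {z}" by (simp add: G' shrink_def Let_def C_def)
  have arcs': "parcs G' = {(i, j). (i, j) \<in> parcs G \<and> i \<notin> C \<and> j \<notin> C}
       \<union> {(z, i) | i. i \<in> pverts G - C \<and> (\<exists>j\<in>C. (j, i) \<in> parcs G)}
       \<union> {(i, z) | i. i \<in> pverts G - C \<and> (\<exists>j\<in>C. (i, j) \<in> parcs G)}"
    by (simp add: G' shrink_def Let_def C_def)
  show "loopfree_fin G'" unfolding loopfree_fin_def V' arcs' using finV wf loop z by auto
  have "card (pverts G') = card (pverts G) - card C + 1"
    unfolding V' using z finV C(1) by (simp add: card_Diff_subset finite_subset)
  moreover have "card C \<le> card (pverts G)" by (rule card_mono[OF finV C(1)])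
  ultimately show "card (pverts G') < card (pverts G)" using C(2) by simp
  define \<pi> where "\<pi> u = (if u \<in> C then z else u)" for u
  obtain c0 where c0: "c0 \<in> C" using C(2) by fastforce
  have onto: "\<pi> ` pverts G = pverts G'"
  proof
    show "\<pi> ` pverts G \<subseteq> pverts G'" by (auto simp: \<pi>_def V')
    show "pverts G' \<subseteq> \<pi> ` pverts G"
    proof
      fix v assume "v \<in> pverts G'"
      then consider "v = z" | "v \<in> pverts G" "v \<notin> C" by (auto simp: V')
      then show "v \<in> \<pi> ` pverts G"
        by cases (use c0 C(1) in \<open>auto simp: \<pi>_def image_iff intro: bexI[of _ c0]\<close>)
    qed
  qed
  have fwd1: "(\<pi> u, \<pi> v) \<in> (parcs G')\<^sup>*" if uv: "(u, v) \<in> parcs G" for u v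
  proof (cases "u \<in> C \<and> v \<in> C")
    case False
    have "u \<in> pverts G" "v \<in> pverts G" using uv wf by auto
    then have "(\<pi> u, \<pi> v) \<in> parcs G'" using False uv by (auto simp: \<pi>_def arcs')
    then show ?thesis by blast
  qed (simp add: \<pi>_def)
  have fwd: "(\<pi> u, \<pi> v) \<in> (parcs G')\<^sup>*" if "(u, v) \<in> (parcs G)\<^sup>*" for u v
    using that by (induct rule: rtrancl_induct) (auto intro: rtrancl_trans fwd1)
  have eq: "(u, v) \<in> (parcs G)\<^sup>*" if "u \<in> pverts G" "v \<in> pverts G" "\<pi> u = \<pi> v" for u v
    using that C(3)[of u v] z by (auto simp: \<pi>_def split: if_splits)
  \<comment> \<open>An arc at \<open>z\<close> comes from an arc at some \<open>j \<in> C\<close>,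
    and strong connectivity of \<open>C\<close> joins \<open>j\<close> to whichever of
    \<open>u\<close> and \<open>v\<close> was collapsed.\<close>
  have bwd1: "(u, v) \<in> (parcs G)\<^sup>*"
    if uv: "u \<in> pverts G" "v \<in> pverts G" and arc: "(\<pi> u, \<pi> v) \<in> parcs G'" for u v
  proof -
    consider "(\<pi> u, \<pi> v) \<in> parcs G" "\<pi> u \<notin> C" "\<pi> v \<notin> C"
      | j where "\<pi> u = z" "\<pi> v \<in> pverts G - C" "j \<in> C" "(j, \<pi> v) \<in> parcs G"
      | j where "\<pi> v = z" "\<pi> u \<in> pverts G - C" "j \<in> C" "(\<pi> u, j) \<in> parcs G"
      using arc unfolding arcs' by blast
    then show ?thesis
    proof cases
      case 1
      then have "\<pi> u \<noteq> z" "\<pi> v \<noteq> z" using wf z by auto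
      then show ?thesis using 1 by (auto simp: \<pi>_def split: if_splits)
    next
      case 2
      then have "u \<in> C" "\<pi> v = v" using uv z by (auto simp: \<pi>_def split: if_splits)
      then show ?thesis using C(3)[of u j] 2(3,4) by (metis rtrancl.rtrancl_into_rtrancl)
    next
      case 3
      then have "v \<in> C" "\<pi> u = u" using uv z by (auto simp: \<pi>_def split: if_splits)
      then show ?thesis using C(3)[of j v] 3(3,4) by (metis converse_rtrancl_into_rtrancl)
    qed
  qed
  have bwd: "(u, v) \<in> (parcs G)\<^sup>*"
    if "(a, b) \<in> (parcs G')\<^sup>*" "u \<in> pverts G" "v \<in> pverts G" "\<pi> u = a" "\<pi> v = b" for a b u v
    using that
  proof (induct arbitrary: v rule: rtrancl_induct)
    case base
    then show ?case using eq by simp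
  next
    case (step b c)
    have "b \<in> pverts G'" using step(2) \<open>loopfree_fin G'\<close> unfolding loopfree_fin_def by blast
    then have "b \<in> \<pi> ` pverts G" by (simp only: onto)
    then obtain w where w: "w \<in> pverts G" "\<pi> w = b" by (elim imageE) simp
    have "(u, w) \<in> (parcs G)\<^sup>*" using step(3)[OF step(4) w(1) step(6) w(2)] .
    moreover have "(w, v) \<in> (parcs G)\<^sup>*" using bwd1[OF w(1) step(5)] step(2,7) w(2) by simp
    ultimately show ?case by (rule rtrancl_trans)
  qed
  show "reach_quotient G G'" unfolding reach_quotient_def
    using onto fwd bwd by (intro exI[of _ \<pi>]) blast
qed

lemma shrink_steps_props:
  assumes "shrink_step\<^sup>*\<^sup>* G G'" "loopfree_fin G"
  shows "loopfree_fin G' \<and> reach_quotient G G'"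
  using assms
  by (induct rule: rtranclp_induct) (auto intro: reach_quotient_refl reach_quotient_trans dest: shrink_step_props)

lemma acyclic_simple:
  assumes G: "loopfree_fin G" and ac: "acyclic_digraph G"
  shows "simple_digraph G"
  unfolding simple_digraph_def
proof (intro conjI allI impI notI)
  interpret pair_digraph G by (rule loopfree_fin_pair_digraph[OF G])
  show "pair_digraph G" by unfold_locales
  fix u v assume uv: "(u, v) \<in> parcs G" "(v, u) \<in> parcs G"
  have "cycle [(u, v), (v, u)]"
    unfolding cycle_def awalk_def using uv in_arcsD1[OF uv(1)] G
    by (intro exI[of _ u]) (auto simp: loopfree_fin_def)
  with ac show False unfolding acyclic_digraph_def by blast
qed (use G in \<open>auto simp: loopfree_fin_def\<close>)

text \<open>Each shrinking loses a vertex, so the process stops, and an infinite type always has a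
  fresh vertex to offer.\<close>

lemma star_exists:
  fixes G :: "'v pair_pre_digraph"
  assumes "infinite (UNIV :: 'v set)" and G: "loopfree_fin G"
  shows "\<exists>H. is_star G H"
proof -
  have "\<exists>G'. shrink_step\<^sup>*\<^sup>* G G' \<and> acyclic_digraph G'"
    using G
  proof (induct "card (pverts G)" arbitrary: G rule: less_induct)
    case less
    show ?case
    proof (cases "acyclic_digraph G")
      case False
      then obtain p where p: "pre_digraph.cycle (with_proj G) p" by (auto simp: acyclic_digraph_def)
      have "finite (pverts G)" using less(2) by (simp add: loopfree_fin_def)
      then obtain z where "z \<notin> pverts G"
        using ex_new_if_finite[OF assms(1)] by blast
      then have step: "shrink_step G (shrink G p z)" using p unfolding shrink_step_def by blast
      obtain G' where "shrink_step\<^sup>*\<^sup>* (shrink G p z) G'" "acyclic_digraph G'"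
        using less(1)[OF shrink_step_props(2,1)[OF less(2) step]] by blast
      then show ?thesis using step by (meson converse_rtranclp_into_rtranclp)
    qed blast
  qed
  then obtain G' where "shrink_step\<^sup>*\<^sup>* G G'" "acyclic_digraph G'" by blast
  then show ?thesis
    using acyclic_simple shrink_steps_props[OF _ G] unfolding is_star_def by blast
qed

text \<open>Distinct vertices of a transitive closure are adjacent exactly if one reaches the other,
  so independent sets are antichains for reachability, and shrinking does not change the sizes of
  these.\<close>

lemma independence_number_star:
  assumes G: "loopfree_fin G" and H: "is_star G H"
  shows "independence_number H = Max {card A | A. reach_antichain G A}"
proof -
  obtain G' where G': "shrink_step\<^sup>*\<^sup>* G G'" and Ht: "H = transitive_closure G'"
    using H by (auto simp: is_star_def)
  have eq: "A \<subseteq> pverts H \<and> (\<forall>x\<in>A. \<forall>y\<in>A. (x, y) \<notin> parcs H) \<longleftrightarrow> reach_antichain G' A" for A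
    unfolding reach_antichain_def Ht transitive_closure_def by (auto simp: rtrancl_eq_or_trancl)
  have "reach_quotient G G'" using shrink_steps_props[OF G' G] by simp
  then show ?thesis
    unfolding independence_number_def by (simp only: eq reach_quotient_antichain)
qed

section \<open>The ideal of a digraph\<close>

locale fin_digraph_hom =
  fixes G :: "'v::{linorder, countable} pair_pre_digraph" and m :: nat
  assumes G: "loopfree_fin G" and m: "m \<ge> 1"
begin

abbreviation reach :: "'v \<Rightarrow> 'v \<Rightarrow> bool"
  where "reach u v \<equiv> (u, v) \<in> (parcs G)\<^sup>*"

text \<open>Components are represented by their least vertices, so that the poset lies in the vertex
  type and inherits its linear order and countability.\<close>

definition rep :: "'v \<Rightarrow> 'v"
  where "rep v = Min {u \<in> pverts G. reach u v \<and> reach v u}"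

definition reps :: "'v set"
  where "reps = rep ` pverts G"

definition label :: "'v \<times> nat \<Rightarrow> ('v \<times> nat \<Rightarrow>\<^sub>0 nat)"
  where "label = (\<lambda>(c, j). \<Sum>v | v \<in> pverts G \<and> rep v = c. Poly_Mapping.single (v, j) 1)"

lemma finV: "finite (pverts G)"
  using G by (simp add: loopfree_fin_def)

lemma rep: "rep v \<in> pverts G" "reach (rep v) v" "reach v (rep v)" if "v \<in> pverts G"
proof -
  have "rep v \<in> {u \<in> pverts G. reach u v \<and> reach v u}"
    unfolding rep_def using finV that by (intro Min_in) auto
  then show "rep v \<in> pverts G" "reach (rep v) v" "reach v (rep v)" by auto
qed

lemma rep_eq: "reach u v \<Longrightarrow> reach v u \<Longrightarrow> rep u = rep v"
proof -
  assume "reach u v" "reach v u"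
  then have "{w \<in> pverts G. reach w u \<and> reach u w} = {w \<in> pverts G. reach w v \<and> reach v w}"
    by (auto intro: rtrancl_trans)
  then show ?thesis by (simp add: rep_def)
qed

lemma reps_sub: "reps \<subseteq> pverts G"
  using rep(1) by (auto simp: reps_def)

lemma rep_rep: "c \<in> reps \<Longrightarrow> rep c = c"
  unfolding reps_def using rep rep_eq by blast

lemma reach_rep: "u \<in> pverts G \<Longrightarrow> v \<in> pverts G \<Longrightarrow> reach (rep u) (rep v) \<longleftrightarrow> reach u v"
  using rep(2,3) by (meson rtrancl_trans)

lemma lookup_label:
  "Poly_Mapping.lookup (label (c, j)) x = (if fst x \<in> pverts G \<and> rep (fst x) = c \<and> snd x = j then 1 else 0)"
proof -
  have "Poly_Mapping.lookup (label (c, j)) x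
      = (\<Sum>v | v \<in> pverts G \<and> rep v = c. if v = fst x then if snd x = j then 1 else 0 else 0)"
    unfolding label_def by (auto simp: lookup_sum lookup_single when_def prod_eq_iff intro!: sum.cong)
  then show ?thesis using finV by simp
qed

lemma keys_label_eq: "Poly_Mapping.keys (label (c, j)) = {v \<in> pverts G. rep v = c} \<times> {j}"
  by (auto simp: in_keys_iff lookup_label split: if_splits)

sublocale multihom reps reach m
proof
  show "finite reps" using finV by (simp add: reps_def)
  show "a = b" if "a \<in> reps" "b \<in> reps" "reach a b" "reach b a" for a b
    using rep_eq[OF that(3,4)] rep_rep that(1,2) by simp
qed (rule rtrancl_trans)

sublocale cell_res_nontrivial reps reach m label "pverts G \<times> {1..m}"
proof
  show "finite cells" by (rule fin_cells)
  fix e assume e: "e \<in> cells"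
  obtain c j where cj: "e = (c, j)" by (cases e)
  then have c: "c \<in> reps" "j \<in> {1..m}" using e by (auto simp: cells_def)
  show "Poly_Mapping.keys (label e) \<subseteq> pverts G \<times> {1..m}" using c by (auto simp: cj keys_label_eq)
  have "(c, j) \<in> Poly_Mapping.keys (label e)" using c reps_sub rep_rep by (auto simp: cj keys_label_eq)
  then show "label e \<noteq> 0" by auto
  fix e' assume "e' \<in> cells" "e \<noteq> e'"
  then show "Poly_Mapping.keys (label e) \<inter> Poly_Mapping.keys (label e') = {}"
    by (cases e') (auto simp: cj keys_label_eq)
qed (rule m)

lemma pverts_D: "pverts (D m) = {1..m}"
  by (simp add: D_def)

lemma WHom_iff: "\<phi> \<in> WHom G (D m) \<longleftrightarrow>
    \<phi> \<in> pverts G \<rightarrow>\<^sub>E {1..m} \<and> (\<forall>(x, y)\<in>parcs G. \<phi> x \<le> \<phi> y)"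
proof -
  have wf: "parcs G \<subseteq> pverts G \<times> pverts G" using G by (simp add: loopfree_fin_def)
  have "(\<phi> x = \<phi> y \<or> (\<phi> x, \<phi> y) \<in> parcs (D m)) \<longleftrightarrow> \<phi> x \<le> \<phi> y"
    if "\<phi> \<in> pverts G \<rightarrow>\<^sub>E {1..m}" "(x, y) \<in> parcs G" for x y
  proof -
    have "\<phi> x \<in> {1..m}" "\<phi> y \<in> {1..m}" using that wf by auto
    then show ?thesis by (auto simp: D_def)
  qed
  then show ?thesis unfolding WHom_def pverts_D by fastforce
qed

lemma WHom_reach:
  assumes \<phi>: "\<phi> \<in> WHom G (D m)" and "reach u v"
  shows "\<phi> u \<le> \<phi> v"
  using assms(2)
proof (induct rule: rtrancl_induct)
  case (step y z)
  then have "\<phi> y \<le> \<phi> z" using \<phi> by (auto simp: WHom_iff)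
  with step show ?case by simp
qed simp

lemma WHom_rep: "\<phi> \<in> WHom G (D m) \<Longrightarrow> v \<in> pverts G \<Longrightarrow> \<phi> (rep v) = \<phi> v"
  using WHom_reach rep(2,3) by (metis antisym)

lemma hom_monomial_eq: "hom_monomial G \<phi> = mon (\<Sum>v\<in>pverts G. Poly_Mapping.single (v, \<phi> v) 1)"
proof -
  have "(\<Prod>v\<in>A. indet (v, \<phi> v)) = mon (\<Sum>v\<in>A. Poly_Mapping.single (v, \<phi> v) 1)" for A
    by (induct A rule: infinite_finite_induct) (simp_all add: indet_def mon_add)
  then show ?thesis by (simp add: hom_monomial_def)
qed

text \<open>Regrouping the vertices by components matches the label of a vertex of the complex with
  the exponent of the monomial of \<phi>.\<close>

lemma lab_graph:
  assumes "\<And>v. v \<in> pverts G \<Longrightarrow> \<phi> (rep v) = \<phi> v"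
  shows "lab ((\<lambda>c. (c, \<phi> c)) ` reps) = (\<Sum>v\<in>pverts G. Poly_Mapping.single (v, \<phi> v) 1)"
proof -
  have "lab ((\<lambda>c. (c, \<phi> c)) ` reps) = (\<Sum>c\<in>reps. label (c, \<phi> c))"
    unfolding lab_def by (subst sum.reindex) (auto simp: inj_on_def)
  also have "\<dots> = (\<Sum>c\<in>reps. \<Sum>v | v \<in> pverts G \<and> rep v = c. Poly_Mapping.single (v, \<phi> v) 1)"
    unfolding label_def using assms by (auto intro!: sum.cong)
  also have "\<dots> = (\<Sum>v\<in>pverts G. Poly_Mapping.single (v, \<phi> v) 1)"
    by (rule sum.group) (use finV finP in \<open>auto simp: reps_def\<close>)
  finally show ?thesis .
qed

text \<open>A weak homomorphism is constant on mutually reachable vertices, so its values at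
  representatives determine it; conversely, a monotone map on representatives extends along
  \<open>rep\<close>.\<close>

lemma deg_zero_graph:
  "deg 0 = (\<lambda>\<phi>. (\<lambda>c. (c, \<phi> c)) ` reps) ` WHom G (D m)"
proof (intro equalityI subsetI)
  fix T assume "T \<in> (\<lambda>\<phi>. (\<lambda>c. (c, \<phi> c)) ` reps) ` WHom G (D m)"
  then obtain \<phi> where \<phi>: "\<phi> \<in> WHom G (D m)" and T: "T = (\<lambda>c. (c, \<phi> c)) ` reps" by blast
  have "\<phi> c \<in> {1..m}" if "c \<in> reps" for c using \<phi> that reps_sub unfolding WHom_iff by blast
  then have "T \<subseteq> cells" unfolding T cells_def by auto
  moreover have "fst ` T = reps" by (simp add: T image_image)
  moreover have "\<forall>(c, i)\<in>T. \<forall>(d, j)\<in>T. reach c d \<longrightarrow> c \<noteq> d \<longrightarrow> i \<le> j"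
    using WHom_reach[OF \<phi>] by (auto simp: T)
  ultimately have "adm T" unfolding adm_def by blast
  moreover have "card T = card reps" unfolding T by (rule card_image) (auto simp: inj_on_def)
  ultimately show "T \<in> deg 0" by (simp add: deg_def)
next
  fix T assume T: "T \<in> deg 0"
  then have adm: "adm T" and card: "card T = card reps" by (auto simp: deg_def)
  then have fstT: "fst ` T = reps" by (simp add: adm_def)
  have inj: "inj_on fst T" using card fstT adm_finite[OF adm] by (intro eq_card_imp_inj_on) auto
  obtain \<psi> where \<psi>: "(c, \<psi> c) \<in> T" if "c \<in> reps" for c using adm_fibre[OF adm] by metis
  \<comment> \<open>\<open>WHom\<close> consists of extensional functions, hence the value
    \<open>undefined\<close> off the vertices.\<close>
  define \<phi> where "\<phi> v = (if v \<in> pverts G then \<psi> (rep v) else undefined)" for v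
  have rV: "rep v \<in> reps" if "v \<in> pverts G" for v using that by (simp add: reps_def)
  have "\<phi> \<in> pverts G \<rightarrow>\<^sub>E {1..m}"
    using \<psi> rV adm_sub[OF adm] by (fastforce simp: \<phi>_def cells_def)
  moreover have "\<phi> x \<le> \<phi> y" if xy: "(x, y) \<in> parcs G" for x y
  proof -
    have V: "x \<in> pverts G" "y \<in> pverts G" using xy G by (auto simp: loopfree_fin_def)
    have "reach (rep x) (rep y)" using reach_rep[OF V] xy by blast
    then show ?thesis
      using \<psi>[OF rV[OF V(1)]] \<psi>[OF rV[OF V(2)]] adm V unfolding adm_def \<phi>_def by fastforce
  qed
  ultimately have "\<phi> \<in> WHom G (D m)" unfolding WHom_iff by blast
  moreover have "T = (\<lambda>c. (c, \<phi> c)) ` reps"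
  proof -
    have 1: "(\<lambda>c. (c, \<phi> c)) ` reps \<subseteq> T"
      using \<psi> reps_sub rep_rep by (auto simp: \<phi>_def)
    have "card ((\<lambda>c. (c, \<phi> c)) ` reps) = card T"
      unfolding card by (rule card_image) (auto simp: inj_on_def)
    then show ?thesis using card_subset_eq[OF adm_finite[OF adm] 1] by simp
  qed
  ultimately show "T \<in> (\<lambda>\<phi>. (\<lambda>c. (c, \<phi> c)) ` reps) ` WHom G (D m)" by blast
qed

lemma gens_eq: "gens = hom_monomial G ` WHom G (D m)"
  unfolding gens_def deg_zero_graph image_image hom_monomial_eq
  by (intro image_cong refl arg_cong[of _ _ mon] lab_graph WHom_rep)

lemma antichain_iff: "antichain A \<longleftrightarrow> A \<subseteq> reps \<and> reach_antichain G A"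
  unfolding antichain_def reach_antichain_def using reps_sub by blast

lemma rep_antichain:
  assumes A: "reach_antichain G A"
  shows "antichain (rep ` A)" "card (rep ` A) = card A"
proof -
  have AV: "A \<subseteq> pverts G" using A by (simp add: reach_antichain_def)
  have "inj_on rep A"
  proof (rule inj_onI)
    fix x y assume xy: "x \<in> A" "y \<in> A" "rep x = rep y"
    then have "reach x y" using reach_rep[of x y] AV by auto
    then show "x = y" using A xy unfolding reach_antichain_def by blast
  qed
  then show "card (rep ` A) = card A" by (rule card_image)
  show "antichain (rep ` A)" unfolding antichain_def
  proof (intro conjI ballI impI)
    show "rep ` A \<subseteq> reps" using AV by (auto simp: reps_def)
    fix x' y' assume "x' \<in> rep ` A" "y' \<in> rep ` A" "x' \<noteq> y'"
    then obtain x y where "x \<in> A" "y \<in> A" "x' = rep x" "y' = rep y" "x \<noteq> y" by blast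
    then show "\<not> reach x' y'" using A reach_rep[of x y] AV unfolding reach_antichain_def by blast
  qed
qed

theorem proj_dim_hom_ideal:
  "proj_dim (hom_ring G (D m) :: ('v \<times> nat, 'k::field) mpoly ring)
      (ideal_module (hom_ring G (D m)) (hom_ideal G (D m)))
    = enat (Max {card A | A. reach_antichain G A} * (m - 1))"
proof -
  let ?C = "{card A | A. reach_antichain G A}"
  have fin: "finite ?C"
    by (rule finite_subset[of _ "card ` Pow (pverts G)"]) (use finV in \<open>auto simp: reach_antichain_def\<close>)
  have "reach_antichain G {}" by (simp add: reach_antichain_def)
  then have "?C \<noteq> {}" by blast
  from Max_in[OF fin this] obtain A where A: "reach_antichain G A" "card A = Max ?C" by auto
  have "card B \<le> card (rep ` A)" if "antichain B" for B
  proof -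
    have "card B \<in> ?C" using that by (auto simp: antichain_iff)
    then show ?thesis using Max_ge[OF fin] rep_antichain(2)[OF A(1)] A(2) by simp
  qed
  from proj_dim_gens[OF rep_antichain(1)[OF A(1)] this, where 'k = 'k]
  show ?thesis
    by (simp add: hom_ring_def hom_ideal_def pverts_D gens_eq rep_antichain(2)[OF A(1)] A(2))
qed

end

text \<open>Existence of an outcome is claimed as well, because otherwise the formula for all
  outcomes could hold vacuously.\<close>

theorem theorem3p16:
  fixes G :: "nat pair_pre_digraph" and n m :: nat
  assumes "simple_digraph G" and "pverts G = {1..n}" and "m \<ge> 1"
  shows "(\<exists>H. is_star G H) \<and>
    (\<forall>H. is_star G H \<longrightarrow>
      proj_dim (hom_ring G (D m) :: (nat \<times> nat, 'k::field) mpoly ring)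
          (ideal_module (hom_ring G (D m)) (hom_ideal G (D m)))
        = enat (independence_number H * (m - 1)))"
proof -
  have G: "loopfree_fin G" by (rule simple_digraph_loopfree_fin[OF assms(1)])
  interpret fin_digraph_hom G m by unfold_locales (rule G assms(3))+
  show ?thesis
    using star_exists[OF infinite_UNIV_nat G] proj_dim_hom_ideal independence_number_star[OF G] by simp
qed

end
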